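(* Let $\alpha>-1/2$. There exists $\varepsilon_0>0$ such that for every $0<\varepsilon<\varepsilon_0$ there is a constant $C$, depending only on $\varepsilon$ and $\alpha$, such that whenever $S$ and $\Sigma$ are $(\varepsilon,\alpha)$-thin subsets of $\mathbb{R}^+$, every $f\in L^2_\alpha(\mathbb{R}^+)$ satisfies $$\|f\|_{L^2_\alpha}\le C\Big(\|f\|_{L^2_\alpha(\mathbb{R}^+\setminus S)}+\|\mathcal{F}_\alpha(f)\|_{L^2_\alpha(\mathbb{R}^+\setminus\Sigma)}\Big).$$
   Context: Fix $\alpha>-1/2$. Let $d\mu_\alpha(x)=(2\pi)^{\alpha+1}x^{2\alpha+1}\,dx$ on $\mathbb{R}^+=[0,\infty)$, and $L^2_\alpha(\mathbb{R}^+)=L^2(\mathbb{R}^+,\mu_\alpha)$; for $A\subset\mathbb{R}^+$, $\|g\|_{L^2_\alpha(A)}=(\int_A|g|^2d\mu_\alpha)^{1/2}$. The normalized Bessel function is $j_\alpha(x)=J_\alpha(x)/x^\alpha=2^{-\alpha}\sum_{n\ge0}\frac{(-1)^n}{n!\Gamma(n+\alpha+1)}(x/2)^{2n}$. For $f\in L^1_\alpha(\mathbb{R}^+)$ the Fourier-Bessel transform is $\mathcal{F}_\alpha(f)(y)=\int_0^\infty f(x)j_\alpha(2\pi xy)\,d\mu_\alpha(x)$; it extends to a unitary operator on $L^2_\alpha(\mathbb{R}^+)$. For $\varepsilon\in(0,1)$, a measurable set $S\subset\mathbb{R}^+$ is $(\varepsilon,\alpha)$-thin if $\mu_\alpha(S\cap[x,x+1])\le\varepsilon\,\mu_\alpha([x,x+1])$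 for all $0\le x\le1$, and $\mu_\alpha(S\cap[x,x+\frac1x])\le\varepsilon\,\mu_\alpha([x,x+\frac1x])$ for all $x>1$. *)

theory Defs
  imports "HOL-Analysis.Analysis"
begin

text \<open>Normalized Bessel function j_alpha(x) = J_alpha(x)/x^alpha, via its power series.\<close>
definition bessel_j :: "real \<Rightarrow> real \<Rightarrow> real" where
  "bessel_j \<alpha> x = 2 powr (-\<alpha>) *
     (\<Sum>n. (-1) ^ n / (fact n * Gamma (real n + \<alpha> + 1)) * (x / 2) ^ (2 * n))"

definition mu :: "real \<Rightarrow> real measure" where
  "mu \<alpha> = density lebesgue
     (\<lambda>x. indicator {0..} x * ennreal ((2 * pi) powr (\<alpha> + 1) * x powr (2 * \<alpha> + 1)))"

definition L2 :: "real \<Rightarrow> (real \<Rightarrow> complex) \<Rightarrow> bool" where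
  "L2 \<alpha> f \<longleftrightarrow> f \<in> borel_measurable (mu \<alpha>) \<and>
     (\<integral>\<^sup>+ x. ennreal ((cmod (f x))\<^sup>2) \<partial>mu \<alpha>) < \<infinity>"

definition L2norm :: "real \<Rightarrow> real set \<Rightarrow> (real \<Rightarrow> complex) \<Rightarrow> real" where
  "L2norm \<alpha> A g = sqrt (enn2real (\<integral>\<^sup>+ x. indicator A x * ennreal ((cmod (g x))\<^sup>2) \<partial>mu \<alpha>))"

definition FB :: "real \<Rightarrow> (real \<Rightarrow> complex) \<Rightarrow> real \<Rightarrow> complex" where
  "FB \<alpha> f y = (\<integral> x. f x * complex_of_real (bessel_j \<alpha> (2 * pi * x * y)) \<partial>mu \<alpha>)"

text \<open>g is the (Plancherel) L^2 Fourier-Bessel transform of f: the L^2 limit of the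
  transforms of the truncations f * 1_[0,R] (which are in L^1_alpha) as R goes to infinity.\<close>
definition FB_L2 :: "real \<Rightarrow> (real \<Rightarrow> complex) \<Rightarrow> (real \<Rightarrow> complex) \<Rightarrow> bool" where
  "FB_L2 \<alpha> f g \<longleftrightarrow> L2 \<alpha> g \<and>
     ((\<lambda>R. L2norm \<alpha> UNIV (\<lambda>y. FB \<alpha> (\<lambda>x. f x * indicator {0..R} x) y - g y)) \<longlongrightarrow> 0) at_top"

definition thin :: "real \<Rightarrow> real \<Rightarrow> real set \<Rightarrow> bool" where
  "thin \<alpha> \<epsilon> S \<longleftrightarrow> S \<in> sets lebesgue \<and> S \<subseteq> {0..} \<and>
     (\<forall>x. 0 \<le> x \<and> x \<le> 1 \<longrightarrow>
        measure (mu \<alpha>) (S \<inter> {x..x+1}) \<le> \<epsilon> * measure (mu \<alpha>) {x..x+1}) \<and>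
     (\<forall>x. x > 1 \<longrightarrow>
        measure (mu \<alpha>) (S \<inter> {x..x+1/x}) \<le> \<epsilon> * measure (mu \<alpha>) {x..x+1/x})"

end

theory Submission
  imports Defs
begin

text \<open>
  Let \<open>p\<^sub>t(x,y)\<close> be the heat kernel of the Bessel operator, so that the transform of
  \<open>exp (- \<pi> t y\<^sup>2)\<close> times the transform of \<open>f\<close> is \<open>P\<^sub>t f\<close>. With \<open>X = 1 + x\<^sup>2\<close>, \<open>Y = 1 + y\<^sup>2\<close> and \<open>g\<close> the transform
  of \<open>f\<close>, put
  \<open>\<Phi>(s) = \<integral>\<integral> exp (- \<pi> s (X + Y)) f(x) j(2 \<pi> x y) g(y) d\<mu>(x) d\<mu>(y)\<close>.
  Then \<open>\<Phi>(s)\<close> tends to \<open>\<parallel>f\<parallel>\<^sup>2\<close> as \<open>s\<close> tends to \<open>0\<close>, \<open>\<Phi>(1) \<le> \<parallel>f\<parallel>\<^sup>2 / 4\<close>, and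
  \<open>\<Phi>(s) - \<Phi>(2s)\<close> is a quadratic form in \<open>f\<close> with kernel about \<open>(exp (- \<pi> s X) - exp (- 2 \<pi> s X)) p\<^sub>s(x,y)\<close>
  plus a quadratic form of the same shape in \<open>g\<close>. Summing over \<open>s = 2\<^sup>-\<^sup>n\<close> gives a kernel which at \<open>x\<close>
  averages over \<open>|y\<^sup>2 - x\<^sup>2| = O(1)\<close>, that is, at the scale of the thinness condition; its mass on a
  thin set is small, so Schur's test bounds both forms by a small multiple of \<open>\<parallel>f\<parallel>\<^sup>2\<close> plus the
  contributions of the complements of \<open>S\<close> and \<open>\<Sigma>\<close>.
\<close>

text \<open>Near a point \<open>x\<close> the thinness condition looks at length about
  \<open>1 / x\<close>, so no single heat time fits: resolving that length takes a time of order
  \<open>1 / (1 + x^2)\<close>, which varies with the point. Each difference of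
  \<open>\<Phi>\<close> at consecutive dyadic times carries a weight concentrated where
  \<open>s * (1 + x^2)\<close> is of order one, so the dyadic sum selects the right time at every
  point, for \<open>f\<close> and for its transform alike. The price is a kernel that is not
  symmetric, its weight depending on \<open>x\<close> alone: its rows telescope, while its columns
  need the separate estimate \<open>ker_column\<close>. The mass, the second moment and the duality
  of the heat kernel all come from the one formula \<open>weber\<close>, because exponentials in
  \<open>y^2\<close> integrate in closed form; this is also why distances are measured by
  \<open>y^2 - x^2\<close>. The summand 1 in \<open>1 + x^2\<close> makes both damping factors at
  time 1 at most 1/2, whence the 1/4. Schur's test is tuned to 1/8 for each of the two forms, so
  that 1/2 of the norm is left on the right and can be absorbed. Absorption needs a finite norm and
  the limit at time zero needs some continuity, so the argument runs first on truncated continuous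
  functions and then extends by density.\<close>

lemma has_sum_times:
  fixes f :: "'a \<Rightarrow> real" and g :: "'b \<Rightarrow> real"
  assumes f: "(f has_sum a) A" and g: "(g has_sum b) C"
  shows "((\<lambda>(x, y). f x * g y) has_sum (a * b)) (A \<times> C)"
proof -
  have fs: "(\<lambda>x. norm (f x)) summable_on A" "(\<lambda>x. norm (g x)) summable_on C"
    by (rule summable_on_iff_abs_summable_on_real[THEN iffD1, OF has_sum_imp_summable[OF f]],
        rule summable_on_iff_abs_summable_on_real[THEN iffD1, OF has_sum_imp_summable[OF g]])
  have "(\<lambda>p. norm (case p of (x, y) \<Rightarrow> f x * g y)) summable_on (A \<times> C)"
    using fs by (subst Infinite_Sum.abs_summable_on_Sigma_iff)
      (auto simp: abs_mult infsum_cmult_right' intro!: summable_on_cmult_right summable_on_cmult_left)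
  then have s: "(\<lambda>(x, y). f x * g y) summable_on (A \<times> C)"
    by (subst summable_on_iff_abs_summable_on_real)
  show ?thesis
  proof (rule has_sum_SigmaI[OF _ _ s])
    show "((\<lambda>y. case (x, y) of (x, y) \<Rightarrow> f x * g y) has_sum (f x * b)) C" if "x \<in> A" for x
      using has_sum_cmult_right[OF g, of "f x"] by simp
    show "((\<lambda>x. f x * b) has_sum a * b) A"
      by (rule has_sum_cmult_left[OF f])
  qed
qed

lemma exp_has_sum: "((\<lambda>n. z ^ n / fact n) has_sum exp (z::real)) UNIV"
proof (rule norm_summable_imp_has_sum)
  show "summable (\<lambda>n. norm (z ^ n / fact n))"
    using summable_norm_exp[of z] by (simp add: divide_inverse mult.commute)
  show "(\<lambda>n. z ^ n / fact n) sums exp z"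
    using exp_converges[of z] by (simp add: divide_inverse mult.commute)
qed

text \<open>With \<open>p r = r / (1 + r)\<close>, increasing and bounded by 1, the increment
  \<open>p (2 * r) - p r\<close> is at least a sixth of \<open>min r (1 / r)\<close> at every scale,
  so the sum telescopes. The bound depends on neither \<open>a\<close> nor \<open>N\<close>.\<close>

lemma sum_dyadic_min_le:
  fixes a :: real
  assumes a: "a > 0"
  shows "(\<Sum>n=1..N. min (a / 2 ^ n) (1 / (a / 2 ^ n))) \<le> 6"
proof -
  define p where "p r = r / (1 + r)" for r :: real
  have step: "min r (1 / r) \<le> 6 * (p (2 * r) - p r)" if r: "r > 0" for r :: real
  proof -
    have "p (2 * r) - p r = r / ((1 + r) * (1 + 2 * r))"
      using r by (simp add: p_def divide_simps) (simp add: algebra_simps)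
    moreover have "min r (1 / r) * ((1 + r) * (1 + 2 * r)) \<le> 6 * r"
    proof (cases "r \<le> 1")
      case True
      then have "min r (1 / r) * ((1 + r) * (1 + 2 * r)) \<le> r * (2 * 3)"
        using r by (intro mult_mono) auto
      then show ?thesis by simp
    next
      case False
      then have "min r (1 / r) * ((1 + r) * (1 + 2 * r)) \<le> (1 / r) * ((2 * r) * (3 * r))"
        using r by (intro mult_mono) auto
      then show ?thesis using r by simp
    qed
    ultimately show ?thesis using r by (simp add: pos_le_divide_eq)
  qed
  have "(\<Sum>n=1..N. min (a / 2 ^ n) (1 / (a / 2 ^ n))) \<le> (\<Sum>n=1..N. 6 * (p (a / 2 ^ (n - 1)) - p (a / 2 ^ n)))"
  proof (rule sum_mono)
    fix n assume "n \<in> {1..N}"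
    then obtain m where m: "n = Suc m" by (cases n) auto
    show "min (a / 2 ^ n) (1 / (a / 2 ^ n)) \<le> 6 * (p (a / 2 ^ (n - 1)) - p (a / 2 ^ n))"
      using step[of "a / 2 ^ n"] a by (simp add: m)
  qed
  also have "\<dots> = 6 * (p a - p (a / 2 ^ N))"
    by (induction N) (auto simp: algebra_simps)
  also have "\<dots> \<le> 6 * (1 - 0)"
    using a by (intro mult_left_mono diff_mono) (auto simp: p_def add_pos_pos)
  finally show ?thesis by simp
qed

text \<open>A geometric series bounded by twice its largest term, made to telescope:
  \<open>p r = min r (2 * h)\<close> grows by exactly \<open>r\<close> from \<open>r\<close> to
  \<open>2 * r\<close> as long as \<open>r < h\<close>, and never exceeds
  \<open>2 * h\<close>.\<close>

lemma sum_dyadic_small_le: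
  fixes a :: real
  assumes a: "a > 0" and h: "h > 0"
  shows "(\<Sum>n\<in>{n\<in>{1..N}. a / 2 ^ n < h}. a / 2 ^ n) \<le> 2 * h"
proof -
  define p where "p r = min r (2 * h)" for r :: real
  have "(\<Sum>n\<in>{n\<in>{1..N}. a / 2 ^ n < h}. a / 2 ^ n) = (\<Sum>n=1..N. if a / 2 ^ n < h then a / 2 ^ n else 0)"
    by (intro sum.inter_filter) auto
  also have "\<dots> \<le> (\<Sum>n=1..N. p (a / 2 ^ (n - 1)) - p (a / 2 ^ n))"
  proof (rule sum_mono)
    fix n assume "n \<in> {1..N}"
    then obtain m where m: "n = Suc m" by (cases n) auto
    show "(if a / 2 ^ n < h then a / 2 ^ n else 0) \<le> p (a / 2 ^ (n - 1)) - p (a / 2 ^ n)"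
    proof -
      define r where "r = a / 2 ^ n"
      have "a / 2 ^ (n - 1) = 2 * r" by (simp add: r_def m)
      moreover have "r > 0" using a by (simp add: r_def)
      ultimately show ?thesis using h unfolding r_def[symmetric] p_def by (auto simp: min_def)
    qed
  qed
  also have "\<dots> = p a - p (a / 2 ^ N)"
    by (induction N) (auto simp: algebra_simps)
  also have "\<dots> \<le> 2 * h - 0" using a h by (intro diff_mono) (auto simp: p_def)
  also have "\<dots> = 2 * h" by simp
  finally show ?thesis .
qed

text \<open>Comparability in both directions serves the two signs of the exponent; the application
  has exponent \<alpha>, which may be negative.\<close>

lemma powr_between:
  fixes A Y L a :: real
  assumes "A > 0" "Y > 0" "A \<le> L * Y" "Y \<le> L * A" "L \<ge> 1"
  shows "A powr a \<le> L powr \<bar>a\<bar> * Y powr a"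
proof (cases "a \<ge> 0")
  case True
  have "A powr a \<le> (L * Y) powr a" using assms True by (intro powr_mono2) auto
  then show ?thesis using True assms by (simp add: powr_mult)
next
  case False
  have "L powr \<bar>a\<bar> * Y powr a = (Y / L) powr a"
    using False assms by (simp add: powr_divide powr_minus field_simps)
  moreover have "A powr a \<le> (Y / L) powr a" using False assms by (intro powr_mono2') (auto simp: field_simps)
  ultimately show ?thesis by simp
qed

text \<open>A function that is not integrable has Bochner integral 0 by convention, so the bound
  survives without an integrability hypothesis.\<close>

lemma ennreal_norm_integral_le:
  fixes f :: "'a \<Rightarrow> real"
  shows "ennreal \<bar>\<integral>x. f x \<partial>L\<bar> \<le> (\<integral>\<^sup>+x. ennreal \<bar>f x\<bar> \<partial>L)"
proof (cases "integrable L f")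
  case True
  then show ?thesis using integral_norm_bound_ennreal[of L f] by simp
qed (simp add: not_integrable_integral_eq)

lemma powr_le1: "1 \<le> x \<Longrightarrow> 0 \<le> b \<Longrightarrow> x powr (- b) \<le> (1::real)"
  using powr_mono[of "- b" 0 x] by simp

lemma exp_subseries:
  fixes z :: real
  assumes "z \<ge> 0"
  shows "summable (\<lambda>n. z ^ (2 * n + N) / fact (2 * n + N))"
    and "(\<Sum>n. z ^ (2 * n + N) / fact (2 * n + N)) \<le> exp z"
proof -
  have le: "(\<Sum>n<m. z ^ (2 * n + N) / fact (2 * n + N)) \<le> exp z" for m
  proof -
    have "(\<Sum>n<m. z ^ (2 * n + N) / fact (2 * n + N)) = (\<Sum>k\<in>(\<lambda>n. 2 * n + N) ` {..<m}. z ^ k / fact k)"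
      by (subst sum.reindex) (auto simp: inj_on_def)
    also have "\<dots> = (\<Sum>k\<in>(\<lambda>n. 2 * n + N) ` {..<m}. inverse (fact k) *\<^sub>R z ^ k)"
      by (simp add: field_simps)
    also have "\<dots> \<le> (\<Sum>k. inverse (fact k) *\<^sub>R z ^ k)"
      using assms by (intro sum_le_suminf summable_exp_generic) auto
    finally show ?thesis by (simp add: exp_def)
  qed
  show sm: "summable (\<lambda>n. z ^ (2 * n + N) / fact (2 * n + N))"
    using assms le by (intro summableI_nonneg_bounded[where x = "exp z"]) auto
  show "(\<Sum>n. z ^ (2 * n + N) / fact (2 * n + N)) \<le> exp z"
    by (intro suminf_le_const sm le)
qed

text \<open>Trades a second moment for two exponential moments, which Weber's integral evaluates in
  closed form.\<close>

lemma square_le_exp: "u\<^sup>2 \<le> 2 * (exp u + exp (- u))" for u :: real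
proof -
  have "v\<^sup>2 / 2 \<le> exp v" if "v \<ge> 0" for v :: real
    using exp_lower_Taylor_quadratic[OF that] that by linarith
  from this[of u] this[of "- u"] show ?thesis
    using exp_gt_zero[of u] exp_gt_zero[of "- u"] by (cases "u \<ge> 0") (auto simp del: exp_gt_zero)
qed

text \<open>Half of \<open>a\<close> can be subtracted because \<open>a\<close> is a real number;
  for infinite \<open>E\<close> there is nothing to show.\<close>

lemma absorb_half:
  assumes "ennreal a \<le> ennreal (1/2) * ennreal a + E" "a \<ge> 0"
  shows "ennreal a \<le> 2 * E"
proof (cases E)
  case (real e)
  have "ennreal (1/2 * a) = ennreal (1/2) * ennreal a" by (rule ennreal_mult) (use assms in auto)
  moreover have "ennreal (1/2 * a + e) = ennreal (1/2 * a) + ennreal e" by (rule ennreal_plus) (use assms real in auto)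
  ultimately have "ennreal a \<le> ennreal (1/2 * a + e)" using assms(1) real by (simp only:)
  then have "a \<le> 1/2 * a + e" using real assms by (subst (asm) ennreal_le_iff) auto
  then have "ennreal a \<le> ennreal (2 * e)" by (intro ennreal_leI) simp
  then show ?thesis using real by (simp add: ennreal_mult)
qed simp

locale hankel =
  fixes \<alpha> :: real
  assumes alpha: "\<alpha> > -1/2"
begin

subsection \<open>The power series of the Bessel function\<close>

definition coef :: "nat \<Rightarrow> real" where
  "coef n = 1 / (fact n * Gamma (real n + \<alpha> + 1))"

text \<open>The Bessel series as an entire function of \<open>w\<close>. Up to the factor
  \<open>(u / 2) powr \<alpha>\<close>, the argument \<open>- (u^2) / 4\<close> gives the Bessel
  function J of order \<alpha> at \<open>u\<close> and \<open>u^2 / 4\<close> gives the modified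
  function I, so the transform and the heat kernel use the same \<open>bes\<close>.\<close>

definition bes :: "real \<Rightarrow> real" where
  "bes w = (\<Sum>n. coef n * w ^ n)"

lemma Gamma_pos: "Gamma (real n + \<alpha> + 1) > 0"
  using alpha by (intro Gamma_real_pos) auto

lemma coef_pos: "coef n > 0"
  using Gamma_pos[of n] by (simp add: coef_def)

lemma pochhammer_ratio_le:
  "\<exists>C>0. \<forall>n. pochhammer (1/2) n / pochhammer (\<alpha> + 1) n \<le> C * (real n + 1) powr (-(\<alpha> + 1/2))"
proof -
  have nz: "\<alpha> + 1 \<notin> \<int>\<^sub>\<le>\<^sub>0" "(1/2::real) \<notin> \<int>\<^sub>\<le>\<^sub>0"
    using alpha by (auto elim!: nonpos_Ints_cases')
  have "(\<lambda>n. Gamma_series (\<alpha> + 1) n / Gamma_series (1/2) n) \<longlonglongrightarrow> Gamma (\<alpha> + 1) / Gamma (1/2)"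
    using nz by (intro tendsto_divide Gamma_series_LIMSEQ) (auto simp: Gamma_eq_zero_iff)
  then have "Bseq (\<lambda>n. Gamma_series (\<alpha> + 1) n / Gamma_series (1/2) n)"
    by (intro convergent_imp_Bseq convergentI)
  then obtain K where K: "K > 0" "\<And>n. norm (Gamma_series (\<alpha> + 1) n / Gamma_series (1/2) n) \<le> K"
    by (auto elim: BseqE)
  \<comment> \<open>\<open>K\<close> bounds a convergent Gamma quotient and serves
    \<open>n \<ge> 2\<close>, where \<open>n + 1 \<le> 3 * (n - 1)\<close> accounts for the power of
    3; the second entry covers \<open>n = 0\<close> and \<open>n = 1\<close>.\<close>
  define C where "C = max (K * 3 powr (\<alpha> + 1/2)) (2 powr (\<alpha> + 1/2))"
  have Cpos: "C > 0" by (simp add: C_def less_max_iff_disj)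
  have "pochhammer (1/2) n / pochhammer (\<alpha> + 1) n \<le> C * (real n + 1) powr (-(\<alpha> + 1/2))" for n
  proof -
    \<comment> \<open>\<open>Gamma_series\<close> at \<open>m\<close> contains the Pochhammer symbol
      of length \<open>m + 1\<close>, hence the shift; \<open>m = 0\<close> is set apart because
      \<open>ln m\<close> says nothing there.\<close>
    consider "n = 0" | "n = 1" | m where "n = Suc m" "m \<ge> 1"
      by (cases n; cases "n - 1") auto
    then show ?thesis
    proof cases
      case 1
      have "(2::real) powr (\<alpha> + 1/2) \<ge> 1" using alpha by (intro ge_one_powr_ge_zero) auto
      then show ?thesis using 1 by (simp add: C_def)
    next
      case 2
      have "1 = (2::real) powr (\<alpha> + 1/2) * 2 powr (-(\<alpha> + 1/2))"
        by (simp flip: powr_add)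
      also have "\<dots> \<le> C * 2 powr (-(\<alpha> + 1/2))" by (intro mult_right_mono) (auto simp: C_def)
      finally have "1 \<le> C * 2 powr (-(\<alpha> + 1/2))" .
      moreover have "(1/2) / (\<alpha> + 1) \<le> 1" using alpha by (simp add: field_simps)
      ultimately show ?thesis using 2 by simp
    next
      case 3
      have pp: "pochhammer (1/2::real) n > 0" "pochhammer (\<alpha> + 1) n > 0"
        using alpha by (auto intro!: pochhammer_pos)
      have "Gamma_series (\<alpha> + 1) m / Gamma_series (1/2) m =
          (exp ((\<alpha> + 1) * ln m) / exp (1/2 * ln m)) * (pochhammer (1/2) n / pochhammer (\<alpha> + 1) n)"
        using pp 3 by (simp add: Gamma_series_def field_simps)
      also have "exp ((\<alpha> + 1) * ln m) / exp (1/2 * ln m) = real m powr (\<alpha> + 1/2)"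
        using 3 by (simp add: powr_def algebra_simps flip: exp_diff)
      finally have "real m powr (\<alpha> + 1/2) * (pochhammer (1/2) n / pochhammer (\<alpha> + 1) n) \<le> K"
        using order_trans[OF abs_ge_self K(2)[of m, unfolded real_norm_def]] by simp
      then have "pochhammer (1/2) n / pochhammer (\<alpha> + 1) n \<le> K * real m powr (-(\<alpha> + 1/2))"
        using 3 by (simp add: powr_minus field_simps)
      also have "real m powr (-(\<alpha> + 1/2)) \<le> ((real n + 1) / 3) powr (-(\<alpha> + 1/2))"
        using 3 alpha by (intro powr_mono2') auto
      also have "((real n + 1) / 3) powr (-(\<alpha> + 1/2)) = 3 powr (\<alpha> + 1/2) * (real n + 1) powr (-(\<alpha> + 1/2))"
        by (simp add: powr_divide powr_minus field_simps)
      finally have "pochhammer (1/2) n / pochhammer (\<alpha> + 1) n \<le>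
          (K * 3 powr (\<alpha> + 1/2)) * (real n + 1) powr (-(\<alpha> + 1/2))" using K(1) by (simp add: mult_ac)
      also have "\<dots> \<le> C * (real n + 1) powr (-(\<alpha> + 1/2))"
        by (intro mult_right_mono) (auto simp: C_def)
      finally show ?thesis .
    qed
  qed
  with Cpos show ?thesis by blast
qed

text \<open>The duplication formula compares the coefficients with those of \<open>cosh\<close>.\<close>
lemma coef_le:
  "\<exists>C>0. \<forall>n. coef n \<le> C * (real n + 1) powr (-(\<alpha> + 1/2)) * 4 ^ n / fact (2 * n)"
proof -
  obtain C where C: "C > 0" "\<And>n. pochhammer (1/2) n / pochhammer (\<alpha> + 1) n \<le> C * (real n + 1) powr (-(\<alpha> + 1/2))"
    using pochhammer_ratio_le by blast
  have G: "Gamma (\<alpha> + 1) > 0" using Gamma_pos[of 0] by simp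
  have nz: "\<alpha> + 1 \<notin> \<int>\<^sub>\<le>\<^sub>0" 
    using alpha by (auto elim!: nonpos_Ints_cases')
  have "coef n \<le> C / Gamma (\<alpha> + 1) * (real n + 1) powr (-(\<alpha> + 1/2)) * 4 ^ n / fact (2 * n)" for n
  proof -
    have pp: "pochhammer (\<alpha> + 1) n > 0" "pochhammer (1/2::real) n > 0"
      using alpha by (auto intro!: pochhammer_pos)
    have "pochhammer (\<alpha> + 1) n = Gamma (real n + \<alpha> + 1) / Gamma (\<alpha> + 1)"
      using pochhammer_Gamma[OF nz, of n] by (simp add: add_ac)
    then have g: "Gamma (real n + \<alpha> + 1) = pochhammer (\<alpha> + 1) n * Gamma (\<alpha> + 1)" using G by simp
    have "(fact (2 * n) :: real) = 4 ^ n * pochhammer (1/2) n * fact n"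
      using fact_double[of n, where 'a = real] by (simp add: power_mult)
    moreover have "coef n = 1 / (fact n * (pochhammer (\<alpha> + 1) n * Gamma (\<alpha> + 1)))"
      unfolding coef_def g ..
    ultimately have "coef n = (pochhammer (1/2) n / pochhammer (\<alpha> + 1) n) * (4 ^ n / (fact (2 * n) * Gamma (\<alpha> + 1)))"
      using pp G by (simp add: field_simps)
    also have "\<dots> \<le> (C * (real n + 1) powr (-(\<alpha> + 1/2))) * (4 ^ n / (fact (2 * n) * Gamma (\<alpha> + 1)))"
      using G by (intro mult_right_mono C) auto
    finally show ?thesis by (simp add: field_simps)
  qed
  then show ?thesis using C(1) G by (intro exI[of _ "C / Gamma (\<alpha> + 1)"]) auto
qed

lemma bes_summable: "summable (\<lambda>n. norm (coef n * w ^ n))"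
proof -
  obtain C where C: "C > 0" "\<And>n. coef n \<le> C * (real n + 1) powr (-(\<alpha> + 1/2)) * 4 ^ n / fact (2 * n)"
    using coef_le by blast
  define z where "z = 2 * sqrt \<bar>w\<bar>"
  have z: "z ^ (2 * n) = 4 ^ n * \<bar>w\<bar> ^ n" for n
    by (simp add: z_def power_mult power_mult_distrib)
  have s: "summable (\<lambda>n. C * (z ^ (2 * n + 0) / fact (2 * n + 0)))"
    by (intro summable_mult exp_subseries) (simp add: z_def)
  have le: "norm (norm (coef n * w ^ n)) \<le> C * (z ^ (2 * n + 0) / fact (2 * n + 0))" for n
  proof -
    have "(real n + 1) powr (-(\<alpha> + 1/2)) \<le> 1"
      using alpha by (intro powr_le1) auto
    then have "C * (real n + 1) powr (-(\<alpha> + 1/2)) * 4 ^ n / fact (2 * n) \<le> C * 1 * 4 ^ n / fact (2 * n)"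
      using C(1) by (intro divide_right_mono mult_right_mono mult_left_mono) auto
    then have "coef n \<le> C * 4 ^ n / fact (2 * n)" using C(2)[of n] by simp
    then have "coef n * \<bar>w\<bar> ^ n \<le> C * 4 ^ n / fact (2 * n) * \<bar>w\<bar> ^ n"
      by (intro mult_right_mono) auto
    then show ?thesis using coef_pos[of n] z[of n] by (simp add: abs_mult power_abs mult_ac)
  qed
  show ?thesis by (rule summable_comparison_test[OF _ s]) (use le in blast)
qed

lemma bes_sums: "(\<lambda>n. coef n * w ^ n) sums bes w"
  unfolding bes_def by (intro summable_sums summable_norm_cancel[OF bes_summable])

lemma bes_mono: "0 \<le> v \<Longrightarrow> v \<le> w \<Longrightarrow> bes v \<le> bes w"
  unfolding bes_def using coef_pos
  by (intro suminf_le summable_norm_cancel[OF bes_summable] mult_left_mono power_mono) (auto simp: less_imp_le)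

lemma bes_pos: "w \<ge> 0 \<Longrightarrow> bes w > 0"
proof -
  assume "w \<ge> 0"
  have "bes 0 = coef 0" unfolding bes_def using suminf_finite[of "{0}" "\<lambda>n. coef n * 0 ^ n"] by simp
  then show ?thesis using bes_mono[of 0 w] coef_pos[of 0] \<open>w \<ge> 0\<close> by simp
qed

lemma abs_bes_le: "\<bar>bes w\<bar> \<le> bes \<bar>w\<bar>"
proof -
  have "norm (\<Sum>n. coef n * w ^ n) \<le> (\<Sum>n. norm (coef n * w ^ n))"
    by (intro summable_norm bes_summable)
  also have "(\<lambda>n. norm (coef n * w ^ n)) = (\<lambda>n. coef n * \<bar>w\<bar> ^ n)"
    using coef_pos by (auto simp: abs_mult power_abs less_imp_le)
  finally show ?thesis by (simp add: bes_def)
qed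

lemma continuous_on_bes [continuous_intros]: "continuous_on A g \<Longrightarrow> continuous_on A (\<lambda>x. bes (g x))"
proof -
  have "isCont bes w" for w
    unfolding bes_def
    by (rule isCont_powser[where K = "\<bar>w\<bar> + 1"]) (auto intro: summable_norm_cancel[OF bes_summable])
  then have "continuous_on UNIV bes" by (simp add: continuous_at_imp_continuous_on)
  then show "continuous_on A g \<Longrightarrow> continuous_on A (\<lambda>x. bes (g x))"
    by (rule continuous_on_compose2) auto
qed

lemma bes_measurable [measurable]: "bes \<in> borel_measurable borel"
  by (intro borel_measurable_continuous_onI continuous_intros)

text \<open>The factor \<open>(n + 1) powr - \<beta>\<close> of the coefficients is at most \<open>(1 + z) powr - \<beta>\<close> times \<open>1 + ((1 + z) / (n + 1)) ^ N\<close> for an integer \<open>N \<ge> \<beta>\<close>, and the power of \<open>1 / (n + 1)\<close> only shifts the exponential series.\<close>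
lemma bes_bound:
  "\<exists>C>0. \<forall>z\<ge>0. bes (z\<^sup>2 / 4) \<le> C * exp z * (1 + z) powr (-(\<alpha> + 1/2))"
proof -
  define \<beta> where "\<beta> = \<alpha> + 1/2"
  have b: "\<beta> > 0" using alpha by (simp add: \<beta>_def)
  define N where "N = nat \<lceil>\<beta>\<rceil>"
  have N: "\<beta> \<le> real N" using b by (simp add: N_def)
  obtain C where C: "C > 0" "\<And>n. coef n \<le> C * (real n + 1) powr (-\<beta>) * 4 ^ n / fact (2 * n)"
    using coef_le by (auto simp: \<beta>_def)
  define D where "D = C * (1 + 2 ^ N + 2 ^ N * (real N + 2) ^ N)"
  have "bes (z\<^sup>2 / 4) \<le> D * exp z * (1 + z) powr (-\<beta>)" if z: "z \<ge> 0" for z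
  proof -
    define q where "q n = z ^ (2 * n) / fact (2 * n)" for n
    have q0: "q n \<ge> 0" for n using z by (simp add: q_def)
    have sq: "summable q" "suminf q \<le> exp z" 
      using exp_subseries[OF z, of 0] by (simp_all add: q_def[abs_def])
    define r where "r n = z ^ (2 * n + N) / fact (2 * n + N)" for n
    have r0: "r n \<ge> 0" for n using z by (simp add: r_def)
    have sr: "summable r" "suminf r \<le> exp z" 
      using exp_subseries[OF z, of N] by (simp_all add: r_def[abs_def])
    have t: "coef n * (z\<^sup>2 / 4) ^ n \<le> (1 + z) powr (-\<beta>) * (C * ((1 + 2 ^ N) * q n + 2 ^ N * (real N + 2) ^ N * r n))" for n
    proof -
      define u where "u = (real n + 1) / (1 + z)"
      have u: "u > 0" using z by (simp add: u_def)
      have "u powr (-\<beta>) \<le> 1 + (1 / u) ^ N"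
      proof (cases "u \<ge> 1")
        case True
        then have "u powr (-\<beta>) \<le> 1" using b by (intro powr_le1) auto
        then show ?thesis using u by (smt (verit) zero_le_power divide_nonneg_nonneg)
      next
        case False
        have "u powr (-\<beta>) = (1 / u) powr \<beta>" using u by (simp add: powr_minus powr_divide field_simps)
        also have "\<dots> \<le> (1 / u) powr real N" using False u N by (intro powr_mono) auto
        also have "\<dots> = (1 / u) ^ N" using u by (subst powr_realpow) auto
        finally show ?thesis by simp
      qed
      moreover have "(real n + 1) powr (-\<beta>) = (1 + z) powr (-\<beta>) * u powr (-\<beta>)"
        using z by (simp add: u_def flip: powr_mult)
      ultimately have e1: "(real n + 1) powr (-\<beta>) \<le> (1 + z) powr (-\<beta>) * (1 + (1 / u) ^ N)"
        by (simp add: mult_left_mono)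
      have "(1 + z) ^ N \<le> 2 ^ N * (1 + z ^ N)"
      proof -
        have "(1 + z) ^ N \<le> (2 * max 1 z) ^ N" using z by (intro power_mono) auto
        also have "\<dots> = 2 ^ N * max 1 z ^ N" by (simp add: power_mult_distrib)
        also have "max 1 z ^ N \<le> 1 + z ^ N" using z by (auto simp: max_def)
        finally show ?thesis by simp
      qed
      then have "(1 / u) ^ N \<le> 2 ^ N * (1 + z ^ N) / (real n + 1) ^ N"
        by (simp add: u_def power_divide divide_right_mono)
      also have "\<dots> \<le> 2 ^ N + 2 ^ N * (z ^ N / (real n + 1) ^ N)"
      proof -
        have "2 ^ N * (1 + z ^ N) / (real n + 1) ^ N = 2 ^ N / (real n + 1) ^ N + 2 ^ N * (z ^ N / (real n + 1) ^ N)"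
          by (simp add: field_simps)
        moreover have "2 ^ N / (real n + 1) ^ N \<le> 2 ^ N" by (simp add: divide_le_eq)
        ultimately show ?thesis by simp
      qed
      finally have e2: "1 + (1 / u) ^ N \<le> (1 + 2 ^ N) + 2 ^ N * (z ^ N / (real n + 1) ^ N)" by simp
      \<comment> \<open>The left factorial has \<open>N\<close> factors more than that of
        \<open>2 * n\<close>, each at most \<open>2 * n + N \<le> (N + 2) * (n + 1)\<close>. This
        converts the negative power of \<open>n + 1\<close> into the shifted series
        \<open>r\<close>.\<close>
      have "(fact (2 * n + N) :: real) \<le> fact (2 * n) * ((real N + 2) ^ N * (real n + 1) ^ N)"
      proof -
        have "(fact (2 * n + N) :: real) \<le> fact (2 * n) * (real (2 * n + N)) ^ N"
        proof (induction N)
          case (Suc N)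
          have "(fact (2 * n + Suc N) :: real) = real (2 * n + Suc N) * fact (2 * n + N)" by simp
          also have "\<dots> \<le> real (2 * n + Suc N) * (fact (2 * n) * real (2 * n + N) ^ N)"
            by (intro mult_left_mono Suc) auto
          also have "\<dots> \<le> real (2 * n + Suc N) * (fact (2 * n) * real (2 * n + Suc N) ^ N)"
            by (intro mult_left_mono power_mono) auto
          finally show ?case by (simp add: mult_ac)
        qed simp
        also have "\<dots> \<le> fact (2 * n) * ((real N + 2) * (real n + 1)) ^ N"
          by (intro mult_left_mono power_mono) (auto simp: algebra_simps)
        finally show ?thesis by (simp add: power_mult_distrib)
      qed
      then have "z ^ (2 * n) * z ^ N * fact (2 * n + N)
          \<le> z ^ (2 * n) * z ^ N * (fact (2 * n) * ((real N + 2) ^ N * (real n + 1) ^ N))"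
        using z by (intro mult_left_mono) auto
      then have e3: "q n * (z ^ N / (real n + 1) ^ N) \<le> (real N + 2) ^ N * r n"
        using z unfolding q_def r_def power_add by (simp add: divide_simps mult_ac)
      have zz: "4 ^ n * (z\<^sup>2 / 4) ^ n = z ^ (2 * n)"
        by (simp add: power_divide power_mult)
      have "coef n * (z\<^sup>2 / 4) ^ n \<le> C * (real n + 1) powr (-\<beta>) * 4 ^ n / fact (2 * n) * (z\<^sup>2 / 4) ^ n"
        by (intro mult_right_mono C) auto
      also have "\<dots> = C * q n * (real n + 1) powr (-\<beta>)"
        unfolding q_def zz[symmetric] by (simp add: field_simps)
      also have "\<dots> \<le> C * q n * ((1 + z) powr (-\<beta>) * ((1 + 2 ^ N) + 2 ^ N * (z ^ N / (real n + 1) ^ N)))"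
        using C(1) q0[of n] by (intro mult_left_mono order_trans[OF e1] e2) auto
      also have "\<dots> = (1 + z) powr (-\<beta>) * (C * ((1 + 2 ^ N) * q n + 2 ^ N * (q n * (z ^ N / (real n + 1) ^ N))))"
        by (simp add: algebra_simps)
      also have "\<dots> \<le> (1 + z) powr (-\<beta>) * (C * ((1 + 2 ^ N) * q n + 2 ^ N * ((real N + 2) ^ N * r n)))"
        using C(1) by (intro mult_left_mono add_left_mono e3) auto
      finally show ?thesis by (simp add: mult_ac)
    qed
    have sm: "summable (\<lambda>n. (1 + z) powr (-\<beta>) * (C * ((1 + 2 ^ N) * q n + 2 ^ N * (real N + 2) ^ N * r n)))"
      by (intro summable_mult summable_add sq sr)
    have "bes (z\<^sup>2 / 4) \<le> (\<Sum>n. (1 + z) powr (-\<beta>) * (C * ((1 + 2 ^ N) * q n + 2 ^ N * (real N + 2) ^ N * r n)))"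
      unfolding bes_def by (intro suminf_le t sm summable_norm_cancel[OF bes_summable])
    also have "\<dots> = (1 + z) powr (-\<beta>) * (C * ((1 + 2 ^ N) * suminf q + 2 ^ N * (real N + 2) ^ N * suminf r))"
      using sq sr by (simp add: suminf_mult suminf_add[symmetric] summable_mult summable_add)
    also have "\<dots> \<le> (1 + z) powr (-\<beta>) * (C * ((1 + 2 ^ N) * exp z + 2 ^ N * (real N + 2) ^ N * exp z))"
      using C(1) sq sr by (intro mult_left_mono add_mono) auto
    finally show ?thesis by (simp add: D_def algebra_simps)
  qed
  moreover have "D > 0" using C(1) by (simp add: D_def add_pos_nonneg)
  ultimately show ?thesis unfolding \<beta>_def by blast
qed

lemma bessel_j_eq: "bessel_j \<alpha> u = 2 powr (-\<alpha>) * bes (- u\<^sup>2 / 4)"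
proof -
  have "(-1) ^ n / (fact n * Gamma (real n + \<alpha> + 1)) * (u / 2) ^ (2 * n) = coef n * (- u\<^sup>2 / 4) ^ n" for n
    by (simp add: coef_def power_mult power_divide power_minus' power_mult_distrib)
  then show ?thesis by (simp add: bessel_j_def bes_def)
qed

subsection \<open>Weber's integral\<close>

lemma bes_has_sum: "((\<lambda>n. coef n * w ^ n) has_sum bes w) UNIV"
  by (intro norm_summable_imp_has_sum bes_summable bes_sums)

text \<open>Vandermonde's identity: both sides are the coefficient of \<open>a ^ n * b ^ m\<close> in \<open>exp (a + b) * bes (a * b)\<close>.\<close>
lemma coef_product:
  "(\<Sum>l\<le>min n m. coef l / (fact (n - l) * fact (m - l))) = coef n * coef m * Gamma (real n + real m + \<alpha> + 1)"
proof -
  have nz: "x \<notin> \<int>\<^sub>\<le>\<^sub>0" if "x > 0" for x :: real using that by (auto elim!: nonpos_Ints_cases')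
  have g1: "(real n + \<alpha> gchoose (n - k)) = Gamma (real n + \<alpha> + 1) * coef k * fact k / fact (n - k)" if "k \<le> n" for k
  proof -
    have "(real n + \<alpha> gchoose (n - k)) = Gamma (real n + \<alpha> + 1) / (fact (n - k) * Gamma (real n + \<alpha> - real (n - k) + 1))"
      using alpha by (intro gbinomial_Gamma nz) auto
    also have "real n + \<alpha> - real (n - k) + 1 = real k + \<alpha> + 1" using that by simp
    finally show ?thesis by (simp add: coef_def)
  qed
  have g2: "(real m + (real n + \<alpha>) gchoose n) = Gamma (real n + real m + \<alpha> + 1) * coef m * fact m / fact n"
  proof -
    have "(real m + (real n + \<alpha>) gchoose n) = Gamma (real m + (real n + \<alpha>) + 1) / (fact n * Gamma (real m + (real n + \<alpha>) - real n + 1))"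
      using alpha by (intro gbinomial_Gamma nz) auto
    also have "real m + (real n + \<alpha>) - real n + 1 = real m + \<alpha> + 1" by simp
    finally show ?thesis by (simp add: coef_def add_ac)
  qed
  \<comment> \<open>The real upper argument \<open>real n + \<alpha>\<close> puts
    \<open>Gamma (real k + \<alpha> + 1)\<close> into the denominator, which is the Gamma factor of
    \<open>coef k\<close>; the integer one \<open>real m\<close> cuts the sum off at
    \<open>m\<close>.\<close>
  have "(\<Sum>k=0..n. (real m gchoose k) * (real n + \<alpha> gchoose (n - k))) = (real m + (real n + \<alpha>) gchoose n)"
    by (rule gbinomial_Vandermonde)
  also have "(\<Sum>k=0..n. (real m gchoose k) * (real n + \<alpha> gchoose (n - k))) =
      (\<Sum>k\<le>min n m. (real m gchoose k) * (real n + \<alpha> gchoose (n - k)))"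
    by (intro sum.mono_neutral_right) (auto simp: not_le simp flip: binomial_gbinomial)
  also have "\<dots> = (\<Sum>l\<le>min n m. fact m * Gamma (real n + \<alpha> + 1) * (coef l / (fact (n - l) * fact (m - l))))"
    by (intro sum.cong refl) (auto simp: g1 binomial_fact mult_ac simp flip: binomial_gbinomial)
  also have "\<dots> = fact m * Gamma (real n + \<alpha> + 1) * (\<Sum>l\<le>min n m. coef l / (fact (n - l) * fact (m - l)))"
    by (simp add: sum_distrib_left)
  finally have *: "fact m * Gamma (real n + \<alpha> + 1) * (\<Sum>l\<le>min n m. coef l / (fact (n - l) * fact (m - l)))
     = Gamma (real n + real m + \<alpha> + 1) * coef m * fact m / fact n" unfolding g2 .
  have "(\<Sum>l\<le>min n m. coef l / (fact (n - l) * fact (m - l))) =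
      (fact m * Gamma (real n + \<alpha> + 1) * (\<Sum>l\<le>min n m. coef l / (fact (n - l) * fact (m - l)))) / (fact m * Gamma (real n + \<alpha> + 1))"
    using Gamma_pos[of n] by simp
  also have "\<dots> = coef n * coef m * Gamma (real n + real m + \<alpha> + 1)"
    unfolding * using Gamma_pos[of n] by (simp add: coef_def)
  finally show ?thesis .
qed

text \<open>Expand \<open>exp a\<close>, \<open>exp b\<close> and \<open>bes (a * b)\<close> into a
  triple series over \<open>i\<close>, \<open>j\<close>, \<open>l\<close> and regroup by
  \<open>n = i + l\<close>, \<open>m = j + l\<close>. The sum over \<open>l\<close> left at fixed
  \<open>(n, m)\<close> is finite and is evaluated by \<open>coef_product\<close>.\<close>

lemma weber_series:
  "((\<lambda>(n, m). coef n * a ^ n * (coef m * b ^ m) * Gamma (real n + real m + \<alpha> + 1)) has_sum exp (a + b) * bes (a * b)) (UNIV \<times> UNIV)"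
proof -
  define T where "T = (\<lambda>((i, j), l). (a ^ i / fact i * (b ^ j / fact j)) * (coef l * (a * b) ^ l))"
  define F where "F = (\<lambda>((n, m), l). coef l / (fact (n - l) * fact (m - l)) * (a ^ n * b ^ m))"
  have "(T has_sum (exp a * exp b) * bes (a * b)) ((UNIV \<times> UNIV) \<times> UNIV)"
    using has_sum_times[OF has_sum_times[OF exp_has_sum[of a] exp_has_sum[of b]] bes_has_sum[of "a * b"]]
    by (simp add: T_def case_prod_unfold)
  also have "?this \<longleftrightarrow> (F has_sum (exp a * exp b) * bes (a * b)) (Sigma (UNIV \<times> UNIV) (\<lambda>(n, m). {..min n m}))"
    by (rule has_sum_reindex_bij_witness[of _ "\<lambda>((n, m), l). ((n - l, m - l), l)" "\<lambda>((i, j), l). ((i + l, j + l), l)"])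
       (auto simp: T_def F_def power_add power_mult_distrib)
  finally have "(F has_sum exp (a + b) * bes (a * b)) (Sigma (UNIV \<times> UNIV) (\<lambda>(n, m). {..min n m}))"
    by (simp add: exp_add)
  then show ?thesis
  proof (rule has_sum_SigmaD)
    fix p :: "nat \<times> nat"
    obtain n m where p: "p = (n, m)" by (cases p)
    have "((\<lambda>l. F (p, l)) has_sum (\<Sum>l\<le>min n m. F (p, l))) {..min n m}"
      by (intro has_sum_finite) auto
    also have "(\<Sum>l\<le>min n m. F (p, l)) = (\<Sum>l\<le>min n m. coef l / (fact (n - l) * fact (m - l))) * (a ^ n * b ^ m)"
      by (simp add: F_def p sum_distrib_right)
    finally show "((\<lambda>l. F (p, l)) has_sum
         (case p of (n, m) \<Rightarrow> coef n * a ^ n * (coef m * b ^ m) * Gamma (real n + real m + \<alpha> + 1)))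
         (case p of (n, m) \<Rightarrow> {..min n m})"
      unfolding coef_product p by (simp add: mult_ac)
  qed
qed

section \<open>The weighted measure as a density, its Gaussian moments and Weber's formula\<close>

abbreviation "M \<equiv> mu \<alpha>"

definition dens :: "real \<Rightarrow> real" where
  "dens x = indicator {0..} x * ((2 * pi) powr (\<alpha> + 1) * x powr (2 * \<alpha> + 1))"

lemma dens_nonneg: "dens x \<ge> 0" by (simp add: dens_def)

lemma mu_dens: "M = density lebesgue (\<lambda>x. ennreal (dens x))"
  unfolding mu_def dens_def by (intro arg_cong2[of _ _ _ _ density] ext) (auto simp: indicator_def)

lemma sets_M [measurable_cong, simp]: "sets M = sets lebesgue" by (simp add: mu_dens)
lemma space_M [simp]: "space M = UNIV" by (simp add: mu_dens)

lemma dens_measurable [measurable]: "dens \<in> borel_measurable borel"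
  unfolding dens_def by measurable

lemma borel_M [measurable_dest]: "f \<in> borel_measurable borel \<Longrightarrow> f \<in> borel_measurable M"
proof -
  assume f: "f \<in> borel_measurable borel"
  have "f \<in> borel_measurable lebesgue" 
    by (rule measurable_completion) (use f in simp)
  then show ?thesis by (simp cong: measurable_cong_sets)
qed

lemma dens_lebesgue: "dens \<in> borel_measurable lebesgue"
  using borel_M[OF dens_measurable] by (simp cong: measurable_cong_sets)

sublocale sigma_finite_measure M
proof -
  interpret L: sigma_finite_measure "lebesgue :: real measure"
  proof
    show "\<exists>A::real set set. countable A \<and> A \<subseteq> sets lebesgue \<and> \<Union> A = space lebesgue \<and> (\<forall>a\<in>A. emeasure lebesgue a \<noteq> \<infinity>)"
    proof (intro exI[of _ "range (\<lambda>n::nat. {- real n..real n})"] conjI)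
      have "x \<in> (\<Union>n::nat. {- real n..real n})" for x
      proof -
        obtain n :: nat where "\<bar>x\<bar> \<le> real n" using real_arch_simple by blast
        then show ?thesis by (intro UN_I[of n]) auto
      qed
      then show "(\<Union>n::nat. {- real n..real n}) = space lebesgue" by auto
    qed auto
  qed
  show "sigma_finite_measure M"
    unfolding mu_dens using dens_lebesgue by (subst L.sigma_finite_iff_density_finite) auto
qed

text \<open>Euler's integral for \<open>Gamma (real k + \<alpha> + 1)\<close> under the substitution
  \<open>t = T * y^2\<close>. Only even moments occur, since \<open>bes\<close> is always evaluated
  at multiples of \<open>y^2\<close>.\<close>

lemma Gamma_moment:
  assumes T: "T > 0"
  shows "has_bochner_integral M (\<lambda>y. exp (- (T * y\<^sup>2)) * y ^ (2 * k))
     ((2 * pi) powr (\<alpha> + 1) / 2 * T powr (- (\<alpha> + 1)) * (Gamma (real k + \<alpha> + 1) / T ^ k))"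
proof -
  define p where "p = real k + \<alpha> + 1"
  have p: "p > 0" using alpha by (simp add: p_def)
  define h where "h t = t powr (p - 1) / exp t" for t :: real
  have h: "(h has_integral Gamma p) {0..}"
    unfolding h_def by (rule Gamma_integral_real[OF p])
  have img: "(\<lambda>y. T * y\<^sup>2) ` {0..} = {0..}"
  proof safe
    fix t :: real assume "t \<ge> 0"
    then show "t \<in> (\<lambda>y. T * y\<^sup>2) ` {0..}"
      using T by (intro image_eqI[of _ _ "sqrt (t / T)"]) auto
  qed (use T in auto)
  have "h absolutely_integrable_on {0..}"
    using h by (intro nonnegative_absolutely_integrable_1) (auto simp: h_def integrable_on_def)
  then have "h absolutely_integrable_on ((\<lambda>y. T * y\<^sup>2) ` {0..}) \<and> integral ((\<lambda>y. T * y\<^sup>2) ` {0..}) h = Gamma p"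
    unfolding img using h by (simp add: integral_unique)
  also have "?this \<longleftrightarrow> (\<lambda>y. \<bar>2 * T * y\<bar> * h (T * y\<^sup>2)) absolutely_integrable_on {0..} \<and>
      integral {0..} (\<lambda>y. \<bar>2 * T * y\<bar> * h (T * y\<^sup>2)) = Gamma p"
  proof (rule has_absolute_integral_change_of_variables_1'[symmetric])
    show "inj_on (\<lambda>y. T * y\<^sup>2) {0..}"
      using T by (auto simp: inj_on_def)
  qed (auto intro!: derivative_eq_intros)
  finally have "set_integrable lebesgue {0..} (\<lambda>y. \<bar>2 * T * y\<bar> * h (T * y\<^sup>2))"
    "integral {0..} (\<lambda>y. \<bar>2 * T * y\<bar> * h (T * y\<^sup>2)) = Gamma p" by auto
  then have "has_bochner_integral lebesgue (\<lambda>y. indicator {0..} y *\<^sub>R (\<bar>2 * T * y\<bar> * h (T * y\<^sup>2))) (Gamma p)"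
    by (auto simp: has_bochner_integral_iff set_integrable_def set_lebesgue_integral_eq_integral(2)[symmetric] set_lebesgue_integral_def)
  then have "has_bochner_integral lebesgue (\<lambda>y. (2 * pi) powr (\<alpha> + 1) / (2 * T powr p) * (indicator {0..} y *\<^sub>R (\<bar>2 * T * y\<bar> * h (T * y\<^sup>2))))
     ((2 * pi) powr (\<alpha> + 1) / (2 * T powr p) * Gamma p)"
    by (intro has_bochner_integral_mult_right) auto
  also have "(\<lambda>y. (2 * pi) powr (\<alpha> + 1) / (2 * T powr p) * (indicator {0..} y *\<^sub>R (\<bar>2 * T * y\<bar> * h (T * y\<^sup>2)))) =
     (\<lambda>y. dens y *\<^sub>R (exp (- (T * y\<^sup>2)) * y ^ (2 * k)))"
  proof
    fix y :: real
    consider "y < 0" | "y = 0" | "y > 0" by linarith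
    then show "(2 * pi) powr (\<alpha> + 1) / (2 * T powr p) * (indicator {0..} y *\<^sub>R (\<bar>2 * T * y\<bar> * h (T * y\<^sup>2))) =
      dens y *\<^sub>R (exp (- (T * y\<^sup>2)) * y ^ (2 * k))"
    proof cases
      case 3
      have "(T * y\<^sup>2) powr (p - 1) = T powr (p - 1) * (y powr 2) powr (p - 1)"
        using 3 T by (subst powr_numeral) (auto simp: powr_mult)
      also have "(y powr 2) powr (p - 1) = y powr (2 * p - 2)"
        unfolding powr_powr by (simp add: algebra_simps)
      also have "2 * p - 2 = (2 * \<alpha> + 1) + real (2 * k) - 1" by (simp add: p_def)
      also have "y powr \<dots> = y powr (2 * \<alpha> + 1) * y ^ (2 * k) / y"
        using 3 by (subst powr_diff, subst powr_add, subst powr_realpow) auto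
      also have "T powr (p - 1) = T powr p / T" using T by (subst powr_diff) auto
      finally show ?thesis using 3 T by (simp add: dens_def h_def exp_minus field_simps)
    qed (auto simp: dens_def)
  qed
  finally have "has_bochner_integral M (\<lambda>y. exp (- (T * y\<^sup>2)) * y ^ (2 * k)) ((2 * pi) powr (\<alpha> + 1) / (2 * T powr p) * Gamma p)"
    unfolding mu_dens using dens_nonneg dens_lebesgue
    by (intro has_bochner_integral_density) (auto intro!: measurable_completion)
  also have "T powr p = T powr (\<alpha> + 1) * T ^ k"
    using T by (simp add: p_def powr_add powr_realpow)
  also have "(2 * pi) powr (\<alpha> + 1) / (2 * (T powr (\<alpha> + 1) * T ^ k)) * Gamma p =
     (2 * pi) powr (\<alpha> + 1) / 2 * T powr (- (\<alpha> + 1)) * (Gamma (real k + \<alpha> + 1) / T ^ k)"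
    unfolding powr_minus p_def using T by (simp add: field_simps)
  finally show ?thesis .
qed

text \<open>Weber's second exponential integral. Since \<open>a\<close> and \<open>b\<close> may have either sign, it contains the integrals of two Bessel kernels, of the heat kernel against a Bessel kernel, and of the heat kernel against a Gaussian.\<close>
lemma weber:
  assumes T: "T > 0"
  shows "has_bochner_integral M (\<lambda>y. exp (- (T * y\<^sup>2)) * bes (a * y\<^sup>2) * bes (b * y\<^sup>2))
     ((2 * pi) powr (\<alpha> + 1) / 2 * T powr (- (\<alpha> + 1)) * (exp ((a + b) / T) * bes (a * b / T\<^sup>2)))"
proof -
  define K where "K = (2 * pi) powr (\<alpha> + 1) / 2 * T powr (- (\<alpha> + 1))"
  have K: "K \<ge> 0" by (simp add: K_def)
  \<comment> \<open>The product of the two series is enumerated by \<open>prod_decode\<close>, so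
    that the theorem on integrating an ordinary series term by term applies.\<close>
  define c where "c i = (case prod_decode i of (n, m) \<Rightarrow> coef n * a ^ n * (coef m * b ^ m))" for i
  define e where "e i = (case prod_decode i of (n, m) \<Rightarrow> n + m)" for i
  define F where "F i y = c i * (exp (- (T * y\<^sup>2)) * y ^ (2 * e i))" for i and y :: real
  have Fi: "has_bochner_integral M (F i) (c i * (K * (Gamma (real (e i) + \<alpha> + 1) / T ^ e i)))" for i
    unfolding F_def[abs_def] K_def by (intro has_bochner_integral_mult_right Gamma_moment T)
  have Fn: "has_bochner_integral M (\<lambda>y. norm (F i y)) (\<bar>c i\<bar> * (K * (Gamma (real (e i) + \<alpha> + 1) / T ^ e i)))" for i
  proof -
    have "(\<lambda>y. norm (F i y)) = (\<lambda>y. \<bar>c i\<bar> * (exp (- (T * y\<^sup>2)) * y ^ (2 * e i)))"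
      by (simp add: F_def abs_mult power_mult)
    then show ?thesis unfolding K_def by (simp only:) (intro has_bochner_integral_mult_right Gamma_moment T)
  qed
  have bij: "bij_betw prod_decode UNIV (UNIV \<times> UNIV)"
    using bij_prod_decode by simp
  have ws: "(\<lambda>i. (case prod_decode i of (n, m) \<Rightarrow> coef n * a' ^ n * (coef m * b' ^ m)) * (K * (Gamma (real (e i) + \<alpha> + 1) / T ^ e i))) sums
     (K * (exp (a' / T + b' / T) * bes (a' / T * (b' / T))))" for a' b'
  proof -
    have "((\<lambda>i. (\<lambda>(n, m). coef n * (a' / T) ^ n * (coef m * (b' / T) ^ m) * Gamma (real n + real m + \<alpha> + 1)) (prod_decode i))
        has_sum exp (a' / T + b' / T) * bes (a' / T * (b' / T))) UNIV"
      by (subst has_sum_reindex_bij_betw[OF bij]) (rule weber_series)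
    then have "(\<lambda>i. K * (\<lambda>(n, m). coef n * (a' / T) ^ n * (coef m * (b' / T) ^ m) * Gamma (real n + real m + \<alpha> + 1)) (prod_decode i))
       sums (K * (exp (a' / T + b' / T) * bes (a' / T * (b' / T))))"
      by (intro sums_mult has_sum_imp_sums)
    then show ?thesis
      by (rule sums_cong[THEN iffD1, rotated]) (auto simp: e_def power_divide power_add split: prod.splits)
  qed
  have Fabs: "\<bar>c i\<bar> = (case prod_decode i of (n, m) \<Rightarrow> coef n * \<bar>a\<bar> ^ n * (coef m * \<bar>b\<bar> ^ m))" for i
    using coef_pos by (auto simp: c_def abs_mult power_abs less_imp_le split: prod.splits)
  have Fsum: "((\<lambda>i. F i y) has_sum exp (- (T * y\<^sup>2)) * (bes (a * y\<^sup>2) * bes (b * y\<^sup>2))) UNIV" for y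
  proof -
    have "((\<lambda>i. (\<lambda>(n, m). coef n * (a * y\<^sup>2) ^ n * (coef m * (b * y\<^sup>2) ^ m)) (prod_decode i))
        has_sum bes (a * y\<^sup>2) * bes (b * y\<^sup>2)) UNIV"
      by (subst has_sum_reindex_bij_betw[OF bij]) (rule has_sum_times[OF bes_has_sum bes_has_sum])
    then have "((\<lambda>i. exp (- (T * y\<^sup>2)) * (\<lambda>(n, m). coef n * (a * y\<^sup>2) ^ n * (coef m * (b * y\<^sup>2) ^ m)) (prod_decode i))
        has_sum exp (- (T * y\<^sup>2)) * (bes (a * y\<^sup>2) * bes (b * y\<^sup>2))) UNIV"
      by (rule has_sum_cmult_right)
    then show ?thesis
      by (rule has_sum_cong[THEN iffD1, rotated])
         (auto simp: F_def c_def e_def power_mult power_add power_mult_distrib split: prod.splits)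
  qed
  have Fsums: "(\<Sum>i. F i y) = exp (- (T * y\<^sup>2)) * bes (a * y\<^sup>2) * bes (b * y\<^sup>2)" for y
    using sums_unique[OF has_sum_imp_sums[OF Fsum[of y]]] by (simp add: mult.assoc)
  have s: "summable (\<lambda>i. norm (F i y))" for y
  proof -
    have "(\<lambda>i. norm (F i y)) summable_on UNIV"
      by (rule summable_on_iff_abs_summable_on_real[THEN iffD1, OF has_sum_imp_summable[OF Fsum[of y]]])
    then show ?thesis by (rule summable_on_imp_summable)
  qed
  \<comment> \<open>The integrals of the norms form the same series taken at
    \<open>\<bar>a\<bar>\<close> and \<open>\<bar>b\<bar>\<close>, so the algebraic identity
    \<open>ws\<close> also supplies the absolute convergence.\<close>
  have si: "summable (\<lambda>i. \<integral>y. norm (F i y) \<partial>M)"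
    using sums_summable[OF ws[of "\<bar>a\<bar>" "\<bar>b\<bar>"]] unfolding has_bochner_integral_integral_eq[OF Fn] Fabs .
  have Fint: "integrable M (F i)" for i using Fi[of i] by (simp add: has_bochner_integral_iff)
  have "integrable M (\<lambda>y. \<Sum>i. F i y)"
    by (intro integrable_suminf Fint si AE_I2 s)
  moreover have "(\<lambda>i. integral\<^sup>L M (F i)) sums (\<integral>y. (\<Sum>i. F i y) \<partial>M)"
    by (intro sums_integral Fint si AE_I2 s)
  then have "(\<integral>y. (\<Sum>i. F i y) \<partial>M) = K * (exp (a / T + b / T) * bes (a / T * (b / T)))"
    using ws[of a b] unfolding has_bochner_integral_integral_eq[OF Fi] c_def by (rule sums_unique2)
  ultimately have "has_bochner_integral M (\<lambda>y. \<Sum>i. F i y) (K * (exp (a / T + b / T) * bes (a / T * (b / T))))"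
    by (simp add: has_bochner_integral_iff)
  then show ?thesis unfolding Fsums K_def by (simp add: add_divide_distrib power2_eq_square)
qed

subsection \<open>The heat kernel\<close>

definition bker :: "real \<Rightarrow> real \<Rightarrow> real" where
  "bker x y = bessel_j \<alpha> (2 * pi * x * y)"

text \<open>A constant times \<open>t powr (-1) * (x * y) powr (- \<alpha>) * exp (- (pi * (x^2 +
  y^2) / t))\<close> times the modified Bessel function of order \<alpha> at
  \<open>2 * pi * x * y / t\<close>. Writing it with \<open>bes\<close> removes the apparent
  singularity at \<open>x * y = 0\<close>.\<close>

definition heat :: "real \<Rightarrow> real \<Rightarrow> real \<Rightarrow> real" where
  "heat t x y = 2 powr (-\<alpha>) * t powr (-(\<alpha> + 1)) * exp (- (pi * (x\<^sup>2 + y\<^sup>2) / t)) * bes ((pi * x * y / t)\<^sup>2)"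

abbreviation gauss :: "real \<Rightarrow> real \<Rightarrow> real" where
  "gauss t y \<equiv> exp (- (pi * t * y\<^sup>2))"

abbreviation damp :: "real \<Rightarrow> real \<Rightarrow> real" where
  "damp s x \<equiv> exp (- (pi * s * (1 + x\<^sup>2)))"

text \<open>The second moment of the heat kernel in the variable \<open>y^2\<close>, in which the
  thinness intervals have bounded length.\<close>

abbreviation spread :: "real \<Rightarrow> real \<Rightarrow> ennreal" where
  "spread t x \<equiv> (\<integral>\<^sup>+y. ennreal (heat t x y * (y\<^sup>2 - x\<^sup>2)\<^sup>2) \<partial>M)"

lemma bker_eq: "bker x y = 2 powr (-\<alpha>) * bes (- ((pi * x)\<^sup>2) * y\<^sup>2)"
  unfolding bker_def bessel_j_eq by (simp add: power_mult_distrib mult.assoc)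

lemma bker_sym: "bker x y = bker y x"
  unfolding bker_def by (simp add: mult_ac)

lemma abs_bker_le: "\<bar>x\<bar> \<le> R \<Longrightarrow> \<bar>bker x y\<bar> \<le> 2 powr (-\<alpha>) * bes ((pi * R)\<^sup>2 * y\<^sup>2)"
proof -
  assume x: "\<bar>x\<bar> \<le> R"
  have "\<bar>bes (- ((pi * x)\<^sup>2) * y\<^sup>2)\<bar> \<le> bes \<bar>- ((pi * x)\<^sup>2) * y\<^sup>2\<bar>" by (rule abs_bes_le)
  also have "\<dots> \<le> bes ((pi * R)\<^sup>2 * y\<^sup>2)"
  proof (intro bes_mono)
    have "x\<^sup>2 \<le> R\<^sup>2" using x by (simp add: abs_le_square_iff[symmetric])
    then show "\<bar>- ((pi * x)\<^sup>2) * y\<^sup>2\<bar> \<le> (pi * R)\<^sup>2 * y\<^sup>2"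
      by (simp add: abs_mult power_mult_distrib mult_left_mono mult_right_mono)
  qed auto
  finally show ?thesis by (simp add: bker_eq abs_mult)
qed

lemma bker_measurable [measurable (raw)]:
  assumes [measurable]: "f \<in> borel_measurable N" "g \<in> borel_measurable N"
  shows "(\<lambda>p. bker (f p) (g p)) \<in> borel_measurable N"
  unfolding bker_eq by measurable

lemma heat_measurable [measurable (raw)]:
  assumes [measurable]: "f \<in> borel_measurable N" "g \<in> borel_measurable N"
  shows "(\<lambda>p. heat t (f p) (g p)) \<in> borel_measurable N"
  unfolding heat_def by measurable

lemma id_M [measurable]: "(\<lambda>x. x) \<in> borel_measurable M"
  by (intro borel_M) simp

lemma fst_M [measurable]: "fst \<in> borel_measurable (M \<Otimes>\<^sub>M M)"
  using measurable_compose[OF measurable_fst id_M] by simp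

lemma snd_M [measurable]: "snd \<in> borel_measurable (M \<Otimes>\<^sub>M M)"
  using measurable_compose[OF measurable_snd id_M] by simp

lemma heat_exp_measurable: "(\<lambda>y. ennreal (heat t x y * gauss u y)) \<in> borel_measurable M"
  by measurable

lemma heat_sym: "heat t x y = heat t y x"
  unfolding heat_def by (simp add: add_ac mult_ac)

lemma heat_nonneg: "heat t x y \<ge> 0"
  unfolding heat_def using bes_pos by (auto simp: less_imp_le intro!: mult_nonneg_nonneg)

lemma weber_const:
  "s > 0 \<Longrightarrow> (2 * pi) powr (\<alpha> + 1) / 2 * (pi * s) powr (- (\<alpha> + 1)) = 2 powr \<alpha> * s powr (- (\<alpha> + 1))"
  unfolding powr_minus by (simp add: powr_mult powr_add field_simps)

lemma weber':
  assumes s: "s > 0"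
  shows "has_bochner_integral M (\<lambda>y. gauss s y * bes (a * y\<^sup>2) * bes (b * y\<^sup>2))
     (2 powr \<alpha> * s powr (- (\<alpha> + 1)) * (exp ((a + b) / (pi * s)) * bes (a * b / (pi * s)\<^sup>2)))"
  using weber[of "pi * s" a b] s unfolding weber_const[OF s] by simp

text \<open>Weber's formula with both arguments negative: their product is positive, which is how
  two oscillating kernels produce the positive heat kernel.\<close>

lemma J_J_integral:
  assumes t: "t > 0"
  shows "has_bochner_integral M (\<lambda>y. gauss t y * bker x y * bker x' y) (heat t x x')"
proof -
  have "has_bochner_integral M
     (\<lambda>y. (2 powr (-\<alpha>) * 2 powr (-\<alpha>)) * (gauss t y * bes (- ((pi * x)\<^sup>2) * y\<^sup>2) * bes (- ((pi * x')\<^sup>2) * y\<^sup>2)))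
     ((2 powr (-\<alpha>) * 2 powr (-\<alpha>)) * (2 powr \<alpha> * t powr (- (\<alpha> + 1)) *
       (exp ((- ((pi * x)\<^sup>2) + - ((pi * x')\<^sup>2)) / (pi * t)) * bes (- ((pi * x)\<^sup>2) * - ((pi * x')\<^sup>2) / (pi * t)\<^sup>2))))"
    by (rule has_bochner_integral_mult_right[OF weber'[OF t]])
  also have "(\<lambda>y. (2 powr (-\<alpha>) * 2 powr (-\<alpha>)) * (gauss t y * bes (- ((pi * x)\<^sup>2) * y\<^sup>2) * bes (- ((pi * x')\<^sup>2) * y\<^sup>2)))
     = (\<lambda>y. gauss t y * bker x y * bker x' y)"
    by (simp add: bker_eq mult_ac)
  also have "(- ((pi * x)\<^sup>2) + - ((pi * x')\<^sup>2)) / (pi * t) = - (pi * (x\<^sup>2 + x'\<^sup>2) / t)"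
    using t by (simp add: field_simps power2_eq_square)
  also have "- ((pi * x)\<^sup>2) * - ((pi * x')\<^sup>2) / (pi * t)\<^sup>2 = (pi * x * x' / t)\<^sup>2"
    using t by (simp add: field_simps power2_eq_square)
  also have "2 powr (-\<alpha>) * 2 powr (-\<alpha>) * (2 powr \<alpha> * t powr (- (\<alpha> + 1)) * (exp (- (pi * (x\<^sup>2 + x'\<^sup>2) / t)) * bes ((pi * x * x' / t)\<^sup>2)))
     = heat t x x'"
    unfolding heat_def powr_minus by simp
  finally show ?thesis .
qed

text \<open>The Gaussian inside \<open>heat\<close> merges with \<open>gauss u\<close> into one
  Gaussian of rate \<open>s = (1 + t * u) / t\<close>, and Weber's formula applies. Negative
  \<open>u\<close> with \<open>1 + t * u > 0\<close> is allowed, as the two-sided Chernoff bound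
  requires.\<close>

lemma heat_integral:
  assumes t: "t > 0" and u: "1 + t * u > 0"
  shows "has_bochner_integral M (\<lambda>y. gauss u y * heat t x y * bes (b * y\<^sup>2))
    ((1 + t * u) powr (- (\<alpha> + 1)) * exp (- (pi * u * x\<^sup>2 / (1 + t * u)) + b * t / (pi * (1 + t * u))) * bes (b * x\<^sup>2 / (1 + t * u)\<^sup>2))"
proof -
  define s where "s = (1 + t * u) / t"
  have s: "s > 0" using t u by (simp add: s_def)
  define c where "c = 2 powr (-\<alpha>) * t powr (-(\<alpha> + 1)) * exp (- (pi * x\<^sup>2 / t))"
  define a where "a = (pi * x / t)\<^sup>2"
  have "has_bochner_integral M
     (\<lambda>y. c * (gauss s y * bes (a * y\<^sup>2) * bes (b * y\<^sup>2)))
     (c * (2 powr \<alpha> * s powr (- (\<alpha> + 1)) * (exp ((a + b) / (pi * s)) * bes (a * b / (pi * s)\<^sup>2))))"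
    by (rule has_bochner_integral_mult_right[OF weber'[OF s]])
  also have "(\<lambda>y. c * (gauss s y * bes (a * y\<^sup>2) * bes (b * y\<^sup>2))) = (\<lambda>y. gauss u y * heat t x y * bes (b * y\<^sup>2))"
  proof
    fix y
    have "exp (- (pi * x\<^sup>2 / t)) * gauss s y = gauss u y * exp (- (pi * (x\<^sup>2 + y\<^sup>2) / t))"
      using t by (simp add: s_def field_simps flip: exp_add)
    moreover have "a * y\<^sup>2 = (pi * x * y / t)\<^sup>2"
      by (simp add: a_def power_mult_distrib power_divide)
    ultimately show "c * (gauss s y * bes (a * y\<^sup>2) * bes (b * y\<^sup>2)) = gauss u y * heat t x y * bes (b * y\<^sup>2)"
      by (simp add: c_def heat_def mult_ac)
  qed
  also have "(a + b) / (pi * s) = pi * x\<^sup>2 / t - pi * u * x\<^sup>2 / (1 + t * u) + b * t / (pi * (1 + t * u))"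
  proof -
    have "b / (pi * s) = b * t / (pi * (1 + t * u))" using t by (simp add: s_def)
    moreover have "a / (pi * s) = pi * x\<^sup>2 / t - pi * u * x\<^sup>2 / (1 + t * u)"
    proof -
      have "a / (pi * s) = pi * x\<^sup>2 / t * (1 / (1 + t * u))"
        using t u by (simp add: a_def s_def power2_eq_square)
      also have "1 / (1 + t * u) = 1 - t * u / (1 + t * u)" using u by (simp add: field_simps)
      finally show ?thesis using t by (simp add: right_diff_distrib)
    qed
    ultimately show ?thesis by (simp add: add_divide_distrib)
  qed
  also have "a * b / (pi * s)\<^sup>2 = b * x\<^sup>2 / (1 + t * u)\<^sup>2"
    using t u by (simp add: a_def s_def divide_simps power2_eq_square)
  also have "s powr (- (\<alpha> + 1)) = (1 + t * u) powr (- (\<alpha> + 1)) / t powr (- (\<alpha> + 1))"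
    using t u by (simp only: s_def powr_divide)
  also have "c * (2 powr \<alpha> * ((1 + t * u) powr (- (\<alpha> + 1)) / t powr (- (\<alpha> + 1))) *
       (exp (pi * x\<^sup>2 / t - pi * u * x\<^sup>2 / (1 + t * u) + b * t / (pi * (1 + t * u))) * bes (b * x\<^sup>2 / (1 + t * u)\<^sup>2)))
     = (1 + t * u) powr (- (\<alpha> + 1)) * exp (- (pi * u * x\<^sup>2 / (1 + t * u)) + b * t / (pi * (1 + t * u))) * bes (b * x\<^sup>2 / (1 + t * u)\<^sup>2)"
  proof -
    have e: "exp (- (pi * x\<^sup>2 / t)) * exp (pi * x\<^sup>2 / t - pi * u * x\<^sup>2 / (1 + t * u) + b * t / (pi * (1 + t * u)))
       = exp (- (pi * u * x\<^sup>2 / (1 + t * u)) + b * t / (pi * (1 + t * u)))"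
      by (simp flip: exp_add)
    have "t powr (- (\<alpha> + 1)) > 0" using t by simp
    moreover have "(2::real) powr (-\<alpha>) * 2 powr \<alpha> = 1" by (simp flip: powr_add)
    ultimately show ?thesis unfolding e[symmetric] c_def by (simp add: field_simps)
  qed
  finally show ?thesis .
qed

text \<open>The Bessel kernels are eigenfunctions of the heat semigroup: the case
  \<open>u = 0\<close> with a negative argument \<open>b\<close>.\<close>

lemma heat_bker_integral:
  assumes t: "t > 0"
  shows "has_bochner_integral M (\<lambda>y. heat t x y * bker x' y) (exp (- (pi * t * x'\<^sup>2)) * bker x x')"
proof -
  have "has_bochner_integral M (\<lambda>y. 2 powr (-\<alpha>) * (gauss 0 y * heat t x y * bes (- ((pi * x')\<^sup>2) * y\<^sup>2)))
     (2 powr (-\<alpha>) * ((1 + t * 0) powr (- (\<alpha> + 1)) * exp (- (pi * 0 * x\<^sup>2 / (1 + t * 0)) + - ((pi * x')\<^sup>2) * t / (pi * (1 + t * 0)))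
        * bes (- ((pi * x')\<^sup>2) * x\<^sup>2 / (1 + t * 0)\<^sup>2)))"
    by (rule has_bochner_integral_mult_right[OF heat_integral[OF t]]) auto
  also have "- ((pi * x')\<^sup>2) * t / (pi * (1 + t * 0)) = - (pi * t * x'\<^sup>2)"
    by (simp add: field_simps power2_eq_square)
  finally show ?thesis
    unfolding bker_sym[of x x'] unfolding bker_eq by (simp add: mult_ac)
qed

text \<open>The case \<open>b = 0\<close>, after division by the common factor \<open>bes 0\<close>,
  which is positive but in general not 1.\<close>

lemma heat_exp_integral:
  assumes t: "t > 0" and u: "1 + t * u > 0"
  shows "has_bochner_integral M (\<lambda>y. heat t x y * gauss u y)
    ((1 + t * u) powr (- (\<alpha> + 1)) * exp (- (pi * u * x\<^sup>2 / (1 + t * u))))"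
proof -
  have B0: "bes 0 > 0" by (rule bes_pos) simp
  have "has_bochner_integral M (\<lambda>y. (1 / bes 0) * (gauss u y * heat t x y * bes (0 * y\<^sup>2)))
    ((1 / bes 0) * ((1 + t * u) powr (- (\<alpha> + 1)) * exp (- (pi * u * x\<^sup>2 / (1 + t * u)) + 0 * t / (pi * (1 + t * u))) * bes (0 * x\<^sup>2 / (1 + t * u)\<^sup>2)))"
    by (rule has_bochner_integral_mult_right[OF heat_integral[OF t u]])
  then show ?thesis using B0 by (simp add: mult_ac)
qed

lemma heat_exp_nn:
  assumes t: "t > 0" and u: "1 + t * u > 0"
  shows "(\<integral>\<^sup>+y. ennreal (heat t x y * gauss u y) \<partial>M) =
    ennreal ((1 + t * u) powr (- (\<alpha> + 1)) * exp (- (pi * u * x\<^sup>2 / (1 + t * u))))"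
proof -
  note i = heat_exp_integral[OF t u, of x]
  show ?thesis
    using nn_integral_eq_integral[of M "\<lambda>y. heat t x y * gauss u y"] i heat_nonneg
    by (simp add: has_bochner_integral_iff)
qed

lemma heat_mass:
  assumes t: "t > 0"
  shows "(\<integral>\<^sup>+y. ennreal (heat t x y) \<partial>M) = 1"
  using heat_exp_nn[OF t, of 0 x] by simp

text \<open>Chernoff's method with exponent of size \<open>(x\<^sup>2 / t + 1) powr (- 1 / 2)\<close>.\<close>
lemma heat_variance:
  "\<exists>C>0. \<forall>t x. 0 < t \<longrightarrow> t \<le> 1 \<longrightarrow> spread t x \<le> ennreal (C * (t * (1 + x\<^sup>2)))"
proof -
  define D where "D = 2 * (2 powr (\<alpha> + 1) * exp 1 + exp 1)"
  have D: "D > 0" by (simp add: D_def add_pos_pos)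
  have "spread t x \<le> ennreal (4 * D * (t * (1 + x\<^sup>2)))"
    if t: "0 < t" "t \<le> 1" for t x
  proof -
    define l where "l = pi * x\<^sup>2 / t"
    have l: "l \<ge> 0" using t by (simp add: l_def)
    \<comment> \<open>The size of \<open>h\<close> is dictated by two needs:
      \<open>l * h^2 \<le> 1/2\<close> keeps both exponential moments bounded, and
      \<open>h \<le> 1/2\<close> keeps \<open>1 - h\<close> away from 0.\<close>
    define h where "h = 1 / (2 * sqrt (l + 1))"
    have s1: "sqrt (l + 1) \<ge> 1" using l by simp
    have h: "h > 0" "h \<le> 1/2" using s1 by (auto simp: h_def field_simps)
    have h2: "h\<^sup>2 = 1 / (4 * (l + 1))" using l by (simp add: h_def power_divide power_mult_distrib)
    have lh: "l * h\<^sup>2 \<le> 1/2" using l by (simp add: h2 field_simps)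
    define K where "K = 2 * ((t / pi)\<^sup>2 / h\<^sup>2)"
    have K: "K \<ge> 0" by (simp add: K_def)
    define u where "u = h / t"
    have tu: "t * u = h" using t by (simp add: u_def)
    have pw: "heat t x y * (y\<^sup>2 - x\<^sup>2)\<^sup>2 \<le> K * exp (h * l) * (heat t x y * gauss u y) + K * exp (- (h * l)) * (heat t x y * exp (- (pi * (-u) * y\<^sup>2)))" for y
    proof -
      \<comment> \<open>The exponent centred at \<open>y = x\<close>: it equals
        \<open>pi * u * (x^2 - y^2)\<close>, so \<open>(y^2 - x^2)^2\<close> is a multiple of
        \<open>v^2\<close>, to which \<open>square_le_exp\<close> applies.\<close>
      define v where "v = h * l - pi * u * y\<^sup>2"
      have "v = h * (pi / t) * (x\<^sup>2 - y\<^sup>2)"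
        using t by (simp add: v_def l_def u_def field_simps)
      then have "(y\<^sup>2 - x\<^sup>2)\<^sup>2 = ((t / pi)\<^sup>2 / h\<^sup>2) * v\<^sup>2"
        using t h by (simp add: power_mult_distrib power_divide power2_commute)
      also have "\<dots> \<le> ((t / pi)\<^sup>2 / h\<^sup>2) * (2 * (exp v + exp (- v)))"
        by (intro mult_left_mono square_le_exp) auto
      also have "\<dots> = K * exp (h * l) * gauss u y + K * exp (- (h * l)) * exp (- (pi * (-u) * y\<^sup>2))"
      proof -
        have "exp v = exp (h * l) * gauss u y" "exp (- v) = exp (- (h * l)) * exp (- (pi * (-u) * y\<^sup>2))"
          by (simp_all add: v_def flip: exp_add)
        then show ?thesis by (simp add: K_def algebra_simps)
      qed
      finally have "heat t x y * (y\<^sup>2 - x\<^sup>2)\<^sup>2 \<le> heat t x y * \<dots>"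
        by (intro mult_left_mono heat_nonneg)
      then show ?thesis by (simp add: algebra_simps)
    qed
    have "spread t x \<le>
      (\<integral>\<^sup>+y. ennreal (K * exp (h * l)) * ennreal (heat t x y * gauss u y) + ennreal (K * exp (- (h * l))) * ennreal (heat t x y * exp (- (pi * (-u) * y\<^sup>2))) \<partial>M)"
      using K heat_nonneg pw by (intro nn_integral_mono) (simp flip: ennreal_mult ennreal_plus)
    also have "\<dots> = ennreal (K * exp (h * l)) * ennreal ((1 + t * u) powr (- (\<alpha> + 1)) * exp (- (pi * u * x\<^sup>2 / (1 + t * u))))
      + ennreal (K * exp (- (h * l))) * ennreal ((1 + t * (-u)) powr (- (\<alpha> + 1)) * exp (- (pi * (-u) * x\<^sup>2 / (1 + t * (-u)))))"
    proof -
      have "1 + t * u > 0" "1 + t * (-u) > 0" using h tu by auto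
      then show ?thesis
        by (simp only: nn_integral_add nn_integral_cmult heat_exp_nn[OF t(1)] borel_measurable_times_ennreal
            heat_exp_measurable borel_measurable_const)
    qed
    also have "\<dots> = ennreal (K * ((1 + h) powr (- (\<alpha> + 1)) * exp (l * h\<^sup>2 / (1 + h))) + K * ((1 - h) powr (- (\<alpha> + 1)) * exp (l * h\<^sup>2 / (1 - h))))"
    proof -
      have pu: "pi * u * x\<^sup>2 = h * l" using t by (simp add: u_def l_def)
      have "h * l - pi * u * x\<^sup>2 / (1 + t * u) = l * h\<^sup>2 / (1 + h)"
        unfolding pu tu using h by (simp add: field_simps power2_eq_square)
      moreover have "- (h * l) - pi * (-u) * x\<^sup>2 / (1 + t * (-u)) = l * h\<^sup>2 / (1 - h)"
      proof -
        have "pi * (-u) * x\<^sup>2 = - (h * l)" "t * (-u) = - h" using pu tu by auto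
        then show ?thesis using h by (simp add: field_simps power2_eq_square)
      qed
      ultimately have e12: "exp (h * l) * exp (- (pi * u * x\<^sup>2 / (1 + t * u))) = exp (l * h\<^sup>2 / (1 + h))"
        "exp (- (h * l)) * exp (- (pi * (-u) * x\<^sup>2 / (1 + t * (-u)))) = exp (l * h\<^sup>2 / (1 - h))"
        by (simp_all flip: exp_add)
      show ?thesis unfolding e12[symmetric] using K tu h by (simp add: mult_ac flip: ennreal_mult ennreal_plus)
    qed
    also have "\<dots> \<le> ennreal (K * (1 * exp 1) + K * (2 powr (\<alpha> + 1) * exp 1))"
    proof (intro ennreal_leI add_mono mult_left_mono mult_mono)
      show "(1 + h) powr (- (\<alpha> + 1)) \<le> 1" using h alpha by (intro powr_le1) auto
      have "(1 - h) powr (- (\<alpha> + 1)) \<le> (1/2) powr (- (\<alpha> + 1))" using h alpha by (intro powr_mono2') auto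
      also have "(1/2::real) powr (- (\<alpha> + 1)) = 2 powr (\<alpha> + 1)" unfolding powr_divide powr_minus by simp
      finally show "(1 - h) powr (- (\<alpha> + 1)) \<le> 2 powr (\<alpha> + 1)" .
      have "l * h\<^sup>2 \<le> 1 * (1 + h)" "l * h\<^sup>2 \<le> 1 * (1 - h)" using lh h by auto
      then show "exp (l * h\<^sup>2 / (1 + h)) \<le> exp 1" "exp (l * h\<^sup>2 / (1 - h)) \<le> exp 1"
        using h by (simp_all add: divide_le_eq)
    qed (use K in auto)
    also have "\<dots> \<le> ennreal (4 * D * (t * (1 + x\<^sup>2)))"
    proof (intro ennreal_leI)
      \<comment> \<open>Since \<open>l = pi * x^2 / t\<close>, one of the two powers of
        \<open>t\<close> cancels against \<open>l\<close>; this gives the rate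
        \<open>t * (1 + x^2)\<close>.\<close>
      have "(t / pi)\<^sup>2 / h\<^sup>2 = 4 * ((t / pi)\<^sup>2 * (l + 1))" using l by (simp add: h2)
      also have "(t / pi)\<^sup>2 * (l + 1) = t * (x\<^sup>2 / pi + t / pi\<^sup>2)"
        using t by (simp add: l_def field_simps power2_eq_square)
      also have "x\<^sup>2 / pi + t / pi\<^sup>2 \<le> 1 + x\<^sup>2"
      proof -
        have "x\<^sup>2 / pi \<le> x\<^sup>2 / 1" using pi_ge_two by (intro divide_left_mono) auto
        moreover have "t / pi\<^sup>2 \<le> 1 / 1" using t pi_ge_two by (intro frac_le) (auto simp: one_le_power)
        ultimately show ?thesis by linarith
      qed
      finally have "K \<le> 2 * (4 * (t * (1 + x\<^sup>2)))" using t by (simp add: K_def mult_left_mono)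
      then have "K * (exp 1 + 2 powr (\<alpha> + 1) * exp 1) \<le> 2 * (4 * (t * (1 + x\<^sup>2))) * (exp 1 + 2 powr (\<alpha> + 1) * exp 1)"
        by (intro mult_right_mono add_nonneg_nonneg) auto
      then show "K * (1 * exp 1) + K * (2 powr (\<alpha> + 1) * exp 1) \<le> 4 * D * (t * (1 + x\<^sup>2))"
        by (simp add: D_def algebra_simps)
    qed
    finally show ?thesis .
  qed
  then show ?thesis using D by (intro exI[of _ "4 * D"]) auto
qed

text \<open>The growth \<open>exp z\<close> in \<open>bes_bound\<close>, with
  \<open>z = 2 * pi * x * y / t\<close>, completes the square to
  \<open>exp (- (pi * (x - y)^2 / t)) \<le> 1\<close>. Only the powers of \<open>t\<close> and
  \<open>t + x * y\<close> remain.\<close>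

lemma heat_le:
  "\<exists>C>0. \<forall>t x y. 0 < t \<longrightarrow> 0 \<le> x \<longrightarrow> 0 \<le> y \<longrightarrow> heat t x y \<le> C * (t powr (-1/2) * (t + x * y) powr (-(\<alpha> + 1/2)))"
proof -
  obtain C where C: "C > 0" "\<And>z. z \<ge> 0 \<Longrightarrow> bes (z\<^sup>2 / 4) \<le> C * exp z * (1 + z) powr (-(\<alpha> + 1/2))"
    using bes_bound by blast
  have "heat t x y \<le> 2 powr (-\<alpha>) * C * (t powr (-1/2) * (t + x * y) powr (-(\<alpha> + 1/2)))"
    if t: "0 < t" "0 \<le> x" "0 \<le> y" for t x y
  proof -
    define z where "z = 2 * pi * x * y / t"
    have z: "z \<ge> 0" using t by (simp add: z_def)
    have "(pi * x * y / t)\<^sup>2 = z\<^sup>2 / 4" by (simp add: z_def power_divide power_mult_distrib)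
    then have "exp (- (pi * (x\<^sup>2 + y\<^sup>2) / t)) * bes ((pi * x * y / t)\<^sup>2) \<le> exp (- (pi * (x\<^sup>2 + y\<^sup>2) / t)) * (C * exp z * (1 + z) powr (-(\<alpha> + 1/2)))"
      using C(2)[OF z] by (intro mult_left_mono) (simp_all only: exp_ge_zero)
    also have "\<dots> = C * (exp (- (pi * (x\<^sup>2 + y\<^sup>2) / t) + z) * (1 + z) powr (-(\<alpha> + 1/2)))"
      unfolding exp_add by (simp only: mult_ac)
    also have "\<dots> \<le> C * (1 * ((t + x * y) / t) powr (-(\<alpha> + 1/2)))"
    proof (intro mult_left_mono mult_mono)
      have "- (pi * (x\<^sup>2 + y\<^sup>2) / t) + z = - (pi * (x - y)\<^sup>2 / t)"
        using t by (simp add: z_def field_simps power2_eq_square)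
      then show "exp (- (pi * (x\<^sup>2 + y\<^sup>2) / t) + z) \<le> 1" using t by simp
      have "(t + x * y) / t = 1 + x * y / t" using t by (simp add: field_simps)
      moreover have "x * y / t \<le> z"
      proof -
        have "1 * (x * y) \<le> (2 * pi) * (x * y)" using t pi_ge_two by (intro mult_right_mono) auto
        then show ?thesis using t unfolding z_def by (intro divide_right_mono) (auto simp: mult_ac)
      qed
      ultimately have "(t + x * y) / t \<le> 1 + z" by simp
      then show "(1 + z) powr (-(\<alpha> + 1/2)) \<le> ((t + x * y) / t) powr (-(\<alpha> + 1/2))"
        using alpha t by (intro powr_mono2') (auto intro!: divide_pos_pos add_pos_nonneg)
    qed (use C(1) in auto)
    also have "((t + x * y) / t) powr (-(\<alpha> + 1/2)) = (t + x * y) powr (-(\<alpha> + 1/2)) / t powr (-(\<alpha> + 1/2))"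
      by (rule powr_divide)
    finally have "heat t x y \<le> 2 powr (-\<alpha>) * t powr (-(\<alpha> + 1)) * (C * (1 * ((t + x * y) powr (-(\<alpha> + 1/2)) / t powr (-(\<alpha> + 1/2)))))"
      unfolding heat_def mult.assoc by (intro mult_left_mono) auto
    also have "\<dots> = 2 powr (-\<alpha>) * C * ((t powr (-(\<alpha> + 1)) / t powr (-(\<alpha> + 1/2))) * (t + x * y) powr (-(\<alpha> + 1/2)))"
      by simp
    also have "t powr (-(\<alpha> + 1)) / t powr (-(\<alpha> + 1/2)) = t powr (-1/2)"
      by (simp flip: powr_diff)
    finally show ?thesis .
  qed
  then show ?thesis using C(1) by (intro exI[of _ "2 powr (-\<alpha>) * C"]) auto
qed

subsection \<open>Thin sets\<close>

lemma emeasure_M: "A \<in> sets lebesgue \<Longrightarrow> emeasure M A = (\<integral>\<^sup>+x. ennreal (dens x) * indicator A x \<partial>lebesgue)"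
  unfolding mu_dens using dens_lebesgue by (intro emeasure_density) auto

lemma emeasure_interval_le:
  assumes "0 \<le> a" "a \<le> b"
  shows "emeasure M {a..b} \<le> ennreal ((2 * pi) powr (\<alpha> + 1) * b powr (2 * \<alpha> + 1) * (b - a))"
proof -
  have "emeasure M {a..b} = (\<integral>\<^sup>+x. ennreal (dens x) * indicator {a..b} x \<partial>lebesgue)"
    by (rule emeasure_M) auto
  also have "\<dots> \<le> (\<integral>\<^sup>+x. ennreal ((2 * pi) powr (\<alpha> + 1) * b powr (2 * \<alpha> + 1)) * indicator {a..b} x \<partial>lebesgue)"
  proof (intro nn_integral_mono)
    fix x
    have "dens x \<le> (2 * pi) powr (\<alpha> + 1) * b powr (2 * \<alpha> + 1)" if "x \<in> {a..b}"
      using that assms alpha unfolding dens_def by (auto intro!: mult_left_mono powr_mono2)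
    then show "ennreal (dens x) * indicator {a..b} x \<le> ennreal ((2 * pi) powr (\<alpha> + 1) * b powr (2 * \<alpha> + 1)) * indicator {a..b} x"
      by (auto simp: indicator_def intro: ennreal_leI)
  qed
  also have "\<dots> = ennreal ((2 * pi) powr (\<alpha> + 1) * b powr (2 * \<alpha> + 1)) * ennreal (b - a)"
    using assms by (subst nn_integral_cmult_indicator) auto
  also have "\<dots> = ennreal ((2 * pi) powr (\<alpha> + 1) * b powr (2 * \<alpha> + 1) * (b - a))"
    using assms by (simp add: ennreal_mult)
  finally show ?thesis .
qed

lemma emeasure_M_finite: "0 \<le> a \<Longrightarrow> emeasure M {a..b} < \<infinity>"
  using emeasure_interval_le[of a b] by (cases "a \<le> b") (auto simp: less_top[symmetric] top_unique)

text \<open>In the variable \<open>a\<^sup>2\<close> the intervals \<open>[a, a + step a]\<close> of the thinness condition have length between \<open>1\<close> and \<open>3\<close>.\<close>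
definition step :: "real \<Rightarrow> real" where
  "step a = (if a \<le> 1 then 1 else 1 / a)"

text \<open>For the measure, with \<open>A = 1 + a^2\<close>: the density on the interval is at most
  of order \<open>A powr (\<alpha> + 1/2)\<close> and the length is at most
  \<open>2 / sqrt A\<close>, hence the power \<open>A powr \<alpha>\<close>.\<close>

lemma step_bounds:
  assumes "a \<ge> 0"
  shows "step a > 0" "a\<^sup>2 + 1 \<le> (a + step a)\<^sup>2" "(a + step a)\<^sup>2 \<le> a\<^sup>2 + 3"
    "emeasure M {a..a + step a} \<le> ennreal ((2 * pi) powr (\<alpha> + 1) * 2 powr (2 * \<alpha> + 2) * (1 + a\<^sup>2) powr \<alpha>)"
proof -
  show p: "step a > 0" using assms by (auto simp: step_def)
  have e: "(a + step a)\<^sup>2 = a\<^sup>2 + 2 * (a * step a) + (step a)\<^sup>2" by (simp add: power2_sum)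
  show "a\<^sup>2 + 1 \<le> (a + step a)\<^sup>2" "(a + step a)\<^sup>2 \<le> a\<^sup>2 + 3"
    unfolding e using assms by (auto simp: step_def power_divide)
  define A where "A = 1 + a\<^sup>2"
  have A: "A > 0" by (simp add: A_def add_pos_nonneg)
  have "step a \<le> 1" using assms by (auto simp: step_def)
  moreover have "a \<le> sqrt A" "1 \<le> sqrt A" using assms by (auto simp: A_def real_le_rsqrt)
  ultimately have b: "a + step a \<le> 2 * sqrt A" by linarith
  have s: "step a * sqrt A \<le> 2"
  proof (cases "a \<le> 1")
    case True
    then have "a\<^sup>2 \<le> 1" using assms by (simp add: power_le_one)
    then have "sqrt A \<le> sqrt 4" unfolding A_def by (intro real_sqrt_le_mono) auto
    then show ?thesis using True by (simp add: step_def)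
  next
    case False
    then have "1 \<le> a\<^sup>2" by simp
    then have "A \<le> (2 * a)\<^sup>2" unfolding A_def power_mult_distrib by simp
    then have "sqrt A \<le> 2 * a" using False by (intro real_le_lsqrt) auto
    then show ?thesis using False by (simp add: step_def field_simps)
  qed
  have "emeasure M {a..a + step a} \<le> ennreal ((2 * pi) powr (\<alpha> + 1) * (a + step a) powr (2 * \<alpha> + 1) * (a + step a - a))"
    using assms p by (intro emeasure_interval_le) auto
  also have "\<dots> \<le> ennreal ((2 * pi) powr (\<alpha> + 1) * 2 powr (2 * \<alpha> + 2) * A powr \<alpha>)"
  proof (intro ennreal_leI)
    have "(a + step a) powr (2 * \<alpha> + 1) * step a \<le> (2 * sqrt A) powr (2 * \<alpha> + 1) * (2 / sqrt A)"
      using s b p assms alpha A by (intro mult_mono powr_mono2) (auto simp: field_simps)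
    also have "\<dots> = 2 powr (2 * \<alpha> + 1) * 2 * (sqrt A powr (2 * \<alpha> + 1) / sqrt A)"
      using A by (simp add: powr_mult)
    also have "sqrt A powr (2 * \<alpha> + 1) / sqrt A = A powr \<alpha>"
      using A by (simp add: powr_half_sqrt[symmetric] powr_powr powr_add add_divide_distrib)
    also have "2 powr (2 * \<alpha> + 1) * 2 = (2::real) powr (2 * \<alpha> + 2)"
      by (simp add: powr_add)
    finally show "(2 * pi) powr (\<alpha> + 1) * (a + step a) powr (2 * \<alpha> + 1) * (a + step a - a) \<le> (2 * pi) powr (\<alpha> + 1) * 2 powr (2 * \<alpha> + 2) * A powr \<alpha>"
      by (simp add: mult.assoc mult_left_mono)
  qed
  finally show "emeasure M {a..a + step a} \<le> ennreal ((2 * pi) powr (\<alpha> + 1) * 2 powr (2 * \<alpha> + 2) * (1 + a\<^sup>2) powr \<alpha>)"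
    by (simp add: A_def)
qed

lemma thin_step:
  assumes S: "thin \<alpha> \<epsilon> S" and e: "\<epsilon> \<ge> 0" and a: "a \<ge> 0"
  shows "emeasure M (S \<inter> {a..a + step a}) \<le> ennreal (\<epsilon> * ((2 * pi) powr (\<alpha> + 1) * 2 powr (2 * \<alpha> + 2) * (1 + a\<^sup>2) powr \<alpha>))"
proof -
  have fin: "emeasure M {a..a + step a} \<noteq> \<infinity>" using emeasure_M_finite[OF a, of "a + step a"] by auto
  have meas: "S \<inter> {a..a + step a} \<in> sets M" using S by (auto simp: thin_def)
  have "emeasure M (S \<inter> {a..a + step a}) \<le> emeasure M {a..a + step a}" by (intro emeasure_mono) auto
  then have "emeasure M (S \<inter> {a..a + step a}) = ennreal (measure M (S \<inter> {a..a + step a}))"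
    using fin by (intro emeasure_eq_ennreal_measure) (auto simp: top_unique)
  also have "measure M (S \<inter> {a..a + step a}) \<le> \<epsilon> * measure M {a..a + step a}"
    using S a unfolding thin_def step_def by auto
  also have "\<dots> \<le> \<epsilon> * ((2 * pi) powr (\<alpha> + 1) * 2 powr (2 * \<alpha> + 2) * (1 + a\<^sup>2) powr \<alpha>)"
    using step_bounds(4)[OF a] fin e by (intro mult_left_mono) (auto simp: measure_def intro!: enn2real_leI)
  finally show ?thesis by (simp add: ennreal_leI)
qed

text \<open>Walk to the right from \<open>sqrt (max 0 (x^2 - m))\<close> by successive steps. Each
  step raises the square by at least 1, so \<open>2 * m + 1\<close> intervals cover the region, and
  by at most 3, so every \<open>1 + (a k)^2\<close> is comparable to \<open>1 + x^2\<close> with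
  factor \<open>L\<close>. The thinness condition is used once on each interval.\<close>

lemma thin_cover:
  fixes m :: nat
  shows "\<exists>C>0. \<forall>\<epsilon> S x. thin \<alpha> \<epsilon> S \<longrightarrow> \<epsilon> \<ge> 0 \<longrightarrow> emeasure M (S \<inter> {y. \<bar>y\<^sup>2 - x\<^sup>2\<bar> \<le> real m}) \<le> ennreal (\<epsilon> * C * (1 + x\<^sup>2) powr \<alpha>)"
proof -
  \<comment> \<open>One more than the width \<open>2 * m\<close> of the region in the squared
    variable, so that the last point lies strictly beyond it.\<close>
  define K where "K = 2 * m + 1"
  define L where "L = 1 + 3 * real K"
  define D where "D = (2 * pi) powr (\<alpha> + 1) * 2 powr (2 * \<alpha> + 2) * L powr \<bar>\<alpha>\<bar>"
  have D: "D > 0" by (simp add: D_def L_def)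
  have "emeasure M (S \<inter> {y. \<bar>y\<^sup>2 - x\<^sup>2\<bar> \<le> real m}) \<le> ennreal (\<epsilon> * (real K * D) * (1 + x\<^sup>2) powr \<alpha>)"
    if S: "thin \<alpha> \<epsilon> S" and e: "\<epsilon> \<ge> 0" for \<epsilon> S x
  proof -
    define a where "a = rec_nat (sqrt (max 0 (x\<^sup>2 - real m))) (\<lambda>_ a. a + step a)"
    have a0: "a 0 = sqrt (max 0 (x\<^sup>2 - real m))" and aS: "a (Suc k) = a k + step (a k)" for k
      by (simp_all add: a_def)
    have ann: "a k \<ge> 0" for k
      by (induction k) (use a0 aS step_bounds(1) in \<open>auto simp: add_nonneg_nonneg less_imp_le\<close>)
    have asq: "(a 0)\<^sup>2 + real k \<le> (a k)\<^sup>2" "(a k)\<^sup>2 \<le> (a 0)\<^sup>2 + 3 * real k" for k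
    proof (induction k)
      case (Suc k)
      { case 1 then show ?case using Suc step_bounds(2)[OF ann[of k]] by (simp add: aS) }
      { case 2 then show ?case using Suc step_bounds(3)[OF ann[of k]] by (simp add: aS) }
    qed auto
    have a0sq: "(a 0)\<^sup>2 = max 0 (x\<^sup>2 - real m)" by (simp add: a0)
    have cov: "S \<inter> {y. \<bar>y\<^sup>2 - x\<^sup>2\<bar> \<le> real m} \<subseteq> (\<Union>k<K. S \<inter> {a k..a k + step (a k)})"
    proof
      fix y assume y: "y \<in> S \<inter> {y. \<bar>y\<^sup>2 - x\<^sup>2\<bar> \<le> real m}"
      then have y0: "y \<ge> 0" using S by (auto simp: thin_def)
      have "a 0 \<le> y" using y y0 unfolding a0 by (intro real_le_lsqrt) (auto simp: abs_le_iff)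
      moreover have "y < a K"
      proof -
        have "y\<^sup>2 < (a 0)\<^sup>2 + real K" using y unfolding a0sq K_def by (auto simp: abs_le_iff)
        also have "\<dots> \<le> (a K)\<^sup>2" by (rule asq)
        finally show ?thesis using ann[of K] by (simp add: power_less_imp_less_base)
      qed
      ultimately have "\<exists>k<K. a k \<le> y \<and> y \<le> a (Suc k)"
      proof (induction K)
        case (Suc K)
        show ?case
        proof (cases "y < a K")
          case True
          then obtain k where "k < K" "a k \<le> y" "y \<le> a (Suc k)" using Suc by blast
          then show ?thesis by (intro exI[of _ k]) auto
        next
          case False
          with Suc show ?thesis by (intro exI[of _ K]) auto
        qed
      qed auto
      then show "y \<in> (\<Union>k<K. S \<inter> {a k..a k + step (a k)})"
        using y by (auto simp: aS)
    qed
    have bd: "emeasure M (S \<inter> {a k..a k + step (a k)}) \<le> ennreal (\<epsilon> * (D * (1 + x\<^sup>2) powr \<alpha>))" if k: "k < K" for k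
    proof -
      have "(1 + (a k)\<^sup>2) powr \<alpha> \<le> L powr \<bar>\<alpha>\<bar> * (1 + x\<^sup>2) powr \<alpha>"
      proof (rule powr_between)
        have "(a 0)\<^sup>2 \<le> x\<^sup>2" unfolding a0sq by (rule max.boundedI) simp_all
        moreover have "real k \<le> real K" using k by simp
        ultimately have "1 + (a k)\<^sup>2 \<le> 1 + x\<^sup>2 + 3 * real K" using asq(2)[of k] by linarith
        also have "\<dots> \<le> L * (1 + x\<^sup>2)" by (simp add: L_def algebra_simps)
        finally show "1 + (a k)\<^sup>2 \<le> L * (1 + x\<^sup>2)" .
        have "1 + x\<^sup>2 \<le> 1 + (a k)\<^sup>2 + 3 * real K" using asq(1)[of k] unfolding a0sq by (auto simp: max_def K_def split: if_splits)
        also have "\<dots> \<le> L * (1 + (a k)\<^sup>2)" by (simp add: L_def algebra_simps)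
        finally show "1 + x\<^sup>2 \<le> L * (1 + (a k)\<^sup>2)" .
      qed (auto simp: L_def add_pos_nonneg)
      then have "\<epsilon> * ((2 * pi) powr (\<alpha> + 1) * 2 powr (2 * \<alpha> + 2) * (1 + (a k)\<^sup>2) powr \<alpha>) \<le> 
         \<epsilon> * ((2 * pi) powr (\<alpha> + 1) * 2 powr (2 * \<alpha> + 2) * (L powr \<bar>\<alpha>\<bar> * (1 + x\<^sup>2) powr \<alpha>))"
        using e by (intro mult_left_mono) auto
      also have "\<dots> = \<epsilon> * (D * (1 + x\<^sup>2) powr \<alpha>)" by (simp add: D_def)
      finally show ?thesis by (intro order_trans[OF thin_step[OF S e ann[of k]]] ennreal_leI)
    qed
    have "emeasure M (S \<inter> {y. \<bar>y\<^sup>2 - x\<^sup>2\<bar> \<le> real m}) \<le> emeasure M (\<Union>k<K. S \<inter> {a k..a k + step (a k)})"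
      using S by (intro emeasure_mono cov sets.finite_UN) (auto simp: thin_def)
    also have "\<dots> \<le> (\<Sum>k<K. emeasure M (S \<inter> {a k..a k + step (a k)}))"
      using S by (intro emeasure_subadditive_finite) (auto simp: thin_def)
    also have "\<dots> \<le> (\<Sum>k<K. ennreal (\<epsilon> * (D * (1 + x\<^sup>2) powr \<alpha>)))"
      by (intro sum_mono bd) auto
    also have "\<dots> = ennreal (real K * (\<epsilon> * (D * (1 + x\<^sup>2) powr \<alpha>)))"
      using e D by (subst sum_ennreal) auto
    finally show ?thesis by (simp add: mult_ac)
  qed
  moreover have "real K * D > 0" using D by (simp add: K_def)
  ultimately show ?thesis by blast
qed

text \<open>In \<open>heat_le\<close> the factor \<open>t + x * y\<close> is at least
  \<open>c * (1 + x^2)\<close>: for \<open>x^2 \<ge> 2 * m\<close> because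
  \<open>y \<ge> x / 2\<close>, and otherwise because \<open>x\<close> is bounded and
  \<open>t\<close> alone is large enough, which explains the two entries of \<open>c\<close>. The
  factor \<open>t powr (-1/2)\<close> costs at most order \<open>(1 + x^2) powr (1/2)\<close>, so
  the exponents add up to \<open>- \<alpha>\<close>, cancelling the power in
  \<open>thin_cover\<close>.\<close>

lemma heat_sup:
  fixes m :: nat
  assumes m: "m \<ge> 1" and h: "h > 0"
  shows "\<exists>C>0. \<forall>t x y. 0 \<le> x \<longrightarrow> 0 \<le> y \<longrightarrow> \<bar>y\<^sup>2 - x\<^sup>2\<bar> \<le> real m \<longrightarrow> h / (1 + x\<^sup>2) \<le> t \<longrightarrow> heat t x y \<le> C * (1 + x\<^sup>2) powr (- \<alpha>)"
proof -
  obtain C where C: "C > 0" "\<And>t x y. 0 < t \<Longrightarrow> 0 \<le> x \<Longrightarrow> 0 \<le> y \<Longrightarrow> heat t x y \<le> C * (t powr (-1/2) * (t + x * y) powr (-(\<alpha> + 1/2)))"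
    using heat_le by blast
  define c where "c = min (h / (1 + 2 * real m)\<^sup>2) (1 / 4)"
  have c: "c > 0" using h m by (simp add: c_def)
  define D where "D = C * (h powr (-1/2) * c powr (-(\<alpha> + 1/2)))"
  have main: "heat t x y \<le> D * (1 + x\<^sup>2) powr (- \<alpha>)"
    if xy: "0 \<le> x" "0 \<le> y" "\<bar>y\<^sup>2 - x\<^sup>2\<bar> \<le> real m" and t: "h / (1 + x\<^sup>2) \<le> t" for t x y
  proof -
    define X where "X = 1 + x\<^sup>2"
    have X: "X \<ge> 1" by (simp add: X_def)
    have "h / X > 0" using h X by simp
    then have t0: "t > 0" using t unfolding X_def[symmetric] by linarith
    have lower: "c * X \<le> t + x * y"
    proof (cases "x\<^sup>2 \<ge> 2 * real m")
      case True
      have "x\<^sup>2 / 4 \<le> y\<^sup>2"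
        using True abs_le_D2[OF xy(3)] zero_le_power2[of x] by linarith
      then have "(x / 2)\<^sup>2 \<le> y\<^sup>2" by (simp only: power_divide power2_eq_square[of "2::real"])
      then have "x / 2 \<le> y" by (rule power2_le_imp_le[OF _ xy(2)])
      then have "x * (x / 2) \<le> x * y" using xy(1) by (rule mult_left_mono)
      then have "x\<^sup>2 / 2 \<le> x * y" by (simp add: power2_eq_square)
      moreover have "X / 4 \<le> x\<^sup>2 / 2" using True m unfolding X_def by simp
      moreover have "c * X \<le> 1 / 4 * X" using X unfolding c_def by (intro mult_right_mono min.cobounded2) auto
      ultimately show ?thesis using t0 by simp
    next
      case False
      then have X2: "X \<le> 1 + 2 * real m" by (simp add: X_def)
      have "c * X \<le> h / (1 + 2 * real m)\<^sup>2 * X" using X unfolding c_def by (intro mult_right_mono min.cobounded1) auto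
      also have "\<dots> \<le> h / X\<^sup>2 * X" using X X2 h by (intro mult_right_mono divide_left_mono power_mono) auto
      also have "\<dots> = h / X" using X by (simp add: power2_eq_square)
      also have "\<dots> \<le> t" using t by (simp add: X_def)
      finally have "c * X \<le> t" .
      moreover have "0 \<le> x * y" using xy by simp
      ultimately show ?thesis by linarith
    qed
    have "heat t x y \<le> C * (t powr (-1/2) * (t + x * y) powr (-(\<alpha> + 1/2)))"
      by (intro C t0 xy)
    also have "\<dots> \<le> C * ((h / X) powr (-1/2) * (c * X) powr (-(\<alpha> + 1/2)))"
    proof (intro mult_left_mono mult_mono powr_mono2')
      show "h / X \<le> t" using t by (simp add: X_def)
      have "0 < X" using X by linarith
      with c h show "0 < c * X" "0 < h / X" by simp_all
    qed (use C(1) lower alpha in simp_all)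
    also have "\<dots> = D * (X powr (1/2) * X powr (-(\<alpha> + 1/2)))"
    proof -
      have "(h / X) powr (-1/2) = h powr (-1/2) * X powr (1/2)"
      proof -
        have "-1/2 = - (1/2::real)" by simp
        then have "X powr (-1/2) = inverse (X powr (1/2))" by (simp only: powr_minus)
        then show ?thesis unfolding powr_divide by (simp only: divide_inverse inverse_inverse_eq)
      qed
      moreover have "(c * X) powr (-(\<alpha> + 1/2)) = c powr (-(\<alpha> + 1/2)) * X powr (-(\<alpha> + 1/2))"
        by (rule powr_mult)
      ultimately show ?thesis unfolding D_def by (simp only: mult_ac)
    qed
    also have "X powr (1/2) * X powr (-(\<alpha> + 1/2)) = X powr (-\<alpha>)"
      by (simp flip: powr_add)
    finally show ?thesis by (simp add: X_def)
  qed
  have "D > 0" using C(1) h c by (simp add: D_def)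
  show ?thesis
  proof (rule exI[of _ D], rule conjI[OF \<open>D > 0\<close>], intro allI impI)
    fix t x y
    assume "0 \<le> x" "0 \<le> y" "\<bar>y\<^sup>2 - x\<^sup>2\<bar> \<le> real m" "h / (1 + x\<^sup>2) \<le> t"
    then show "heat t x y \<le> D * (1 + x\<^sup>2) powr (- \<alpha>)" by (rule main)
  qed
qed

subsection \<open>Dyadic sums of heat kernels\<close>

text \<open>A bump in the variable \<open>s * (1 + x^2)\<close>: at most linear where that is small
  and exponentially decaying where it is large. Hence it singles out the time adapted to
  \<open>x\<close>.\<close>

definition wt :: "real \<Rightarrow> real \<Rightarrow> real" where
  "wt s x = damp s x - damp (2 * s) x"

lemma wt_bounds:
  assumes s: "s > 0"
  shows "wt s x \<ge> 0" "wt s x \<le> damp s x" "wt s x \<le> pi * (s * (1 + x\<^sup>2))"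
    "wt s x \<le> 1" "wt s x * (s * (1 + x\<^sup>2)) \<le> min (s * (1 + x\<^sup>2)) (1 / (s * (1 + x\<^sup>2)))"
proof -
  define r where "r = s * (1 + x\<^sup>2)"
  have r: "r > 0" using s by (simp add: r_def add_pos_nonneg)
  have w: "wt s x = exp (- (pi * r)) - exp (- (2 * (pi * r)))"
    by (simp add: wt_def r_def mult_ac)
  have w1: "wt s x = exp (- (pi * r)) * (1 - exp (- (pi * r)))"
    unfolding w by (simp add: algebra_simps flip: exp_add)
  have e1: "exp (- (pi * r)) \<le> 1" using r by simp
  show w0: "wt s x \<ge> 0" unfolding w1 using e1 by (intro mult_nonneg_nonneg) auto
  have w2: "wt s x \<le> exp (- (pi * r))" unfolding w by simp
  then show "wt s x \<le> damp s x" by (simp add: r_def mult.assoc)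
  show w4: "wt s x \<le> 1" using w2 e1 by linarith
  have "wt s x \<le> 1 * (1 - exp (- (pi * r)))" unfolding w1 using e1 by (intro mult_right_mono) auto
  also have "\<dots> \<le> pi * r" using exp_ge_add_one_self[of "- (pi * r)"] by simp
  finally show "wt s x \<le> pi * (s * (1 + x\<^sup>2))" by (simp add: r_def)
  have "wt s x * r \<le> 1 * r" using w4 r by (intro mult_right_mono) auto
  moreover have "wt s x * r \<le> 1 / r"
  proof -
    have "r\<^sup>2 \<le> exp (pi * r)"
    proof -
      have "r\<^sup>2 * 1 \<le> (pi * r)\<^sup>2 / 2"
      proof -
        have "2\<^sup>2 \<le> pi\<^sup>2" using pi_ge_two by (intro power_mono) auto
        then have "r\<^sup>2 * 2 \<le> r\<^sup>2 * pi\<^sup>2" by (intro mult_left_mono) auto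
        then show ?thesis by (simp add: power_mult_distrib mult_ac)
      qed
      also have "\<dots> \<le> exp (pi * r)" using exp_lower_Taylor_quadratic[of "pi * r"] r
        by (smt (verit) mult_nonneg_nonneg pi_ge_zero)
      finally show ?thesis by simp
    qed
    then have "exp (- (pi * r)) * r\<^sup>2 \<le> 1" by (simp add: exp_minus field_simps)
    moreover have "wt s x * r\<^sup>2 \<le> exp (- (pi * r)) * r\<^sup>2" using w2 by (intro mult_right_mono) auto
    ultimately have "wt s x * r\<^sup>2 \<le> 1" by linarith
    then show ?thesis using r by (simp add: field_simps power2_eq_square)
  qed
  ultimately show "wt s x * (s * (1 + x\<^sup>2)) \<le> min (s * (1 + x\<^sup>2)) (1 / (s * (1 + x\<^sup>2)))"
    unfolding r_def[symmetric] by simp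
qed

text \<open>Doubling the time \<open>1 / 2 ^ n\<close> gives the preceding dyadic time, so the sum
  collapses to a difference of two values of \<open>damp\<close>.\<close>

lemma wt_sum_le: "(\<Sum>n=1..N. wt (1 / 2 ^ n) x) \<le> 1"
proof -
  define g where "g n = exp (- (pi * (1 / 2 ^ n) * (1 + x\<^sup>2)))" for n :: nat
  have "(\<Sum>n=1..N. wt (1 / 2 ^ n) x) = (\<Sum>n=1..N. g n - g (n - 1))"
  proof (rule sum.cong)
    fix n assume "n \<in> {1..N}"
    then obtain m where m: "n = Suc m" by (cases n) auto
    show "wt (1 / 2 ^ n) x = g n - g (n - 1)" by (simp add: m wt_def g_def)
  qed simp
  also have "\<dots> = g N - g 0" by (induction N) auto
  also have "\<dots> \<le> 1 - 0"
    by (intro diff_mono) (auto simp: g_def add_nonneg_nonneg intro!: mult_nonneg_nonneg divide_nonneg_nonneg)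
  finally show ?thesis by simp
qed

lemma wt_measurable [measurable (raw)]:
  assumes [measurable]: "f \<in> borel_measurable N"
  shows "(\<lambda>p. wt s (f p)) \<in> borel_measurable N"
  unfolding wt_def by measurable

text \<open>The factor \<open>c\<close> separates the heat time from the time in the weight:
  \<open>c = 1\<close> is the form in \<open>f\<close>, \<open>c = 2\<close> the form in its
  transform, as in \<open>pairing_diff\<close>.\<close>

definition ker :: "real \<Rightarrow> nat \<Rightarrow> real \<Rightarrow> real \<Rightarrow> real" where
  "ker c N x y = (\<Sum>n=1..N. wt (1 / 2 ^ n) x * heat (c / 2 ^ n) x y)"

lemma ker_measurable [measurable (raw)]:
  assumes [measurable]: "f \<in> borel_measurable L" "g \<in> borel_measurable L"
  shows "(\<lambda>p. ker c N (f p) (g p)) \<in> borel_measurable L"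
  unfolding ker_def by measurable

lemma ker_nn:
  assumes h: "h \<in> borel_measurable M" and h0: "\<And>y. h y \<ge> 0"
  shows "(\<integral>\<^sup>+y. ennreal (ker c N x y) * h y \<partial>M) = (\<Sum>n=1..N. ennreal (wt (1 / 2 ^ n) x) * (\<integral>\<^sup>+y. ennreal (heat (c / 2 ^ n) x y) * h y \<partial>M))"
proof -
  note [measurable] = h
  have "(\<integral>\<^sup>+y. ennreal (ker c N x y) * h y \<partial>M) = (\<integral>\<^sup>+y. (\<Sum>n=1..N. ennreal (wt (1 / 2 ^ n) x) * (ennreal (heat (c / 2 ^ n) x y) * h y)) \<partial>M)"
    unfolding ker_def using heat_nonneg wt_bounds(1)
    by (intro nn_integral_cong) (simp add: sum_distrib_right ennreal_mult mult.assoc flip: sum_ennreal)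
  also have "\<dots> = (\<Sum>n=1..N. (\<integral>\<^sup>+y. ennreal (wt (1 / 2 ^ n) x) * (ennreal (heat (c / 2 ^ n) x y) * h y) \<partial>M))"
    by (rule nn_integral_sum) measurable
  also have "\<dots> = (\<Sum>n=1..N. ennreal (wt (1 / 2 ^ n) x) * (\<integral>\<^sup>+y. ennreal (heat (c / 2 ^ n) x y) * h y \<partial>M))"
    by (intro sum.cong refl nn_integral_cmult) measurable
  finally show ?thesis .
qed

lemma ker_row:
  assumes c: "c > 0"
  shows "(\<integral>\<^sup>+y. ennreal (ker c N x y) \<partial>M) \<le> 1"
proof -
  have "(\<integral>\<^sup>+y. ennreal (ker c N x y) \<partial>M) = (\<Sum>n=1..N. ennreal (wt (1 / 2 ^ n) x))"
    using ker_nn[of "\<lambda>_. 1" c N x] c by (simp add: heat_mass)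
  also have "\<dots> = ennreal (\<Sum>n=1..N. wt (1 / 2 ^ n) x)"
    by (intro sum_ennreal wt_bounds) auto
  also have "\<dots> \<le> ennreal 1" by (intro ennreal_leI wt_sum_le)
  finally show ?thesis by simp
qed

text \<open>Here the weight sits on the variable of integration and does not telescope. Instead each
  scale is bounded by a multiple of \<open>min r (1 / r)\<close> with \<open>r = s * Y\<close>, and
  \<open>sum_dyadic_min_le\<close> sums these.\<close>

lemma ker_column:
  "\<exists>C>0. \<forall>c N y. 0 < c \<longrightarrow> c \<le> 2 \<longrightarrow> (\<integral>\<^sup>+x. ennreal (ker c N x y) \<partial>M) \<le> ennreal C"
proof -
  obtain V where V: "V > 0" "\<And>t x. 0 < t \<Longrightarrow> t \<le> 1 \<Longrightarrow> spread t x \<le> ennreal (V * (t * (1 + x\<^sup>2)))"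
    using heat_variance by blast
  define D where "D = pi * (2 + V)"
  have D: "D \<ge> 1"
  proof -
    have "1 * 1 \<le> pi * (2 + V)" using pi_ge_two V(1) by (intro mult_mono) auto
    then show ?thesis by (simp add: D_def)
  qed
  have "(\<integral>\<^sup>+x. ennreal (ker c N x y) \<partial>M) \<le> ennreal (D * 6)" if c: "0 < c" "c \<le> 2" for c N y
  proof -
    define Y where "Y = 1 + y\<^sup>2"
    have Y: "Y \<ge> 1" by (simp add: Y_def)
    have tm: "(\<integral>\<^sup>+x. ennreal (wt (1 / 2 ^ n) x * heat (c / 2 ^ n) x y) \<partial>M) \<le> ennreal (D * min (Y / 2 ^ n) (1 / (Y / 2 ^ n)))"
      if n: "n \<in> {1..N}" for n
    proof -
      define s where "s = 1 / (2::real) ^ n"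
      define t where "t = c / 2 ^ n"
      \<comment> \<open>Starting the sum at \<open>n = 1\<close> makes \<open>s \<le> 1/2\<close>,
        so that \<open>c \<le> 2\<close> still gives \<open>t \<le> 1\<close>, the range of
        \<open>heat_variance\<close>.\<close>
      have "(2::real) ^ 1 \<le> 2 ^ n" using n by (intro power_increasing) auto
      then have s: "s > 0" "s \<le> 1/2" by (simp_all add: s_def field_simps)
      have ts: "t = c * s" by (simp add: t_def s_def)
      have t: "t > 0" "t \<le> 1" using c s mult_mono[of c 2 s "1/2"] by (auto simp: ts)
      \<comment> \<open>For large \<open>s * Y\<close>: the heat average of the Gaussian damping is
        again a Gaussian in \<open>y\<close>, with rate at least half of the original one.\<close>
      have A: "(\<integral>\<^sup>+x. ennreal (wt s x * heat t x y) \<partial>M) \<le> ennreal (1 / (s * Y))"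
      proof -
        have "(\<integral>\<^sup>+x. ennreal (wt s x * heat t x y) \<partial>M) \<le> (\<integral>\<^sup>+x. ennreal (exp (- (pi * s))) * ennreal (heat t y x * gauss s x) \<partial>M)"
        proof (intro nn_integral_mono)
          fix x
          have "wt s x * heat t x y \<le> damp s x * heat t x y"
            by (intro mult_right_mono wt_bounds s heat_nonneg)
          also have "damp s x = exp (- (pi * s)) * gauss s x"
            by (simp add: algebra_simps flip: exp_add)
          finally show "ennreal (wt s x * heat t x y) \<le> ennreal (exp (- (pi * s))) * ennreal (heat t y x * gauss s x)"
            using heat_nonneg by (simp add: heat_sym[of t y x] mult_ac ennreal_leI flip: ennreal_mult)
        qed
        also have "\<dots> = ennreal (exp (- (pi * s))) * (\<integral>\<^sup>+x. ennreal (heat t y x * gauss s x) \<partial>M)"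
          by (rule nn_integral_cmult) measurable
        also have "\<dots> = ennreal (exp (- (pi * s)) * ((1 + t * s) powr (- (\<alpha> + 1)) * exp (- (pi * s * y\<^sup>2 / (1 + t * s)))))"
          using s t by (subst heat_exp_nn) (auto simp: ennreal_mult add_pos_nonneg)
        also have "\<dots> \<le> ennreal (1 / (s * Y))"
        proof (intro ennreal_leI)
          have t2: "1 + t * s \<le> 2" "1 \<le> 1 + t * s" using s t mult_mono[of t 1 s 1] by auto
          have "(1 + t * s) powr (- (\<alpha> + 1)) \<le> 1" using t2 alpha by (intro powr_le1) auto
          then have "exp (- (pi * s)) * ((1 + t * s) powr (- (\<alpha> + 1)) * exp (- (pi * s * y\<^sup>2 / (1 + t * s)))) \<le>
             exp (- (pi * s)) * (1 * exp (- (pi * s * y\<^sup>2 / (1 + t * s))))"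
            by (intro mult_left_mono mult_right_mono) auto
          also have "\<dots> = exp (- (pi * s + pi * s * y\<^sup>2 / (1 + t * s)))" by (simp flip: exp_add)
          also have "\<dots> \<le> exp (- (s * Y))"
          proof -
            have "pi * s * y\<^sup>2 / 2 \<le> pi * s * y\<^sup>2 / (1 + t * s)"
              using t2 s by (intro divide_left_mono) auto
            moreover have "2 * (s * y\<^sup>2) \<le> pi * (s * y\<^sup>2)" "2 * s \<le> pi * s" 
              using s pi_ge_two by (intro mult_right_mono; simp)+
            moreover have "pi * s * y\<^sup>2 / 2 = pi * (s * y\<^sup>2) / 2" "s * Y = s + s * y\<^sup>2"
              by (simp_all add: Y_def distrib_left)
            ultimately have "s * Y \<le> pi * s + pi * s * y\<^sup>2 / (1 + t * s)"
              using s by linarith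
            then show ?thesis by simp
          qed
          also have "\<dots> \<le> 1 / (s * Y)"
          proof -
            have "s * Y \<le> exp (s * Y)" using exp_ge_add_one_self[of "s * Y"] by linarith
            then show ?thesis using s Y by (simp add: exp_minus field_simps)
          qed
          finally show "exp (- (pi * s)) * ((1 + t * s) powr (- (\<alpha> + 1)) * exp (- (pi * s * y\<^sup>2 / (1 + t * s)))) \<le> 1 / (s * Y)" .
        qed
        finally show ?thesis .
      qed
      \<comment> \<open>For small \<open>s * Y\<close>: the weight is at most
        \<open>pi * s * (1 + x^2)\<close>, and the variance bound shows that the heat average of
        \<open>1 + x^2\<close> around \<open>y\<close> is of order \<open>Y\<close>.\<close>
      have Bd: "(\<integral>\<^sup>+x. ennreal (wt s x * heat t x y) \<partial>M) \<le> ennreal (D * (s * Y))"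
      proof -
        have "(\<integral>\<^sup>+x. ennreal (wt s x * heat t x y) \<partial>M) \<le> (\<integral>\<^sup>+x. ennreal (pi * s) * (ennreal (2 * Y) * ennreal (heat t y x) + ennreal (heat t y x * (x\<^sup>2 - y\<^sup>2)\<^sup>2)) \<partial>M)"
        proof (intro nn_integral_mono)
          fix x
          have "wt s x * heat t x y \<le> pi * (s * (1 + x\<^sup>2)) * heat t x y"
            by (intro mult_right_mono wt_bounds s heat_nonneg)
          also have "\<dots> \<le> pi * (s * (2 * Y + (x\<^sup>2 - y\<^sup>2)\<^sup>2)) * heat t x y"
          proof (intro mult_right_mono mult_left_mono heat_nonneg)
            have "u \<le> 1 + u\<^sup>2" for u :: real
              using zero_le_power2[of "u - 1/2"] by (simp add: power2_eq_square algebra_simps)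
            from this[of "x\<^sup>2 - y\<^sup>2"] have "x\<^sup>2 - y\<^sup>2 \<le> 1 + (x\<^sup>2 - y\<^sup>2)\<^sup>2" .
            moreover have H: "1 + a \<le> 2 * (1 + b) + q" if "a - b \<le> 1 + q" "0 \<le> b" for a b q :: real
              using that by (simp add: distrib_left)
            ultimately show "1 + x\<^sup>2 \<le> 2 * Y + (x\<^sup>2 - y\<^sup>2)\<^sup>2"
              unfolding Y_def by (intro H zero_le_power2)
          qed (use s in auto)
          also have "\<dots> = (pi * s) * ((2 * Y) * heat t y x + heat t y x * (x\<^sup>2 - y\<^sup>2)\<^sup>2)"
            by (simp add: heat_sym[of t y x] algebra_simps)
          finally show "ennreal (wt s x * heat t x y) \<le> ennreal (pi * s) * (ennreal (2 * Y) * ennreal (heat t y x) + ennreal (heat t y x * (x\<^sup>2 - y\<^sup>2)\<^sup>2))"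
            using heat_nonneg s Y by (simp add: ennreal_leI flip: ennreal_mult ennreal_plus)
        qed
        also have "\<dots> = ennreal (pi * s) * (ennreal (2 * Y) * (\<integral>\<^sup>+x. ennreal (heat t y x) \<partial>M) + (\<integral>\<^sup>+x. ennreal (heat t y x * (x\<^sup>2 - y\<^sup>2)\<^sup>2) \<partial>M))"
        proof -
          have m1: "(\<lambda>x. ennreal (heat t y x)) \<in> borel_measurable M" by measurable
          have m2: "(\<lambda>x. ennreal (heat t y x * (x\<^sup>2 - y\<^sup>2)\<^sup>2)) \<in> borel_measurable M" by measurable
          have m3: "(\<lambda>x. ennreal (2 * Y) * ennreal (heat t y x)) \<in> borel_measurable M" by measurable
          show ?thesis using m1 m2 m3 by (simp add: nn_integral_cmult nn_integral_add)
        qed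
        also have "\<dots> \<le> ennreal (pi * s) * (ennreal (2 * Y) * 1 + ennreal (V * (t * Y)))"
          unfolding heat_mass[OF t(1)] Y_def by (intro mult_left_mono add_left_mono V t) auto
        also have "\<dots> = ennreal (pi * s * (2 * Y + V * (t * Y)))"
          using s Y V(1) t by (simp flip: ennreal_mult ennreal_plus)
        also have "\<dots> \<le> ennreal (D * (s * Y))"
        proof (intro ennreal_leI)
          have "2 * Y + V * (t * Y) \<le> 2 * Y + V * (1 * Y)"
            using t V(1) Y by (intro add_left_mono mult_left_mono mult_right_mono) auto
          then have "pi * s * (2 * Y + V * (t * Y)) \<le> pi * s * (2 * Y + V * (1 * Y))"
            using s by (intro mult_left_mono) auto
          then show "pi * s * (2 * Y + V * (t * Y)) \<le> D * (s * Y)" by (simp add: D_def algebra_simps)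
        qed
        finally show ?thesis .
      qed
      have "1 / (s * Y) \<le> D * (1 / (s * Y))"
        using D s Y mult_right_mono[of 1 D "1 / (s * Y)"] by simp
      then have A': "(\<integral>\<^sup>+x. ennreal (wt s x * heat t x y) \<partial>M) \<le> ennreal (D * (1 / (s * Y)))"
        by (intro order_trans[OF A] ennreal_leI)
      have "Y / 2 ^ n = s * Y" by (simp add: s_def)
      then show ?thesis using A' Bd unfolding s_def[symmetric] t_def[symmetric] by (simp add: min_def)
    qed
    have "(\<integral>\<^sup>+x. ennreal (ker c N x y) \<partial>M) = (\<integral>\<^sup>+x. (\<Sum>n=1..N. ennreal (wt (1 / 2 ^ n) x * heat (c / 2 ^ n) x y)) \<partial>M)"
      unfolding ker_def using heat_nonneg wt_bounds(1)
      by (intro nn_integral_cong) (subst sum_ennreal, auto)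
    also have "\<dots> = (\<Sum>n=1..N. \<integral>\<^sup>+x. ennreal (wt (1 / 2 ^ n) x * heat (c / 2 ^ n) x y) \<partial>M)"
      by (rule nn_integral_sum) measurable
    also have "\<dots> \<le> (\<Sum>n=1..N. ennreal (D * min (Y / 2 ^ n) (1 / (Y / 2 ^ n))))"
      by (intro sum_mono tm)
    also have "\<dots> = ennreal (\<Sum>n=1..N. D * min (Y / 2 ^ n) (1 / (Y / 2 ^ n)))"
      using D Y by (intro sum_ennreal) auto
    also have "\<dots> \<le> ennreal (D * 6)"
      unfolding sum_distrib_left[symmetric] using D Y by (intro ennreal_leI mult_left_mono sum_dyadic_min_le) auto
    finally show ?thesis .
  qed
  then show ?thesis using D by (intro exI[of _ "D * 6"]) auto
qed

lemma AE_M_nonneg: "AE x in M. x \<ge> 0"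
proof -
  have "AE x in lebesgue. 0 < ennreal (dens x) \<longrightarrow> x \<ge> 0"
    by (intro AE_I2) (auto simp: dens_def indicator_def split: if_splits)
  then show ?thesis
    unfolding mu_dens using dens_lebesgue by (subst AE_density) auto
qed

lemma M_fst: "f \<in> borel_measurable M \<Longrightarrow> (\<lambda>p. f (fst p)) \<in> borel_measurable (M \<Otimes>\<^sub>M M)"
  by (rule measurable_compose[OF measurable_fst])

lemma M_snd: "f \<in> borel_measurable M \<Longrightarrow> (\<lambda>p. f (snd p)) \<in> borel_measurable (M \<Otimes>\<^sub>M M)"
  by (rule measurable_compose[OF measurable_snd])

sublocale pair: pair_sigma_finite M M ..

text \<open>Times with \<open>s (1 + x\<^sup>2)\<close> small carry little weight; for the others the variance bound restricts to \<open>|y\<^sup>2 - x\<^sup>2| \<le> m\<close>, where the kernel is bounded by the inverse of the measure of that region.\<close>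
lemma heat_on_thin:
  assumes "\<delta> > 0"
  shows "\<exists>\<epsilon>0>0. \<forall>\<epsilon> S c N x. 0 \<le> \<epsilon> \<longrightarrow> \<epsilon> < \<epsilon>0 \<longrightarrow> thin \<alpha> \<epsilon> S \<longrightarrow> 1 \<le> c \<longrightarrow> c \<le> 2 \<longrightarrow> 0 \<le> x \<longrightarrow>
    (\<integral>\<^sup>+y. ennreal (ker c N x y) * indicator S y \<partial>M) \<le> ennreal \<delta>"
proof -
  obtain V where V: "V > 0" "\<And>t x. 0 < t \<Longrightarrow> t \<le> 1 \<Longrightarrow> spread t x \<le> ennreal (V * (t * (1 + x\<^sup>2)))"
    using heat_variance by blast
  \<comment> \<open>Three errors receive a third of \<open>\<delta>\<close> each:
    \<open>2 * pi * \<eta>\<close> from small times, \<open>12 * V / m^2\<close> from distant points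
    and \<open>H * \<epsilon>\<close> from the nearby part of \<open>S\<close>. This fixes
    \<open>\<eta>\<close>, \<open>m\<close> and the threshold
    \<open>\<delta> / (3 * H)\<close>.\<close>
  define \<eta> where "\<eta> = \<delta> / (6 * pi)"
  have \<eta>: "\<eta> > 0" using assms by (simp add: \<eta>_def)
  obtain m :: nat where m: "real m \<ge> 36 * V / \<delta> + 1" using real_arch_simple by blast
  have "36 * V / \<delta> > 0" using V(1) assms by simp
  then have m1: "real m \<ge> 1" using m by linarith
  have m2: "12 * V / (real m)\<^sup>2 \<le> \<delta> / 3"
  proof -
    have "36 * V / \<delta> \<le> real m * 1" using m by simp
    also have "\<dots> \<le> real m * real m" using m1 by (intro mult_left_mono) auto
    finally have "36 * V \<le> \<delta> * (real m)\<^sup>2" using assms by (simp add: field_simps power2_eq_square)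
    then show ?thesis using m1 by (simp add: field_simps)
  qed
  obtain Cc where Cc: "Cc > 0" "\<And>\<epsilon> S x. thin \<alpha> \<epsilon> S \<Longrightarrow> \<epsilon> \<ge> 0 \<Longrightarrow> emeasure M (S \<inter> {y. \<bar>y\<^sup>2 - x\<^sup>2\<bar> \<le> real m}) \<le> ennreal (\<epsilon> * Cc * (1 + x\<^sup>2) powr \<alpha>)"
    using thin_cover[of m] by blast
  have "m \<ge> 1" using m1 by simp
  from heat_sup[OF this \<eta>] obtain Ch where Ch: "Ch > 0" 
    "\<And>t x y. 0 \<le> x \<Longrightarrow> 0 \<le> y \<Longrightarrow> \<bar>y\<^sup>2 - x\<^sup>2\<bar> \<le> real m \<Longrightarrow> \<eta> / (1 + x\<^sup>2) \<le> t \<Longrightarrow> heat t x y \<le> Ch * (1 + x\<^sup>2) powr (- \<alpha>)"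
    by blast
  define H where "H = Ch * Cc"
  have H: "H > 0" using Ch Cc by (simp add: H_def)
  have "(\<integral>\<^sup>+y. ennreal (ker c N x y) * indicator S y \<partial>M) \<le> ennreal \<delta>"
    if e: "0 \<le> \<epsilon>" "\<epsilon> < \<delta> / (3 * H)" and S: "thin \<alpha> \<epsilon> S" and c: "1 \<le> c" "c \<le> 2" and x: "0 \<le> x" for \<epsilon> S c N x
  proof -
    have Sm: "S \<in> sets M" "S \<subseteq> {0..}" using S by (auto simp: thin_def)
    define X where "X = 1 + x\<^sup>2"
    have X: "X \<ge> 1" by (simp add: X_def)
    define I where "I n = (\<integral>\<^sup>+y. ennreal (heat (c / 2 ^ n) x y) * indicator S y \<partial>M)" for n :: nat
    \<comment> \<open>For very small times the kernel may concentrate entirely on \<open>S\<close>,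
      so only the total mass 1 is available; the gain there has to come from the weight.\<close>
    define b where "b n = (if X / 2 ^ n < \<eta> then 1 else 2 * V / (real m)\<^sup>2 * (X / 2 ^ n) + H * \<epsilon>)" for n :: nat
    have b0: "b n \<ge> 0" for n
      using V(1) X H e by (auto simp: b_def intro!: add_nonneg_nonneg mult_nonneg_nonneg)
    have Ib: "I n \<le> ennreal (b n)" if n: "n \<in> {1..N}" for n
    proof (cases "X / 2 ^ n < \<eta>")
      case True
      have "I n \<le> (\<integral>\<^sup>+y. ennreal (heat (c / 2 ^ n) x y) \<partial>M)"
        unfolding I_def by (intro nn_integral_mono) (auto simp: indicator_def)
      also have "\<dots> = 1" using c by (intro heat_mass) auto
      finally show ?thesis using True by (simp add: b_def)
    next
      case False
      define t where "t = c / 2 ^ n"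
      have "(2::real) ^ 1 \<le> 2 ^ n" using n by (intro power_increasing) auto
      then have t: "t > 0" "t \<le> 1" "t \<le> 2 * (1 / 2 ^ n)" using c by (simp_all add: t_def field_simps)
      have "\<eta> / X \<le> (X / 2 ^ n) / X" using False X by (intro divide_right_mono) auto
      also have "\<dots> = 1 / 2 ^ n" using X by simp
      also have "\<dots> \<le> t" unfolding t_def using c by (intro divide_right_mono) auto
      finally have tX: "\<eta> / X \<le> t" .
      define A where "A = S \<inter> {y. \<bar>y\<^sup>2 - x\<^sup>2\<bar> \<le> real m}"
      have Am: "A \<in> sets M"
      proof -
        have "{y::real. \<bar>y\<^sup>2 - x\<^sup>2\<bar> \<le> real m} \<in> sets borel" by measurable
        then have "{y::real. \<bar>y\<^sup>2 - x\<^sup>2\<bar> \<le> real m} \<in> sets lebesgue" by (simp add: sets_completionI_sets)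
        then show ?thesis using Sm unfolding A_def by (simp add: sets.Int)
      qed
      \<comment> \<open>Chebyshev's inequality away from \<open>x\<close>, the supremum bound
        \<open>heat_sup\<close> on the nearby part \<open>A\<close> of \<open>S\<close>.\<close>
      have pw: "ennreal (heat t x y) * indicator S y \<le> ennreal (1 / (real m)\<^sup>2) * ennreal (heat t x y * (y\<^sup>2 - x\<^sup>2)\<^sup>2) + ennreal (Ch * X powr (- \<alpha>)) * indicator A y" for y
      proof -
        consider "y \<notin> S" | "y \<in> A" | "y \<in> S" "real m < \<bar>y\<^sup>2 - x\<^sup>2\<bar>" unfolding A_def by force
        then show ?thesis
        proof cases
          case 2
          then have "\<bar>y\<^sup>2 - x\<^sup>2\<bar> \<le> real m" "0 \<le> y" using Sm unfolding A_def by blast+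
          from Ch(2)[OF x this(2,1) tX[unfolded X_def]] have "ennreal (heat t x y) \<le> ennreal (Ch * X powr (- \<alpha>))"
            unfolding X_def by (rule ennreal_leI)
          moreover have "y \<in> S" using 2 by (simp add: A_def)
          ultimately show ?thesis using 2 by (simp add: add_increasing)
        next
          case 3
          have "(real m)\<^sup>2 \<le> \<bar>y\<^sup>2 - x\<^sup>2\<bar>\<^sup>2" using 3(2) by (intro power_mono) auto
          then have "(real m)\<^sup>2 \<le> (y\<^sup>2 - x\<^sup>2)\<^sup>2" by (simp only: power2_abs)
          then have "heat t x y * (real m)\<^sup>2 \<le> heat t x y * (y\<^sup>2 - x\<^sup>2)\<^sup>2"
            by (rule mult_left_mono[OF _ heat_nonneg])
          then have "heat t x y \<le> 1 / (real m)\<^sup>2 * (heat t x y * (y\<^sup>2 - x\<^sup>2)\<^sup>2)"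
            using m1 by (simp add: pos_le_divide_eq)
          then have "ennreal (heat t x y) \<le> ennreal (1 / (real m)\<^sup>2 * (heat t x y * (y\<^sup>2 - x\<^sup>2)\<^sup>2))"
            by (rule ennreal_leI)
          also have "\<dots> = ennreal (1 / (real m)\<^sup>2) * ennreal (heat t x y * (y\<^sup>2 - x\<^sup>2)\<^sup>2)"
            by (rule ennreal_mult) (auto intro!: mult_nonneg_nonneg heat_nonneg)
          finally show ?thesis using 3(1) by (simp add: add_increasing2)
        qed auto
      qed
      have "I n \<le> (\<integral>\<^sup>+y. ennreal (1 / (real m)\<^sup>2) * ennreal (heat t x y * (y\<^sup>2 - x\<^sup>2)\<^sup>2) + ennreal (Ch * X powr (- \<alpha>)) * indicator A y \<partial>M)"
        unfolding I_def t_def[symmetric] by (intro nn_integral_mono pw)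
      also have "\<dots> = ennreal (1 / (real m)\<^sup>2) * spread t x + ennreal (Ch * X powr (- \<alpha>)) * emeasure M A"
      proof -
        have m1: "(\<lambda>y. ennreal (heat t x y * (y\<^sup>2 - x\<^sup>2)\<^sup>2)) \<in> borel_measurable M" by measurable
        then have m2: "(\<lambda>y. ennreal (1 / (real m)\<^sup>2) * ennreal (heat t x y * (y\<^sup>2 - x\<^sup>2)\<^sup>2)) \<in> borel_measurable M" by measurable
        have m3: "(\<lambda>y. ennreal (Ch * X powr (- \<alpha>)) * indicator A y) \<in> borel_measurable M" using Am by measurable
        show ?thesis unfolding nn_integral_add[OF m2 m3] nn_integral_cmult[OF m1] nn_integral_cmult_indicator[OF Am] ..
      qed
      also have "\<dots> \<le> ennreal (1 / (real m)\<^sup>2) * ennreal (V * (t * X)) + ennreal (Ch * X powr (- \<alpha>)) * ennreal (\<epsilon> * Cc * X powr \<alpha>)"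
        unfolding A_def X_def by (intro add_mono mult_left_mono V t Cc S e) auto
      also have "\<dots> = ennreal (1 / (real m)\<^sup>2 * (V * (t * X)) + Ch * X powr (- \<alpha>) * (\<epsilon> * Cc * X powr \<alpha>))"
        using V(1) t X Ch Cc e by (simp flip: ennreal_mult ennreal_plus)
      also have "\<dots> \<le> ennreal (b n)"
      proof (intro ennreal_leI)
        have "X powr (- \<alpha>) * X powr \<alpha> = 1" using X by (simp flip: powr_add)
        then have "Ch * X powr (- \<alpha>) * (\<epsilon> * Cc * X powr \<alpha>) = H * \<epsilon>"
          unfolding H_def by (metis mult.assoc mult.commute mult.right_neutral)
        moreover have "1 / (real m)\<^sup>2 * (V * (t * X)) \<le> 1 / (real m)\<^sup>2 * (V * (2 * (1 / 2 ^ n) * X))"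
          using t V(1) X by (intro mult_left_mono mult_right_mono) auto
        moreover have "1 / (real m)\<^sup>2 * (V * (2 * (1 / 2 ^ n) * X)) = 2 * V / (real m)\<^sup>2 * (X / 2 ^ n)" by simp
        moreover have "b n = 2 * V / (real m)\<^sup>2 * (X / 2 ^ n) + H * \<epsilon>"
          using False by (simp only: b_def if_False)
        ultimately show "1 / (real m)\<^sup>2 * (V * (t * X)) + Ch * X powr (- \<alpha>) * (\<epsilon> * Cc * X powr \<alpha>) \<le> b n"
          by (metis add_right_mono)
      qed
      finally show ?thesis .
    qed
    have "(\<integral>\<^sup>+y. ennreal (ker c N x y) * indicator S y \<partial>M) = (\<Sum>n=1..N. ennreal (wt (1 / 2 ^ n) x) * I n)"
      unfolding I_def using Sm by (intro ker_nn) auto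
    also have "\<dots> \<le> (\<Sum>n=1..N. ennreal (wt (1 / 2 ^ n) x) * ennreal (b n))"
      by (intro sum_mono mult_left_mono Ib) auto
    also have "\<dots> = ennreal (\<Sum>n=1..N. wt (1 / 2 ^ n) x * b n)"
      using b0 wt_bounds(1) by (subst sum_ennreal[symmetric]) (auto simp: ennreal_mult)
    also have "\<dots> \<le> ennreal \<delta>"
    proof (intro ennreal_leI)
      \<comment> \<open>Each summand uses a different bound on the weight: linear for small times,
        the two-sided one against the growth of the variance, and the telescoping sum for the thin
        part.\<close>
      have "(\<Sum>n=1..N. wt (1 / 2 ^ n) x * b n) \<le> (\<Sum>n=1..N. pi * (if X / 2 ^ n < \<eta> then X / 2 ^ n else 0) + 2 * V / (real m)\<^sup>2 * min (X / 2 ^ n) (1 / (X / 2 ^ n)) + H * \<epsilon> * wt (1 / 2 ^ n) x)"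
      proof (rule sum_mono)
        fix n
        have w: "0 \<le> wt (1 / 2 ^ n) x" "wt (1 / 2 ^ n) x \<le> pi * (X / 2 ^ n)" "wt (1 / 2 ^ n) x * (X / 2 ^ n) \<le> min (X / 2 ^ n) (1 / (X / 2 ^ n))"
          using wt_bounds(1,3,5)[of "1 / 2 ^ n" x] by (simp_all add: X_def)
        show "wt (1 / 2 ^ n) x * b n \<le> pi * (if X / 2 ^ n < \<eta> then X / 2 ^ n else 0) + 2 * V / (real m)\<^sup>2 * min (X / 2 ^ n) (1 / (X / 2 ^ n)) + H * \<epsilon> * wt (1 / 2 ^ n) x"
        proof (cases "X / 2 ^ n < \<eta>")
          case True
          have "0 \<le> 2 * V / (real m)\<^sup>2 * min (X / 2 ^ n) (1 / (X / 2 ^ n))"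
            using V(1) X by (intro mult_nonneg_nonneg) auto
          moreover have "0 \<le> H * \<epsilon> * wt (1 / 2 ^ n) x" using H e w by auto
          ultimately show ?thesis using True w(2) by (simp add: b_def)
        next
          case False
          have "2 * V / (real m)\<^sup>2 * (wt (1 / 2 ^ n) x * (X / 2 ^ n)) \<le> 2 * V / (real m)\<^sup>2 * min (X / 2 ^ n) (1 / (X / 2 ^ n))"
            using V(1) by (intro mult_left_mono w) auto
          then show ?thesis using False by (simp add: b_def algebra_simps)
        qed
      qed
      also have "\<dots> = pi * (\<Sum>n\<in>{n\<in>{1..N}. X / 2 ^ n < \<eta>}. X / 2 ^ n) + 2 * V / (real m)\<^sup>2 * (\<Sum>n=1..N. min (X / 2 ^ n) (1 / (X / 2 ^ n))) + H * \<epsilon> * (\<Sum>n=1..N. wt (1 / 2 ^ n) x)"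
        by (simp only: sum.distrib sum_distrib_left[symmetric] sum.inter_filter[OF finite_atLeastAtMost])
      also have "\<dots> \<le> pi * (2 * \<eta>) + 2 * V / (real m)\<^sup>2 * 6 + H * \<epsilon> * 1"
        using V(1) X \<eta> H e by (intro add_mono mult_left_mono sum_dyadic_small_le sum_dyadic_min_le wt_sum_le) auto
      also have "\<dots> \<le> \<delta>"
      proof -
        have "pi * (2 * \<eta>) = \<delta> / 3" by (simp add: \<eta>_def)
        moreover have "2 * V / (real m)\<^sup>2 * 6 \<le> \<delta> / 3" using m2 by simp
        moreover have "H * \<epsilon> * 1 \<le> \<delta> / 3" using e H by (simp add: field_simps)
        ultimately show ?thesis by linarith
      qed
      finally show "(\<Sum>n=1..N. wt (1 / 2 ^ n) x * b n) \<le> \<delta>" .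
    qed
    finally show ?thesis .
  qed
  moreover have "\<delta> / (3 * H) > 0" using assms H by simp
  ultimately show ?thesis by (intro exI[of _ "\<delta> / (3 * H)"]) auto
qed

section \<open>Quadratic forms and Schur's test on thin sets\<close>

definition sqnorm :: "(real \<Rightarrow> 'b::real_normed_vector) \<Rightarrow> real set \<Rightarrow> ennreal" where
  "sqnorm f D = (\<integral>\<^sup>+x. ennreal ((norm (f x))\<^sup>2) * indicator D x \<partial>M)"

lemma sqnorm_real: "sqnorm f D = (\<integral>\<^sup>+x. ennreal ((f x)\<^sup>2) * indicator D x \<partial>M)" for f :: "real \<Rightarrow> real"
  by (simp add: sqnorm_def)

abbreviation form :: "(real \<Rightarrow> real \<Rightarrow> real) \<Rightarrow> (real \<Rightarrow> real) \<Rightarrow> ennreal" where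
  "form k h \<equiv> (\<integral>\<^sup>+x. (\<integral>\<^sup>+y. ennreal (k x y) * ennreal \<bar>h x * h y\<bar> \<partial>M) \<partial>M)"

text \<open>Schur's test with the splitting of \<open>h x * h y\<close> left open. The part carrying
  \<open>a x\<close> is integrated first over \<open>y\<close>, against rows weighted by
  \<open>p\<close>; the part \<open>b y\<close> is integrated first over \<open>x\<close>, against
  columns. The row bound is needed only for \<open>x \<ge> 0\<close>, where the measure
  lives.\<close>

lemma form_le_sum:
  assumes k: "(\<lambda>p. k (fst p) (snd p)) \<in> borel_measurable (M \<Otimes>\<^sub>M M)"
    and m[measurable]: "a \<in> borel_measurable M" "b \<in> borel_measurable M" "p \<in> borel_measurable M"
    and h: "\<And>x y. ennreal \<bar>h x * h y\<bar> \<le> p y * a x + b y"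
    and row: "\<And>x. x \<ge> 0 \<Longrightarrow> (\<integral>\<^sup>+y. ennreal (k x y) * p y \<partial>M) \<le> r"
    and col: "\<And>y. (\<integral>\<^sup>+x. ennreal (k x y) \<partial>M) \<le> c"
  shows "form k h \<le> r * (\<integral>\<^sup>+x. a x \<partial>M) + c * (\<integral>\<^sup>+y. b y \<partial>M)"
proof -
  have km: "(\<lambda>p. ennreal (k (fst p) (snd p))) \<in> borel_measurable (M \<Otimes>\<^sub>M M)" using k by measurable
  have [measurable]: "(\<lambda>y. ennreal (k x y)) \<in> borel_measurable M" "(\<lambda>x. ennreal (k x y)) \<in> borel_measurable M" for x y
    using measurable_compose[OF measurable_Pair1' km, of x] measurable_compose[OF measurable_Pair2' km, of y] by simp_all
  have pm: "(\<lambda>(x, y). ennreal (k x y) * b y) \<in> borel_measurable (M \<Otimes>\<^sub>M M)"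
    unfolding case_prod_beta by (intro borel_measurable_times_ennreal km M_snd m)
  have "form k h \<le> (\<integral>\<^sup>+x. (\<integral>\<^sup>+y. (ennreal (k x y) * p y) * a x + ennreal (k x y) * b y \<partial>M) \<partial>M)"
    using mult_left_mono[OF h] by (intro nn_integral_mono) (simp add: distrib_left mult.assoc)
  also have "\<dots> = (\<integral>\<^sup>+x. (\<integral>\<^sup>+y. ennreal (k x y) * p y \<partial>M) * a x + (\<integral>\<^sup>+y. ennreal (k x y) * b y \<partial>M) \<partial>M)"
    by (intro nn_integral_cong, subst nn_integral_add, measurable, subst nn_integral_multc, measurable)
  also have "\<dots> \<le> (\<integral>\<^sup>+x. r * a x + (\<integral>\<^sup>+y. ennreal (k x y) * b y \<partial>M) \<partial>M)"
    by (rule nn_integral_mono_AE, use AE_M_nonneg in eventually_elim) (intro add_mono mult_right_mono row, auto)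
  also have "\<dots> = r * (\<integral>\<^sup>+x. a x \<partial>M) + (\<integral>\<^sup>+x. (\<integral>\<^sup>+y. ennreal (k x y) * b y \<partial>M) \<partial>M)"
    by (subst nn_integral_add[OF _ borel_measurable_nn_integral[OF pm]], measurable, subst nn_integral_cmult, measurable)
  also have "(\<integral>\<^sup>+x. (\<integral>\<^sup>+y. ennreal (k x y) * b y \<partial>M) \<partial>M) = (\<integral>\<^sup>+y. (\<integral>\<^sup>+x. ennreal (k x y) * b y \<partial>M) \<partial>M)"
    using pair.Fubini'[OF pm] by simp
  also have "\<dots> = (\<integral>\<^sup>+y. (\<integral>\<^sup>+x. ennreal (k x y) \<partial>M) * b y \<partial>M)"
    by (intro nn_integral_cong nn_integral_multc) measurable
  also have "\<dots> \<le> (\<integral>\<^sup>+y. c * b y \<partial>M)"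
    by (intro nn_integral_mono mult_right_mono col) auto
  also have "\<dots> = c * (\<integral>\<^sup>+y. b y \<partial>M)" by (rule nn_integral_cmult) measurable
  finally show ?thesis by (simp add: add_left_mono)
qed

text \<open>The inequality between arithmetic and geometric means is weighted according to the
  position of \<open>y\<close>. For \<open>y\<close> in \<open>S\<close> the large constant
  \<open>q\<close> goes to \<open>h x\<close>, where it meets the small row mass on
  \<open>S\<close>; for \<open>y\<close> outside \<open>S\<close> it goes to \<open>h y\<close>,
  which contributes only to the norm off \<open>S\<close>. The small constant
  \<open>\<tau> / 2\<close> meets full rows and columns.\<close>

lemma schur:
  "\<exists>\<epsilon>0>0. \<exists>C>0. \<forall>\<epsilon> S c N h. 0 \<le> \<epsilon> \<longrightarrow> \<epsilon> < \<epsilon>0 \<longrightarrow> thin \<alpha> \<epsilon> S \<longrightarrow> 1 \<le> c \<longrightarrow> c \<le> 2 \<longrightarrow> h \<in> borel_measurable M \<longrightarrow>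
    form (ker c N) h \<le> ennreal (1/8) * sqnorm h UNIV + ennreal C * sqnorm h (- S)"
proof -
  obtain C where C: "C > 0" "\<And>c N y. 0 < c \<Longrightarrow> c \<le> 2 \<Longrightarrow> (\<integral>\<^sup>+x. ennreal (ker c N x y) \<partial>M) \<le> ennreal C"
    using ker_column by blast
  \<comment> \<open>Makes \<open>\<tau> / 2 + C * (\<tau> / 2) = 1 / 16\<close>. The other 1/16 is
    \<open>q * (\<tau> / 8)\<close>, with \<open>q = 1 / (2 * \<tau>)\<close> forced by the mean
    inequality.\<close>
  define \<tau> where "\<tau> = 1 / (8 * (C + 1))"
  have \<tau>: "\<tau> > 0" using C(1) by (simp add: \<tau>_def)
  define q where "q = 1 / (2 * \<tau>)"
  have q: "q > 0" using \<tau> by (simp add: q_def)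
  have "\<tau> / 8 > 0" using \<tau> by simp
  from heat_on_thin[OF this] obtain \<epsilon>0 where E: "\<epsilon>0 > 0" "\<And>\<epsilon> S c N x. 0 \<le> \<epsilon> \<Longrightarrow> \<epsilon> < \<epsilon>0 \<Longrightarrow> thin \<alpha> \<epsilon> S \<Longrightarrow> 1 \<le> c \<Longrightarrow> c \<le> 2 \<Longrightarrow> 0 \<le> x \<Longrightarrow>
    (\<integral>\<^sup>+y. ennreal (ker c N x y) * indicator S y \<partial>M) \<le> ennreal (\<tau> / 8)"
    by blast
  have main: "form (ker c N) h \<le> ennreal (1/8) * sqnorm h UNIV + ennreal (C * q) * sqnorm h (- S)"
    if e: "0 \<le> \<epsilon>" "\<epsilon> < \<epsilon>0" and S: "thin \<alpha> \<epsilon> S" and c: "1 \<le> c" "c \<le> 2" and h[measurable]: "h \<in> borel_measurable M" for \<epsilon> S c N h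
  proof -
    have Sm: "S \<in> sets M" "- S \<in> sets M" using S sets.compl_sets[of S M] by (auto simp: thin_def Compl_eq_Diff_UNIV)
    have [measurable]: "(\<lambda>y. indicator S y :: ennreal) \<in> borel_measurable M" "(\<lambda>y. indicator (- S) y :: ennreal) \<in> borel_measurable M"
      using Sm by auto
    define a where "a x = ennreal ((h x)\<^sup>2)" for x
    have [measurable]: "a \<in> borel_measurable M" unfolding a_def[abs_def] by measurable
    define p where "p y = ennreal q * indicator S y + ennreal (\<tau> / 2)" for y
    define b where "b y = ennreal (\<tau> / 2) * a y + ennreal q * (a y * indicator (- S) y)" for y
    have [measurable]: "p \<in> borel_measurable M" "b \<in> borel_measurable M"
      unfolding p_def[abs_def] b_def[abs_def] by measurable
    have am: "ennreal \<bar>h x * h y\<bar> \<le> ennreal (\<tau> / 2) * a x + ennreal q * a y" for x y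
    proof -
      have "0 \<le> (\<tau> * \<bar>h x\<bar> - \<bar>h y\<bar>)\<^sup>2" by simp
      then have "2 * \<tau> * \<bar>h x * h y\<bar> \<le> \<tau>\<^sup>2 * (h x)\<^sup>2 + (h y)\<^sup>2"
        by (simp add: power2_diff power_mult_distrib abs_mult mult_ac)
      then have "(2 * \<tau> * \<bar>h x * h y\<bar>) / (2 * \<tau>) \<le> (\<tau>\<^sup>2 * (h x)\<^sup>2 + (h y)\<^sup>2) / (2 * \<tau>)"
        using \<tau> by (intro divide_right_mono) auto
      then have "\<bar>h x * h y\<bar> \<le> \<tau> / 2 * (h x)\<^sup>2 + q * (h y)\<^sup>2"
        using \<tau> by (simp add: q_def add_divide_distrib power2_eq_square)
      then show ?thesis using \<tau> q by (simp add: a_def ennreal_leI flip: ennreal_mult ennreal_plus)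
    qed
    have "form (ker c N) h \<le> ennreal (1 / 16 + \<tau> / 2) * (\<integral>\<^sup>+x. a x \<partial>M) + ennreal C * (\<integral>\<^sup>+y. b y \<partial>M)"
    proof (rule form_le_sum)
      show "(\<lambda>p. ker c N (fst p) (snd p)) \<in> borel_measurable (M \<Otimes>\<^sub>M M)" by (rule ker_measurable[OF fst_M snd_M])
      show "(\<integral>\<^sup>+x. ennreal (ker c N x y) \<partial>M) \<le> ennreal C" for y using c by (intro C) auto
      show "ennreal \<bar>h x * h y\<bar> \<le> p y * a x + b y" for x y
      proof (cases "y \<in> S")
        case True
        then have "p y * a x + b y = (ennreal (\<tau> / 2) * a y + ennreal q * a x) + ennreal (\<tau> / 2) * a x"
          by (simp add: p_def b_def distrib_right add_ac)
        then show ?thesis using am[of y x] by (simp add: mult.commute add_increasing2)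
      next
        case False
        then have "p y * a x + b y = (ennreal (\<tau> / 2) * a x + ennreal q * a y) + ennreal (\<tau> / 2) * a y"
          by (simp add: p_def b_def add_ac)
        then show ?thesis using am[of x y] by (simp add: add_increasing2)
      qed
      show "(\<integral>\<^sup>+y. ennreal (ker c N x y) * p y \<partial>M) \<le> ennreal (1 / 16 + \<tau> / 2)" if x: "x \<ge> 0" for x
      proof -
        have [measurable]: "(\<lambda>y. ennreal (ker c N x y)) \<in> borel_measurable M" by measurable
        have "(\<integral>\<^sup>+y. ennreal (ker c N x y) * p y \<partial>M) = (\<integral>\<^sup>+y. ennreal q * (ennreal (ker c N x y) * indicator S y) + ennreal (\<tau> / 2) * ennreal (ker c N x y) \<partial>M)"
          by (intro nn_integral_cong) (simp add: p_def distrib_left mult_ac)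
        also have "\<dots> = ennreal q * (\<integral>\<^sup>+y. ennreal (ker c N x y) * indicator S y \<partial>M) + ennreal (\<tau> / 2) * (\<integral>\<^sup>+y. ennreal (ker c N x y) \<partial>M)"
          by (subst nn_integral_add, measurable, subst (1 2) nn_integral_cmult, measurable)
        also have "\<dots> \<le> ennreal q * ennreal (\<tau> / 8) + ennreal (\<tau> / 2) * 1"
          using c by (intro add_mono mult_left_mono E(2)[OF e S c x] ker_row) auto
        also have "\<dots> = ennreal (q * (\<tau> / 8) + \<tau> / 2)"
          using \<tau> q by (simp add: ennreal_plus flip: ennreal_mult)
        also have "q * (\<tau> / 8) = 1 / 16" using \<tau> by (simp add: q_def)
        finally show ?thesis .
      qed
    qed measurable
    also have "(\<integral>\<^sup>+y. b y \<partial>M) = ennreal (\<tau> / 2) * (\<integral>\<^sup>+y. a y \<partial>M) + ennreal q * (\<integral>\<^sup>+y. a y * indicator (- S) y \<partial>M)"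
      unfolding b_def by (subst nn_integral_add, measurable, subst (1 2) nn_integral_cmult, measurable)
    also have "ennreal (1 / 16 + \<tau> / 2) * (\<integral>\<^sup>+x. a x \<partial>M) + ennreal C * \<dots> =
        (ennreal (1 / 16 + \<tau> / 2) + ennreal C * ennreal (\<tau> / 2)) * (\<integral>\<^sup>+x. a x \<partial>M) + (ennreal C * ennreal q) * (\<integral>\<^sup>+y. a y * indicator (- S) y \<partial>M)"
      by (simp only: distrib_left distrib_right mult.assoc add.assoc)
    also have "ennreal (1 / 16 + \<tau> / 2) + ennreal C * ennreal (\<tau> / 2) = ennreal (1 / 16 + \<tau> / 2 + C * (\<tau> / 2))"
      using C(1) \<tau> by (simp flip: ennreal_mult ennreal_plus)
    also have "1 / 16 + \<tau> / 2 + C * (\<tau> / 2) = 1 / 8"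
    proof -
      have "\<tau> / 2 + C * (\<tau> / 2) = (C + 1) * \<tau> / 2" by (simp add: algebra_simps)
      also have "\<dots> = 1 / 16" using C(1) by (simp add: \<tau>_def)
      finally show ?thesis by linarith
    qed
    also have "ennreal C * ennreal q = ennreal (C * q)" using C(1) q by (simp add: ennreal_mult)
    finally show ?thesis unfolding a_def sqnorm_real by simp
  qed
  have "C * q > 0" using C(1) q by simp
  show ?thesis
    by (rule exI[of _ \<epsilon>0], rule conjI[OF E(1)], rule exI[of _ "C * q"], rule conjI[OF \<open>C * q > 0\<close>], intro allI impI, rule main)
qed

subsection \<open>The transform of compactly supported functions\<close>

text \<open>Support in \<open>{0..R}\<close>, which has finite measure, makes these functions
  integrable, so their transform is an absolutely convergent integral.\<close>

definition csL2 :: "real \<Rightarrow> (real \<Rightarrow> real) \<Rightarrow> bool" where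
  "csL2 R f \<longleftrightarrow> f \<in> borel_measurable M \<and> (\<forall>x. x \<notin> {0..R} \<longrightarrow> f x = 0) \<and> integrable M (\<lambda>x. (f x)\<^sup>2)"

definition hank :: "(real \<Rightarrow> real) \<Rightarrow> real \<Rightarrow> real" where
  "hank f y = (\<integral>x. f x * bker x y \<partial>M)"

text \<open>A majorant of the Bessel kernel for \<open>x\<close> in \<open>{0..R}\<close>, obtained
  by taking absolute values in the series. It may grow exponentially in \<open>y\<close>, but stays
  integrable against the Gaussians and heat kernels that accompany it.\<close>

definition bmaj :: "real \<Rightarrow> real \<Rightarrow> real" where
  "bmaj R y = 2 powr (-\<alpha>) * bes ((pi * R)\<^sup>2 * y\<^sup>2)"

lemma bmaj_nonneg: "bmaj R y \<ge> 0"
  unfolding bmaj_def using bes_pos by (auto simp: less_imp_le intro!: mult_nonneg_nonneg)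

lemma abs_bker_le_bound: "\<bar>x\<bar> \<le> R \<Longrightarrow> \<bar>bker x y\<bar> \<le> bmaj R y"
  unfolding bmaj_def by (rule abs_bker_le)

lemma bmaj_measurable [measurable]: "bmaj R \<in> borel_measurable M"
  unfolding bmaj_def[abs_def] by measurable

lemma csL2_integrable: "csL2 R f \<Longrightarrow> integrable M f"
proof -
  assume f: "csL2 R f"
  have "emeasure M {0..R} < \<infinity>" by (rule emeasure_M_finite) simp
  then have i: "integrable M (\<lambda>x. indicator {0..R} x :: real)" by simp
  show "integrable M f"
  proof (rule Bochner_Integration.integrable_bound)
    show "integrable M (\<lambda>x. indicator {0..R} x + (f x)\<^sup>2)"
      using f i by (intro Bochner_Integration.integrable_add) (auto simp: csL2_def)
    show "AE x in M. norm (f x) \<le> norm (indicator {0..R} x + (f x)\<^sup>2)"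
    proof (rule AE_I2)
      fix x
      have "\<bar>u\<bar> \<le> 1 + u\<^sup>2" for u :: real
        using zero_le_power2[of "\<bar>u\<bar> - 1/2"] by (simp add: power2_diff power2_eq_square algebra_simps)
      then show "norm (f x) \<le> norm (indicator {0..R} x + (f x)\<^sup>2)"
        using f by (cases "x \<in> {0..R}") (auto simp: csL2_def)
    qed
  qed (use f in \<open>auto simp: csL2_def\<close>)
qed

lemma bker_pair: "(\<lambda>p. bker (fst p) (snd p)) \<in> borel_measurable (M \<Otimes>\<^sub>M M)"
  by (rule bker_measurable[OF fst_M snd_M])

lemma csL2_kernel_le:
  assumes f: "csL2 R f"
  shows "\<bar>f x * bker x y\<bar> \<le> \<bar>f x\<bar> * bmaj R y"
proof (cases "x \<in> {0..R}")
  case True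
  then show ?thesis using abs_bker_le[of x R y] by (simp add: abs_mult bmaj_def mult_left_mono)
next
  case False
  then show ?thesis using f by (simp add: csL2_def)
qed

lemma hank_le:
  assumes f: "csL2 R f"
  shows "\<bar>hank f y\<bar> \<le> (\<integral>x. \<bar>f x\<bar> \<partial>M) * bmaj R y"
proof -
  have m: "f \<in> borel_measurable M" using f by (simp add: csL2_def)
  note i = csL2_integrable[OF f]
  have i2: "integrable M (\<lambda>x. \<bar>f x\<bar> * bmaj R y)" using i by auto
  have "\<bar>hank f y\<bar> \<le> (\<integral>x. \<bar>f x\<bar> * bmaj R y \<partial>M)"
    unfolding hank_def by (rule integral_abs_bound[THEN order_trans], rule integral_mono')
     (use i2 csL2_kernel_le[OF f] bmaj_nonneg in auto)
  then show ?thesis by simp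
qed

lemma hank_measurable:
  assumes f: "csL2 R f"
  shows "hank f \<in> borel_measurable M"
proof -
  have m: "f \<in> borel_measurable M" using f by (simp add: csL2_def)
  have "(\<lambda>(y, x). f x * bker x y) \<in> borel_measurable (M \<Otimes>\<^sub>M M)"
    unfolding case_prod_beta by (intro borel_measurable_times M_snd m bker_measurable snd_M fst_M)
  then show ?thesis unfolding hank_def[abs_def] by (rule borel_measurable_lebesgue_integral)
qed

text \<open>Fubini's theorem, with the integrand dominated by
  \<open>\<bar>f x\<bar> * (\<bar>u y\<bar> * bmaj R y)\<close>; the decay must come from
  \<open>u\<close>. The duality formulas below are all instances of it.\<close>

lemma hank_adjoint:
  assumes f: "csL2 R f" and u: "u \<in> borel_measurable M" and ug: "integrable M (\<lambda>y. \<bar>u y\<bar> * bmaj R y)"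
  shows "integrable M (\<lambda>y. u y * hank f y)"
    and "integrable M (\<lambda>x. f x * (\<integral>y. u y * bker x y \<partial>M))"
    and "(\<integral>y. u y * hank f y \<partial>M) = (\<integral>x. f x * (\<integral>y. u y * bker x y \<partial>M) \<partial>M)"
proof -
  have m: "f \<in> borel_measurable M" using f by (simp add: csL2_def)
  note i = csL2_integrable[OF f]
  define F where "F x y = u y * (f x * bker x y)" for x y
  have Fm: "(\<lambda>(x, y). F x y) \<in> borel_measurable (M \<Otimes>\<^sub>M M)"
    unfolding F_def case_prod_beta by (intro borel_measurable_times M_fst M_snd m u bker_pair)
  have Fx: "(\<lambda>y. F x y) \<in> borel_measurable M" for x
    unfolding F_def using u by measurable
  have Fb: "\<bar>F x y\<bar> \<le> \<bar>f x\<bar> * (\<bar>u y\<bar> * bmaj R y)" for x y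
    using mult_left_mono[OF csL2_kernel_le[OF f, of x y], of "\<bar>u y\<bar>"] by (simp add: F_def abs_mult mult_ac)
  have Fi: "integrable M (F x)" for x
    by (rule Bochner_Integration.integrable_bound[of M "\<lambda>y. \<bar>f x\<bar> * (\<bar>u y\<bar> * bmaj R y)"])
       (use ug Fx Fb bmaj_nonneg in auto)
  have int: "integrable (M \<Otimes>\<^sub>M M) (\<lambda>(x, y). F x y)"
  proof (rule pair.Fubini_integrable[OF Fm])
    show "AE x in M. integrable M (\<lambda>y. case (x, y) of (x, y) \<Rightarrow> F x y)" using Fi by simp
    have le: "(\<integral>y. \<bar>F x y\<bar> \<partial>M) \<le> \<bar>f x\<bar> * (\<integral>y. \<bar>u y\<bar> * bmaj R y \<partial>M)" for x
    proof -
      have "(\<integral>y. \<bar>F x y\<bar> \<partial>M) \<le> (\<integral>y. \<bar>f x\<bar> * (\<bar>u y\<bar> * bmaj R y) \<partial>M)"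
        using Fi ug Fb by (intro integral_mono) auto
      then show ?thesis by simp
    qed
    have mm: "(\<lambda>x. \<integral>y. \<bar>F x y\<bar> \<partial>M) \<in> borel_measurable M"
    proof (rule borel_measurable_lebesgue_integral)
      have "(\<lambda>p. \<bar>(\<lambda>(x, y). F x y) p\<bar>) \<in> borel_measurable (M \<Otimes>\<^sub>M M)"
        using Fm by (rule borel_measurable_abs)
      then show "(\<lambda>(x, y). \<bar>F x y\<bar>) \<in> borel_measurable (M \<Otimes>\<^sub>M M)" by (simp add: case_prod_beta)
    qed
    have ii: "integrable M (\<lambda>x. \<bar>f x\<bar> * (\<integral>y. \<bar>u y\<bar> * bmaj R y \<partial>M))" using i by auto
    have "integrable M (\<lambda>x. \<integral>y. \<bar>F x y\<bar> \<partial>M)"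
    proof (rule Bochner_Integration.integrable_bound[OF ii mm], rule AE_I2)
      fix x
      have "(\<integral>y. \<bar>F x y\<bar> \<partial>M) \<ge> 0" by simp
      then show "norm (\<integral>y. \<bar>F x y\<bar> \<partial>M) \<le> norm (\<bar>f x\<bar> * (\<integral>y. \<bar>u y\<bar> * bmaj R y \<partial>M))"
        using order_trans[OF le abs_ge_self, of x] by simp
    qed
    then show "integrable M (\<lambda>x. \<integral>y. norm (case (x, y) of (x, y) \<Rightarrow> F x y) \<partial>M)" by simp
  qed
  have e1: "(\<integral>x. F x y \<partial>M) = u y * hank f y" for y by (simp add: F_def hank_def)
  have e2: "(\<integral>y. F x y \<partial>M) = f x * (\<integral>y. u y * bker x y \<partial>M)" for x
  proof -
    have "(\<lambda>y. F x y) = (\<lambda>y. f x * (u y * bker x y))" by (simp add: F_def mult_ac)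
    then show ?thesis by simp
  qed
  show "integrable M (\<lambda>y. u y * hank f y)" using pair.integrable_snd[OF int] by (simp add: e1)
  show "integrable M (\<lambda>x. f x * (\<integral>y. u y * bker x y \<partial>M))" using pair.integrable_fst[OF int] by (simp add: e2)
  show "(\<integral>y. u y * hank f y \<partial>M) = (\<integral>x. f x * (\<integral>y. u y * bker x y \<partial>M) \<partial>M)"
    using pair.Fubini_integral[OF int] by (simp add: e1 e2)
qed

section \<open>The heat operator, the damped pairing and its dyadic differences\<close>

definition heat_op :: "real \<Rightarrow> (real \<Rightarrow> real) \<Rightarrow> real \<Rightarrow> real" where
  "heat_op t f x = (\<integral>y. heat t x y * f y \<partial>M)"

lemma exp_bmaj_integrable:
  assumes t: "t > 0"
  shows "integrable M (\<lambda>y. gauss t y * bmaj Q y * bmaj R y)"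
proof -
  have "integrable M (\<lambda>y. (2 powr (-\<alpha>) * 2 powr (-\<alpha>)) * (gauss t y * bes ((pi * Q)\<^sup>2 * y\<^sup>2) * bes ((pi * R)\<^sup>2 * y\<^sup>2)))"
    using weber'[OF t] by (intro integrable_mult_right) (auto simp: has_bochner_integral_iff)
  then show ?thesis by (simp add: bmaj_def mult_ac)
qed

lemma heat_op_eq:
  assumes f: "csL2 R f" and t: "t > 0"
  shows "(\<integral>y. gauss t y * bker x y * hank f y \<partial>M) = heat_op t f x"
proof -
  have "(\<integral>y. (gauss t y * bker x y) * hank f y \<partial>M) = (\<integral>x'. f x' * (\<integral>y. (gauss t y * bker x y) * bker x' y \<partial>M) \<partial>M)"
  proof (rule hank_adjoint(3)[OF f])
    show "(\<lambda>y. gauss t y * bker x y) \<in> borel_measurable M" by measurable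
    show "integrable M (\<lambda>y. \<bar>gauss t y * bker x y\<bar> * bmaj R y)"
    proof (rule Bochner_Integration.integrable_bound[OF exp_bmaj_integrable[OF t, of "\<bar>x\<bar>" R]])
      show "AE y in M. norm (\<bar>gauss t y * bker x y\<bar> * bmaj R y) \<le> norm (gauss t y * bmaj \<bar>x\<bar> y * bmaj R y)"
        using abs_bker_le_bound[of x "\<bar>x\<bar>"] bmaj_nonneg by (intro AE_I2) (simp add: abs_mult mult_right_mono mult_left_mono)
    qed measurable
  qed
  also have "\<dots> = (\<integral>x'. heat t x x' * f x' \<partial>M)"
    unfolding has_bochner_integral_integral_eq[OF J_J_integral[OF t]] by (simp only: mult.commute)
  finally show ?thesis by (simp add: heat_op_def)
qed

text \<open>The mirror image of \<open>heat_op_eq\<close>: damping on one side of the transform is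
  the heat operator on the other. It rests on the eigenfunction formula
  \<open>heat_bker_integral\<close>.\<close>

lemma heat_op_hank:
  assumes f: "csL2 R f" and t: "t > 0"
  shows "heat_op t (hank f) y = hank (\<lambda>x. gauss t x * f x) y"
proof -
  have "heat_op t (hank f) y = (\<integral>x. f x * (\<integral>z. heat t y z * bker x z \<partial>M) \<partial>M)"
    unfolding heat_op_def
  proof (rule hank_adjoint(3)[OF f])
    have "integrable M (\<lambda>z. 2 powr (-\<alpha>) * (gauss 0 z * heat t y z * bes ((pi * R)\<^sup>2 * z\<^sup>2)))"
      using heat_integral[OF t, of 0] by (intro integrable_mult_right) (auto simp: has_bochner_integral_iff)
    then show "integrable M (\<lambda>z. \<bar>heat t y z\<bar> * bmaj R z)"
      using heat_nonneg by (simp add: bmaj_def mult_ac)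
  qed measurable
  also have "\<dots> = (\<integral>x. gauss t x * f x * bker x y \<partial>M)"
    unfolding has_bochner_integral_integral_eq[OF heat_bker_integral[OF t]] bker_sym[of y] by (simp add: mult_ac)
  finally show ?thesis by (simp add: hank_def)
qed

lemma csL2_exp:
  assumes f: "csL2 R f" and s: "s \<ge> 0"
  shows "csL2 R (\<lambda>x. damp s x * f x)"
proof -
  have m: "f \<in> borel_measurable M" using f by (simp add: csL2_def)
  have "integrable M (\<lambda>x. (damp s x * f x)\<^sup>2)"
  proof (rule Bochner_Integration.integrable_bound[of M "\<lambda>x. (f x)\<^sup>2"])
    have "(damp s x * f x)\<^sup>2 \<le> 1 * (f x)\<^sup>2" for x
      unfolding power_mult_distrib using s by (intro mult_right_mono power_le_one) (auto simp: add_nonneg_nonneg)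
    then show "AE x in M. norm ((damp s x * f x)\<^sup>2) \<le> norm ((f x)\<^sup>2)" by simp
  qed (use f m in \<open>auto simp: csL2_def\<close>)
  then show ?thesis using f m unfolding csL2_def by auto
qed

text \<open>The quantity \<open>\<Phi>\<close> with separate times \<open>s\<close> for
  \<open>f\<close> and \<open>t\<close> for its transform, so that they can be changed one at a
  time. The integral over \<open>y\<close> is already carried out, and
  \<open>exp (- (pi * t))\<close> is the constant part of the damping in \<open>y\<close>.\<close>

definition pairing :: "real \<Rightarrow> real \<Rightarrow> (real \<Rightarrow> real) \<Rightarrow> real" where
  "pairing s t f = (\<integral>x. damp s x * f x * (exp (- (pi * t)) * heat_op t f x) \<partial>M)"

lemma hank_exp_integrable:
  assumes f: "csL2 R f" and t: "t > 0"
  shows "integrable M (\<lambda>y. \<bar>gauss t y * hank f y\<bar> * bmaj R y)"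
proof (rule Bochner_Integration.integrable_bound)
  note [measurable] = hank_measurable[OF f]
  show "(\<lambda>y. \<bar>gauss t y * hank f y\<bar> * bmaj R y) \<in> borel_measurable M" by measurable
  show "integrable M (\<lambda>y. (\<integral>x. \<bar>f x\<bar> \<partial>M) * (gauss t y * bmaj R y * bmaj R y))"
    using exp_bmaj_integrable[OF t] by simp
  show "AE y in M. norm (\<bar>gauss t y * hank f y\<bar> * bmaj R y) \<le> norm ((\<integral>x. \<bar>f x\<bar> \<partial>M) * (gauss t y * bmaj R y * bmaj R y))"
  proof (rule AE_I2)
    fix y
    have "gauss t y * \<bar>hank f y\<bar> * bmaj R y \<le> gauss t y * ((\<integral>x. \<bar>f x\<bar> \<partial>M) * bmaj R y) * bmaj R y"
      by (intro mult_right_mono mult_left_mono hank_le[OF f] bmaj_nonneg) auto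
    then show "norm (\<bar>gauss t y * hank f y\<bar> * bmaj R y) \<le> norm ((\<integral>x. \<bar>f x\<bar> \<partial>M) * (gauss t y * bmaj R y * bmaj R y))"
      using bmaj_nonneg by (simp add: abs_mult mult_ac)
  qed
qed

text \<open>The same double integral evaluated in the other order. The damped transform
  \<open>u\<close> provides the decay needed for \<open>hank_adjoint\<close>, and the heat operator
  moves from \<open>f\<close> to \<open>hank f\<close>.\<close>

lemma pairing_dual:
  assumes f: "csL2 R f" and s: "s > 0" and t: "t > 0"
  shows "pairing s t f = (\<integral>y. damp t y * hank f y * (exp (- (pi * s)) * heat_op s (hank f) y) \<partial>M)"
    and "integrable M (\<lambda>x. damp s x * f x * (exp (- (pi * t)) * heat_op t f x))"
    and "integrable M (\<lambda>y. damp t y * hank f y * (exp (- (pi * s)) * heat_op s (hank f) y))"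
proof -
  define f' where "f' x = damp s x * f x" for x
  have f': "csL2 R f'" unfolding f'_def[abs_def] using s by (intro csL2_exp f) auto
  define u where "u y = damp t y * hank f y" for y
  note hm = hank_measurable[OF f]
  have um: "u \<in> borel_measurable M" unfolding u_def[abs_def] using hm by measurable
  have u: "u y = exp (- (pi * t)) * (gauss t y * hank f y)" for y
    by (simp add: u_def distrib_left flip: exp_add)
  have ui: "integrable M (\<lambda>y. \<bar>u y\<bar> * bmaj R y)"
    using integrable_mult_right[OF hank_exp_integrable[OF f t], of "exp (- (pi * t))"] by (simp add: u abs_mult mult.assoc)
  have g': "hank f' y = exp (- (pi * s)) * heat_op s (hank f) y" for y
  proof -
    have "f' = (\<lambda>x. exp (- (pi * s)) * (gauss s x * f x))"
      by (auto simp: f'_def distrib_left exp_add exp_diff exp_minus field_simps)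
    then show ?thesis unfolding heat_op_hank[OF f s] by (simp add: hank_def mult.assoc)
  qed
  have uJ: "(\<integral>y. u y * bker x y \<partial>M) = exp (- (pi * t)) * heat_op t f x" for x
  proof -
    have "(\<lambda>y. u y * bker x y) = (\<lambda>y. exp (- (pi * t)) * (gauss t y * bker x y * hank f y))"
      by (simp add: u mult_ac)
    then show ?thesis unfolding heat_op_eq[OF f t, symmetric] by simp
  qed
  note adj = hank_adjoint[OF f' um ui, unfolded g' uJ]
  show "pairing s t f = (\<integral>y. damp t y * hank f y * (exp (- (pi * s)) * heat_op s (hank f) y) \<partial>M)"
    using adj(3) by (simp add: pairing_def u_def f'_def)
  show "integrable M (\<lambda>x. damp s x * f x * (exp (- (pi * t)) * heat_op t f x))"
    using adj(2) by (simp add: f'_def)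
  show "integrable M (\<lambda>y. damp t y * hank f y * (exp (- (pi * s)) * heat_op s (hank f) y))"
    using adj(1) by (simp add: u_def)
qed

text \<open>Passing from \<open>(s, s)\<close> to \<open>(2 s, s)\<close> is computed on the side of \<open>f\<close>, and from \<open>(2 s, s)\<close> to \<open>(2 s, 2 s)\<close> on the side of its transform.\<close>
lemma pairing_diff:
  assumes f: "csL2 R f" and s: "s > 0"
  shows "pairing s s f - pairing (2 * s) (2 * s) f = (\<integral>x. wt s x * f x * (exp (- (pi * s)) * heat_op s f x) \<partial>M)
     + (\<integral>y. wt s y * hank f y * (exp (- (pi * (2 * s))) * heat_op (2 * s) (hank f) y) \<partial>M)"
proof -
  have s2: "2 * s > 0" using s by simp
  have "pairing s s f - pairing (2 * s) s f = (\<integral>x. wt s x * f x * (exp (- (pi * s)) * heat_op s f x) \<partial>M)"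
    unfolding pairing_def
    by (subst Bochner_Integration.integral_diff[symmetric, OF pairing_dual(2)[OF f s s] pairing_dual(2)[OF f s2 s]])
       (simp only: wt_def left_diff_distrib)
  moreover have "pairing (2 * s) s f - pairing (2 * s) (2 * s) f = (\<integral>y. wt s y * hank f y * (exp (- (pi * (2 * s))) * heat_op (2 * s) (hank f) y) \<partial>M)"
    unfolding pairing_dual(1)[OF f s2 s] pairing_dual(1)[OF f s2 s2]
    by (subst Bochner_Integration.integral_diff[symmetric, OF pairing_dual(3)[OF f s2 s] pairing_dual(3)[OF f s2 s2]])
       (simp only: wt_def left_diff_distrib)
  ultimately show ?thesis by linarith
qed

lemma abs_heat_op_le: "h \<in> borel_measurable M \<Longrightarrow> ennreal \<bar>heat_op t h x\<bar> \<le> (\<integral>\<^sup>+y. ennreal (heat t x y) * ennreal \<bar>h y\<bar> \<partial>M)"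
  unfolding heat_op_def using ennreal_norm_integral_le[where f = "\<lambda>y. heat t x y * h y" and L = M] heat_nonneg
  by (simp add: abs_mult ennreal_mult)

lemma form_le:
  assumes h: "h \<in> borel_measurable M" and w: "\<And>x. w x \<ge> 0" and t: "t \<ge> 0"
  shows "ennreal \<bar>\<integral>x. w x * h x * (exp (- (pi * t)) * heat_op t h x) \<partial>M\<bar> \<le>
    (\<integral>\<^sup>+x. (\<integral>\<^sup>+y. ennreal (exp (- (pi * t)) * (w x * heat t x y)) * ennreal \<bar>h x * h y\<bar> \<partial>M) \<partial>M)"
proof -
  have "ennreal \<bar>\<integral>x. w x * h x * (exp (- (pi * t)) * heat_op t h x) \<partial>M\<bar> \<le> (\<integral>\<^sup>+x. ennreal \<bar>w x * h x * (exp (- (pi * t)) * heat_op t h x)\<bar> \<partial>M)"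
    by (rule ennreal_norm_integral_le)
  also have "\<dots> \<le> (\<integral>\<^sup>+x. (\<integral>\<^sup>+y. ennreal (exp (- (pi * t)) * (w x * heat t x y)) * ennreal \<bar>h x * h y\<bar> \<partial>M) \<partial>M)"
  proof (rule nn_integral_mono)
    fix x
    note [measurable] = h
    define c where "c = w x * \<bar>h x\<bar> * exp (- (pi * t))"
    have c: "c \<ge> 0" using w by (simp add: c_def)
    have "ennreal \<bar>w x * h x * (exp (- (pi * t)) * heat_op t h x)\<bar> = ennreal c * ennreal \<bar>heat_op t h x\<bar>"
      using w c by (simp add: c_def abs_mult mult_ac flip: ennreal_mult)
    also have "\<dots> \<le> ennreal c * (\<integral>\<^sup>+y. ennreal (heat t x y) * ennreal \<bar>h y\<bar> \<partial>M)"
      by (intro mult_left_mono abs_heat_op_le h) auto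
    also have "\<dots> = (\<integral>\<^sup>+y. ennreal c * (ennreal (heat t x y) * ennreal \<bar>h y\<bar>) \<partial>M)"
      by (intro nn_integral_cmult[symmetric]) measurable
    also have "\<dots> = (\<integral>\<^sup>+y. ennreal (exp (- (pi * t)) * (w x * heat t x y)) * ennreal \<bar>h x * h y\<bar> \<partial>M)"
      using c w heat_nonneg by (intro nn_integral_cong) (simp add: c_def abs_mult mult_ac flip: ennreal_mult)
    finally show "ennreal \<bar>w x * h x * (exp (- (pi * t)) * heat_op t h x)\<bar> \<le> (\<integral>\<^sup>+y. ennreal (exp (- (pi * t)) * (w x * heat t x y)) * ennreal \<bar>h x * h y\<bar> \<partial>M)" .
  qed
  finally show ?thesis .
qed

text \<open>Schur's test in its simplest form: the heat kernel is symmetric with mass 1, so both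
  constants are 1.\<close>

lemma heat_form:
  assumes h[measurable]: "h \<in> borel_measurable M" and t: "t > 0"
  shows "form (heat t) h \<le> sqnorm h UNIV"
proof -
  define a where "a x = ennreal ((h x)\<^sup>2 / 2)" for x
  have [measurable]: "a \<in> borel_measurable M" unfolding a_def[abs_def] by measurable
  have "form (heat t) h \<le> 1 * (\<integral>\<^sup>+x. a x \<partial>M) + 1 * (\<integral>\<^sup>+y. a y \<partial>M)"
  proof (rule form_le_sum)
    show "(\<lambda>p. heat t (fst p) (snd p)) \<in> borel_measurable (M \<Otimes>\<^sub>M M)" by (rule heat_measurable[OF fst_M snd_M])
    show "ennreal \<bar>h x * h y\<bar> \<le> 1 * a x + a y" for x y
      using zero_le_power2[of "\<bar>h x\<bar> - \<bar>h y\<bar>"] by (simp add: a_def power2_diff abs_mult ennreal_leI flip: ennreal_plus)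
    show "(\<integral>\<^sup>+y. ennreal (heat t x y) * 1 \<partial>M) \<le> 1" for x using heat_mass[OF t] by simp
    show "(\<integral>\<^sup>+x. ennreal (heat t x y) \<partial>M) \<le> 1" for y using heat_mass[OF t, of y] by (simp add: heat_sym[of t _ y])
  qed measurable
  also have "\<dots> = (\<integral>\<^sup>+x. a x + a x \<partial>M)" by (simp add: nn_integral_add)
  also have "\<dots> = sqnorm h UNIV" unfolding sqnorm_real a_def by (intro nn_integral_cong) (simp flip: ennreal_plus)
  finally show ?thesis .
qed

text \<open>The integral of \<open>gauss t y * (hank f y)^2\<close> equals that of
  \<open>f x * heat_op t f x\<close>, hence is at most \<open>sqnorm f UNIV\<close> by
  \<open>heat_form\<close>. Letting \<open>t\<close> tend to 0 with Fatou's lemma removes the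
  Gaussian.\<close>

lemma hank_contraction:
  assumes f: "csL2 R f"
  shows "sqnorm (hank f) UNIV \<le> sqnorm f UNIV"
proof -
  have fm[measurable]: "f \<in> borel_measurable M" using f by (simp add: csL2_def)
  note hm[measurable] = hank_measurable[OF f]
  have le: "(\<integral>\<^sup>+y. ennreal (gauss t y * (hank f y)\<^sup>2) \<partial>M) \<le> sqnorm f UNIV" if t: "t > 0" for t
  proof -
    define u where "u y = gauss t y * hank f y" for y
    have um: "u \<in> borel_measurable M" unfolding u_def[abs_def] using hm by measurable
    have ui: "integrable M (\<lambda>y. \<bar>u y\<bar> * bmaj R y)" unfolding u_def by (rule hank_exp_integrable[OF f t])
    have uJ: "(\<integral>y. u y * bker x y \<partial>M) = heat_op t f x" for x
      unfolding heat_op_eq[OF f t, symmetric] by (simp add: u_def mult_ac)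
    note adj = hank_adjoint[OF f um ui, unfolded uJ]
    have "(\<integral>\<^sup>+y. ennreal (gauss t y * (hank f y)\<^sup>2) \<partial>M) = (\<integral>\<^sup>+y. ennreal (u y * hank f y) \<partial>M)"
      by (simp add: u_def power2_eq_square mult.assoc)
    also have "\<dots> = ennreal (\<integral>y. u y * hank f y \<partial>M)"
      by (rule nn_integral_eq_integral[OF adj(1)]) (simp add: u_def mult.assoc)
    also have "\<dots> = ennreal (\<integral>x. f x * heat_op t f x \<partial>M)" unfolding adj(3) ..
    also have "\<dots> \<le> (\<integral>\<^sup>+x. ennreal \<bar>f x * heat_op t f x\<bar> \<partial>M)"
      by (rule order_trans[OF ennreal_leI[OF abs_ge_self] ennreal_norm_integral_le])
    also have "\<dots> \<le> form (heat t) f"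
    proof (rule nn_integral_mono)
      fix x
      have "ennreal \<bar>f x * heat_op t f x\<bar> \<le> ennreal \<bar>f x\<bar> * (\<integral>\<^sup>+y. ennreal (heat t x y) * ennreal \<bar>f y\<bar> \<partial>M)"
        using mult_left_mono[OF abs_heat_op_le[OF fm, of t x], of "ennreal \<bar>f x\<bar>"] by (simp add: abs_mult ennreal_mult)
      also have "\<dots> = (\<integral>\<^sup>+y. ennreal \<bar>f x\<bar> * (ennreal (heat t x y) * ennreal \<bar>f y\<bar>) \<partial>M)"
        by (intro nn_integral_cmult[symmetric]) measurable
      also have "\<dots> = (\<integral>\<^sup>+y. ennreal (heat t x y) * ennreal \<bar>f x * f y\<bar> \<partial>M)"
        by (simp add: abs_mult ennreal_mult mult_ac)
      finally show "ennreal \<bar>f x * heat_op t f x\<bar> \<le> (\<integral>\<^sup>+y. ennreal (heat t x y) * ennreal \<bar>f x * f y\<bar> \<partial>M)" .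
    qed
    also have "\<dots> \<le> sqnorm f UNIV" by (rule heat_form[OF fm t])
    finally show ?thesis .
  qed
  define F where "F n y = ennreal (exp (- (pi * (1 / real (Suc n)) * y\<^sup>2)) * (hank f y)\<^sup>2)" for n y
  have lim: "(\<lambda>n. F n y) \<longlonglongrightarrow> ennreal ((hank f y)\<^sup>2)" for y
  proof -
    have "(\<lambda>n. 1 / real (Suc n)) \<longlonglongrightarrow> 0" by (rule LIMSEQ_Suc[OF lim_1_over_n])
    then have "(\<lambda>n. exp (- (pi * (1 / real (Suc n)) * y\<^sup>2)) * (hank f y)\<^sup>2) \<longlonglongrightarrow> gauss 0 y * (hank f y)\<^sup>2"
      by (intro tendsto_intros)
    then show ?thesis unfolding F_def by (intro tendsto_ennrealI) simp
  qed
  have "sqnorm (hank f) UNIV = (\<integral>\<^sup>+y. liminf (\<lambda>n. F n y) \<partial>M)"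
    unfolding sqnorm_real by (intro nn_integral_cong) (simp add: lim_imp_Liminf[OF trivial_limit_sequentially lim])
  also have "\<dots> \<le> liminf (\<lambda>n. \<integral>\<^sup>+y. F n y \<partial>M)"
    unfolding F_def by (intro nn_integral_liminf) measurable
  also have "\<dots> \<le> liminf (\<lambda>n. sqnorm f UNIV)"
    unfolding F_def by (intro Liminf_mono always_eventually allI le) auto
  also have "\<dots> = sqnorm f UNIV" by (simp add: Liminf_const)
  finally show ?thesis .
qed

text \<open>The factors \<open>exp (- (pi * t))\<close> are bounded by 1 and dropped; what remains
  under the sum is exactly the kernel treated by Schur's test.\<close>

lemma form_sum:
  assumes h: "h \<in> borel_measurable M" and c: "c \<ge> 0"
  shows "(\<Sum>n=1..N. ennreal \<bar>\<integral>x. wt (1 / 2 ^ n) x * h x * (exp (- (pi * (c / 2 ^ n))) * heat_op (c / 2 ^ n) h x) \<partial>M\<bar>) \<le>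
    form (ker c N) h"
proof -
  note [measurable] = h
  define K where "K n x y = ennreal (wt (1 / 2 ^ n) x * heat (c / 2 ^ n) x y) * ennreal \<bar>h x * h y\<bar>" for n :: nat and x y
  have Kp: "(\<lambda>(x, y). K n x y) \<in> borel_measurable (M \<Otimes>\<^sub>M M)" for n
    unfolding K_def case_prod_beta
    by (intro borel_measurable_times_ennreal measurable_compose[OF _ measurable_ennreal] borel_measurable_times borel_measurable_abs
        wt_measurable fst_M heat_measurable snd_M M_fst[OF h] M_snd[OF h])
  have Ky: "(\<lambda>y. K n x y) \<in> borel_measurable M" for n x
    unfolding K_def by measurable
  have "(\<Sum>n=1..N. ennreal \<bar>\<integral>x. wt (1 / 2 ^ n) x * h x * (exp (- (pi * (c / 2 ^ n))) * heat_op (c / 2 ^ n) h x) \<partial>M\<bar>) \<le>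
    (\<Sum>n=1..N. \<integral>\<^sup>+x. (\<integral>\<^sup>+y. K n x y \<partial>M) \<partial>M)"
  proof (rule sum_mono)
    fix n
    have "ennreal \<bar>\<integral>x. wt (1 / 2 ^ n) x * h x * (exp (- (pi * (c / 2 ^ n))) * heat_op (c / 2 ^ n) h x) \<partial>M\<bar> \<le>
       (\<integral>\<^sup>+x. (\<integral>\<^sup>+y. ennreal (exp (- (pi * (c / 2 ^ n))) * (wt (1 / 2 ^ n) x * heat (c / 2 ^ n) x y)) * ennreal \<bar>h x * h y\<bar> \<partial>M) \<partial>M)"
      by (rule form_le[OF h]) (use c wt_bounds(1) in auto)
    also have "\<dots> \<le> (\<integral>\<^sup>+x. (\<integral>\<^sup>+y. K n x y \<partial>M) \<partial>M)"
      unfolding K_def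
    proof (intro nn_integral_mono mult_right_mono ennreal_leI)
      fix x y
      have "exp (- (pi * (c / 2 ^ n))) \<le> 1" using c by simp
      moreover have "0 \<le> wt (1 / 2 ^ n) x * heat (c / 2 ^ n) x y" by (intro mult_nonneg_nonneg wt_bounds heat_nonneg) auto
      ultimately show "exp (- (pi * (c / 2 ^ n))) * (wt (1 / 2 ^ n) x * heat (c / 2 ^ n) x y) \<le> wt (1 / 2 ^ n) x * heat (c / 2 ^ n) x y"
        by (intro mult_left_le_one_le) auto
    qed auto
    finally show "ennreal \<bar>\<integral>x. wt (1 / 2 ^ n) x * h x * (exp (- (pi * (c / 2 ^ n))) * heat_op (c / 2 ^ n) h x) \<partial>M\<bar> \<le> (\<integral>\<^sup>+x. (\<integral>\<^sup>+y. K n x y \<partial>M) \<partial>M)" .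
  qed
  also have "\<dots> = (\<integral>\<^sup>+x. (\<Sum>n=1..N. \<integral>\<^sup>+y. K n x y \<partial>M) \<partial>M)"
    by (rule nn_integral_sum[symmetric]) (rule borel_measurable_nn_integral[OF Kp])
  also have "\<dots> = (\<integral>\<^sup>+x. (\<integral>\<^sup>+y. (\<Sum>n=1..N. K n x y) \<partial>M) \<partial>M)"
    by (intro nn_integral_cong nn_integral_sum[symmetric] Ky)
  also have "\<dots> = form (ker c N) h"
  proof (intro nn_integral_cong)
    fix x y
    have "(\<Sum>n=1..N. ennreal (wt (1 / 2 ^ n) x * heat (c / 2 ^ n) x y)) = ennreal (ker c N x y)"
      unfolding ker_def by (intro sum_ennreal mult_nonneg_nonneg wt_bounds heat_nonneg) auto
    then show "(\<Sum>n=1..N. K n x y) = ennreal (ker c N x y) * ennreal \<bar>h x * h y\<bar>"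
      unfolding K_def sum_distrib_right[symmetric] by simp
  qed
  finally show ?thesis .
qed

lemma pairing_telescope:
  "pairing (1 / 2 ^ N) (1 / 2 ^ N) f = pairing 1 1 f + (\<Sum>n=1..N. pairing (1 / 2 ^ n) (1 / 2 ^ n) f - pairing (2 * (1 / 2 ^ n)) (2 * (1 / 2 ^ n)) f)"
  by (induction N) auto

text \<open>At time 1 each damping factor is at most \<open>exp (- pi) \<le> 1/2\<close>, also at
  the origin, and \<open>heat_form\<close> handles the rest.\<close>

lemma pairing_one:
  assumes h: "h \<in> borel_measurable M"
  shows "ennreal \<bar>pairing 1 1 h\<bar> \<le> ennreal (1/4) * sqnorm h UNIV"
proof -
  note [measurable] = h
  define k where "k x y = ennreal (heat 1 x y) * ennreal \<bar>h x * h y\<bar>" for x y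
  have kp: "(\<lambda>(x, y). k x y) \<in> borel_measurable (M \<Otimes>\<^sub>M M)"
    unfolding k_def case_prod_beta
    by (intro borel_measurable_times_ennreal measurable_compose[OF _ measurable_ennreal] borel_measurable_times borel_measurable_abs
        fst_M heat_measurable snd_M M_fst[OF h] M_snd[OF h])
  have ky: "(\<lambda>y. k x y) \<in> borel_measurable M" for x unfolding k_def by measurable
  have "ennreal \<bar>pairing 1 1 h\<bar> \<le> (\<integral>\<^sup>+x. (\<integral>\<^sup>+y. ennreal (exp (- (pi * 1)) * (damp 1 x * heat 1 x y)) * ennreal \<bar>h x * h y\<bar> \<partial>M) \<partial>M)"
    unfolding pairing_def by (rule form_le[OF h]) auto
  also have "\<dots> \<le> (\<integral>\<^sup>+x. (\<integral>\<^sup>+y. ennreal (1/4) * k x y \<partial>M) \<partial>M)"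
  proof (intro nn_integral_mono)
    fix x y
    have "1 + pi \<le> exp pi" by (rule exp_ge_add_one_self)
    then have "2 \<le> exp pi" using pi_ge_two by linarith
    then have e1: "exp (- pi) \<le> 1/2" by (simp add: exp_minus field_simps)
    have "pi * 1 \<le> pi * 1 * (1 + x\<^sup>2)" by (simp add: mult_left_mono)
    then have "damp 1 x \<le> exp (- pi)" by simp
    then have e2: "damp 1 x \<le> 1/2" using e1 by linarith
    have "exp (- (pi * 1)) * damp 1 x \<le> 1/2 * (1/2)"
      using e1 e2 by (intro mult_mono) auto
    then have "(exp (- (pi * 1)) * damp 1 x) * heat 1 x y \<le> (1/4) * heat 1 x y"
      by (intro mult_right_mono heat_nonneg) auto
    then have "ennreal (exp (- (pi * 1)) * (damp 1 x * heat 1 x y)) \<le> ennreal ((1/4) * heat 1 x y)"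
      by (intro ennreal_leI) (simp only: mult.assoc)
    then have "ennreal (exp (- (pi * 1)) * (damp 1 x * heat 1 x y)) * ennreal \<bar>h x * h y\<bar> \<le> ennreal ((1/4) * heat 1 x y) * ennreal \<bar>h x * h y\<bar>"
      by (rule mult_right_mono) simp
    also have "ennreal ((1/4) * heat 1 x y) = ennreal (1/4) * ennreal (heat 1 x y)"
      by (rule ennreal_mult) (auto intro: heat_nonneg)
    finally show "ennreal (exp (- (pi * 1)) * (damp 1 x * heat 1 x y)) * ennreal \<bar>h x * h y\<bar> \<le> ennreal (1/4) * k x y"
      unfolding k_def mult.assoc .
  qed
  also have "\<dots> = ennreal (1/4) * (\<integral>\<^sup>+x. (\<integral>\<^sup>+y. k x y \<partial>M) \<partial>M)"
    unfolding nn_integral_cmult[OF ky] nn_integral_cmult[OF borel_measurable_nn_integral[OF kp]] ..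
  also have "\<dots> \<le> ennreal (1/4) * sqnorm h UNIV"
    unfolding k_def by (intro mult_left_mono heat_form h) auto
  finally show ?thesis .
qed

text \<open>Telescoping produces the term at time 1 with constant 1/4 and the two forms with 1/8
  each; \<open>hank_contraction\<close> turns the norm of the transform into that of
  \<open>f\<close>. The sum 1/2 is uniform in \<open>N\<close>.\<close>

lemma pairing_bound:
  "\<exists>\<epsilon>0>0. \<exists>C>0. \<forall>\<epsilon> S T R f N. 0 \<le> \<epsilon> \<longrightarrow> \<epsilon> < \<epsilon>0 \<longrightarrow> thin \<alpha> \<epsilon> S \<longrightarrow> thin \<alpha> \<epsilon> T \<longrightarrow> csL2 R f \<longrightarrow>
    ennreal (pairing (1 / 2 ^ N) (1 / 2 ^ N) f) \<le> ennreal (1/2) * sqnorm f UNIV + ennreal C * (sqnorm f (- S) + sqnorm (hank f) (- T))"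
proof -
  obtain \<epsilon>0 C where E: "\<epsilon>0 > 0" and C: "C > 0" and sch: "\<And>\<epsilon> S c N h. 0 \<le> \<epsilon> \<Longrightarrow> \<epsilon> < \<epsilon>0 \<Longrightarrow> thin \<alpha> \<epsilon> S \<Longrightarrow> 1 \<le> c \<Longrightarrow> c \<le> 2 \<Longrightarrow> h \<in> borel_measurable M \<Longrightarrow>
    form (ker c N) h \<le> ennreal (1/8) * sqnorm h UNIV + ennreal C * sqnorm h (- S)"
    using schur by blast
  have main: "ennreal (pairing (1 / 2 ^ N) (1 / 2 ^ N) f) \<le> ennreal (1/2) * sqnorm f UNIV + ennreal C * (sqnorm f (- S) + sqnorm (hank f) (- T))"
    if e: "0 \<le> \<epsilon>" "\<epsilon> < \<epsilon>0" and S: "thin \<alpha> \<epsilon> S" and T: "thin \<alpha> \<epsilon> T" and f: "csL2 R f" for \<epsilon> S T R f N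
  proof -
    have fm: "f \<in> borel_measurable M" using f by (simp add: csL2_def)
    note hm = hank_measurable[OF f]
    define I where "I h c n = (\<integral>x. wt (1 / 2 ^ n) x * h x * (exp (- (pi * (c / 2 ^ n))) * heat_op (c / 2 ^ n) h x) \<partial>M)" for h c and n :: nat
    have d: "pairing (1 / 2 ^ n) (1 / 2 ^ n) f - pairing (2 * (1 / 2 ^ n)) (2 * (1 / 2 ^ n)) f = I f 1 n + I (hank f) 2 n" for n
      using pairing_diff[OF f, of "1 / 2 ^ n"] by (simp add: I_def)
    have "pairing (1 / 2 ^ N) (1 / 2 ^ N) f \<le> \<bar>pairing 1 1 f\<bar> + ((\<Sum>n=1..N. \<bar>I f 1 n\<bar>) + (\<Sum>n=1..N. \<bar>I (hank f) 2 n\<bar>))"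
      unfolding pairing_telescope[of N] d sum.distrib[symmetric] by (intro add_mono sum_mono) auto
    then have "ennreal (pairing (1 / 2 ^ N) (1 / 2 ^ N) f) \<le> ennreal (\<bar>pairing 1 1 f\<bar> + ((\<Sum>n=1..N. \<bar>I f 1 n\<bar>) + (\<Sum>n=1..N. \<bar>I (hank f) 2 n\<bar>)))"
      by (rule ennreal_leI)
    also have "\<dots> = ennreal \<bar>pairing 1 1 f\<bar> + ((\<Sum>n=1..N. ennreal \<bar>I f 1 n\<bar>) + (\<Sum>n=1..N. ennreal \<bar>I (hank f) 2 n\<bar>))"
      by (subst ennreal_plus, simp, simp add: sum_nonneg, subst ennreal_plus, simp_all add: sum_nonneg sum_ennreal)
    also have "\<dots> \<le> ennreal (1/4) * sqnorm f UNIV + ((ennreal (1/8) * sqnorm f UNIV + ennreal C * sqnorm f (- S)) + (ennreal (1/8) * sqnorm (hank f) UNIV + ennreal C * sqnorm (hank f) (- T)))"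
      unfolding I_def
      by (intro add_mono pairing_one fm order_trans[OF form_sum[OF fm] sch[OF e S]] order_trans[OF form_sum[OF hm] sch[OF e T]] hm) auto
    also have "\<dots> \<le> ennreal (1/4) * sqnorm f UNIV + ((ennreal (1/8) * sqnorm f UNIV + ennreal C * sqnorm f (- S)) + (ennreal (1/8) * sqnorm f UNIV + ennreal C * sqnorm (hank f) (- T)))"
      by (intro add_mono mult_left_mono hank_contraction[OF f] order_refl) auto
    also have "\<dots> = (ennreal (1/4) + ennreal (1/8) + ennreal (1/8)) * sqnorm f UNIV + ennreal C * (sqnorm f (- S) + sqnorm (hank f) (- T))"
      by (simp only: distrib_left distrib_right add_ac)
    also have "ennreal (1/4) + ennreal (1/8) + ennreal (1/8) = ennreal (1/2)" by (simp flip: ennreal_plus)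
    finally show ?thesis .
  qed
  show ?thesis
    by (rule exI[of _ \<epsilon>0], rule conjI[OF E], rule exI[of _ C], rule conjI[OF C], intro allI impI, rule main)
qed

text \<open>Chebyshev's inequality: where \<open>\<bar>y^2 - x^2\<bar> \<ge> d\<close> the
  oscillation of \<open>f\<close> is at most \<open>2 * K\<close>, and the mass of that region is
  controlled by \<open>spread\<close>.\<close>

lemma heat_op_approx:
  "\<exists>V>0. \<forall>f K x d e t. f \<in> borel_measurable M \<longrightarrow> (\<forall>y. \<bar>f y\<bar> \<le> K) \<longrightarrow> 0 < d \<longrightarrow> 0 \<le> e \<longrightarrow>
    (\<forall>y\<ge>0. \<bar>y\<^sup>2 - x\<^sup>2\<bar> < d \<longrightarrow> \<bar>f y - f x\<bar> \<le> e) \<longrightarrow> 0 < t \<longrightarrow> t \<le> 1 \<longrightarrow>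
    \<bar>heat_op t f x - f x\<bar> \<le> e + 2 * K / d\<^sup>2 * (V * (t * (1 + x\<^sup>2)))"
proof -
  obtain V where V: "V > 0" "\<And>t x. 0 < t \<Longrightarrow> t \<le> 1 \<Longrightarrow> spread t x \<le> ennreal (V * (t * (1 + x\<^sup>2)))"
    using heat_variance by blast
  have main: "\<bar>heat_op t f x - f x\<bar> \<le> e + 2 * K / d\<^sup>2 * (V * (t * (1 + x\<^sup>2)))"
    if f[measurable]: "f \<in> borel_measurable M" and K: "\<forall>y. \<bar>f y\<bar> \<le> K" and d: "0 < d" and e: "0 \<le> e"
      and cont: "\<forall>y\<ge>0. \<bar>y\<^sup>2 - x\<^sup>2\<bar> < d \<longrightarrow> \<bar>f y - f x\<bar> \<le> e" and t: "0 < t" "t \<le> 1" for f K x d e t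
  proof -
    have K0: "K \<ge> 0" using K abs_ge_zero[of "f 0"] order_trans by blast
    have hb: "has_bochner_integral M (heat t x) 1"
      using heat_exp_integral[OF t(1), of 0 x] by simp
    then have hi: "integrable M (heat t x)" "(\<integral>y. heat t x y \<partial>M) = 1" by (auto simp: has_bochner_integral_iff)
    have hf: "integrable M (\<lambda>y. heat t x y * f y)"
    proof (rule Bochner_Integration.integrable_bound[of M "\<lambda>y. K * heat t x y"])
      show "AE y in M. norm (heat t x y * f y) \<le> norm (K * heat t x y)"
        using K K0 heat_nonneg by (intro AE_I2) (simp add: abs_mult mult.commute mult_right_mono)
    qed (use hi in \<open>auto, measurable\<close>)
    have "heat_op t f x - f x = (\<integral>y. heat t x y * f y - heat t x y * f x \<partial>M)"
      unfolding heat_op_def using hf hi by (subst Bochner_Integration.integral_diff) auto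
    also have "\<dots> = (\<integral>y. heat t x y * (f y - f x) \<partial>M)" by (simp add: algebra_simps)
    finally have "ennreal \<bar>heat_op t f x - f x\<bar> \<le> (\<integral>\<^sup>+y. ennreal \<bar>heat t x y * (f y - f x)\<bar> \<partial>M)"
      by (simp only: ennreal_norm_integral_le)
    also have "\<dots> \<le> (\<integral>\<^sup>+y. ennreal e * ennreal (heat t x y) + ennreal (2 * K / d\<^sup>2) * ennreal (heat t x y * (y\<^sup>2 - x\<^sup>2)\<^sup>2) \<partial>M)"
    proof (rule nn_integral_mono_AE, use AE_M_nonneg in eventually_elim)
      fix y :: real assume y: "y \<ge> 0"
      define q where "q = (y\<^sup>2 - x\<^sup>2)\<^sup>2"
      have q: "q \<ge> 0" by (simp add: q_def)
      have "\<bar>f y - f x\<bar> \<le> e + 2 * K / d\<^sup>2 * q"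
      proof (cases "\<bar>y\<^sup>2 - x\<^sup>2\<bar> < d")
        case True
        then have "\<bar>f y - f x\<bar> \<le> e" using cont y by blast
        moreover have "0 \<le> 2 * K / d\<^sup>2 * q" using K0 q by simp
        ultimately show ?thesis by linarith
      next
        case False
        then have "d\<^sup>2 \<le> \<bar>y\<^sup>2 - x\<^sup>2\<bar>\<^sup>2" using d by (intro power_mono) linarith+
        then have "d\<^sup>2 \<le> q" unfolding q_def by (simp only: power2_abs)
        then have "2 * K * 1 \<le> 2 * K * (q / d\<^sup>2)" using K0 d by (intro mult_left_mono) auto
        moreover have "\<bar>f y - f x\<bar> \<le> 2 * K" using K[rule_format, of x] K[rule_format, of y] by linarith
        ultimately show ?thesis using e by simp
      qed
      then have "heat t x y * \<bar>f y - f x\<bar> \<le> heat t x y * (e + 2 * K / d\<^sup>2 * q)"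
        by (rule mult_left_mono[OF _ heat_nonneg])
      then have "\<bar>heat t x y * (f y - f x)\<bar> \<le> e * heat t x y + 2 * K / d\<^sup>2 * (heat t x y * q)"
      proof -
        have "\<bar>heat t x y * (f y - f x)\<bar> = heat t x y * \<bar>f y - f x\<bar>"
          using heat_nonneg[of t x y] by (simp only: abs_mult abs_of_nonneg)
        moreover have "heat t x y * (e + 2 * K / d\<^sup>2 * q) = e * heat t x y + 2 * K / d\<^sup>2 * (heat t x y * q)"
          by (simp add: distrib_left mult_ac)
        ultimately show ?thesis
          using \<open>heat t x y * \<bar>f y - f x\<bar> \<le> heat t x y * (e + 2 * K / d\<^sup>2 * q)\<close> by simp
      qed
      then have "ennreal \<bar>heat t x y * (f y - f x)\<bar> \<le> ennreal (e * heat t x y + 2 * K / d\<^sup>2 * (heat t x y * q))"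
        by (rule ennreal_leI)
      also have "\<dots> = ennreal e * ennreal (heat t x y) + ennreal (2 * K / d\<^sup>2) * ennreal (heat t x y * q)"
      proof -
        have h0: "heat t x y \<ge> 0" by (rule heat_nonneg)
        have k0: "2 * K / d\<^sup>2 \<ge> 0" "heat t x y * q \<ge> 0" using K0 h0 q by auto
        have "ennreal (e * heat t x y + 2 * K / d\<^sup>2 * (heat t x y * q)) = ennreal (e * heat t x y) + ennreal (2 * K / d\<^sup>2 * (heat t x y * q))"
          by (intro ennreal_plus mult_nonneg_nonneg e h0 k0)
        then show ?thesis unfolding ennreal_mult[OF e h0] ennreal_mult[OF k0] .
      qed
      finally show "ennreal \<bar>heat t x y * (f y - f x)\<bar> \<le> ennreal e * ennreal (heat t x y) + ennreal (2 * K / d\<^sup>2) * ennreal (heat t x y * (y\<^sup>2 - x\<^sup>2)\<^sup>2)"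
        unfolding q_def .
    qed
    also have "\<dots> = ennreal e * (\<integral>\<^sup>+y. ennreal (heat t x y) \<partial>M) + ennreal (2 * K / d\<^sup>2) * spread t x"
    proof -
      have m1: "(\<lambda>y. ennreal (heat t x y)) \<in> borel_measurable M" by measurable
      have m2: "(\<lambda>y. ennreal (heat t x y * (y\<^sup>2 - x\<^sup>2)\<^sup>2)) \<in> borel_measurable M" by measurable
      have m3: "(\<lambda>y. ennreal e * ennreal (heat t x y)) \<in> borel_measurable M" using m1 by measurable
      have m4: "(\<lambda>y. ennreal (2 * K / d\<^sup>2) * ennreal (heat t x y * (y\<^sup>2 - x\<^sup>2)\<^sup>2)) \<in> borel_measurable M" using m2 by measurable
      show ?thesis unfolding nn_integral_add[OF m3 m4] nn_integral_cmult[OF m1] nn_integral_cmult[OF m2] ..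
    qed
    also have "\<dots> \<le> ennreal e * 1 + ennreal (2 * K / d\<^sup>2) * ennreal (V * (t * (1 + x\<^sup>2)))"
      unfolding heat_mass[OF t(1)] by (intro add_mono mult_left_mono V t order_refl) auto
    also have "\<dots> = ennreal (e + 2 * K / d\<^sup>2 * (V * (t * (1 + x\<^sup>2))))"
    proof -
      have k0: "2 * K / d\<^sup>2 \<ge> 0" "V * (t * (1 + x\<^sup>2)) \<ge> 0"
        using K0 V(1) t by (auto intro!: mult_nonneg_nonneg add_nonneg_nonneg)
      have "ennreal (e + 2 * K / d\<^sup>2 * (V * (t * (1 + x\<^sup>2)))) = ennreal e + ennreal (2 * K / d\<^sup>2 * (V * (t * (1 + x\<^sup>2))))"
        by (intro ennreal_plus mult_nonneg_nonneg e k0)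
      then show ?thesis unfolding ennreal_mult[OF k0] by simp
    qed
    finally show ?thesis
      using e K0 V(1) t by (subst (asm) ennreal_le_iff) (auto intro!: add_nonneg_nonneg mult_nonneg_nonneg divide_nonneg_nonneg)
  qed
  show ?thesis
    by (rule exI[of _ V], rule conjI[OF V(1)], intro allI impI, rule main)
qed

subsection \<open>Recovering the norm as the time tends to zero\<close>

text \<open>On the half-line the only possible discontinuity is the cut at \<open>R\<close>, a null
  set, and boundedness gives a dominating function for the limit at time zero.\<close>

definition nice :: "real \<Rightarrow> (real \<Rightarrow> real) \<Rightarrow> bool" where
  "nice R f \<longleftrightarrow> (\<exists>K h. continuous_on UNIV h \<and> (\<forall>x. \<bar>h x\<bar> \<le> K) \<and> f = (\<lambda>x. h x * indicator {0..R} x))"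

lemma indicator_sq_integrable: "integrable M (\<lambda>x. indicator {0..R::real} x :: real)"
proof -
  have "emeasure M {0..R} < \<infinity>" by (rule emeasure_M_finite) simp
  then show ?thesis by simp
qed

lemma nice_csL2:
  assumes "nice R f" shows "csL2 R f"
proof -
  obtain K h where h: "continuous_on UNIV h" "\<And>x. \<bar>h x\<bar> \<le> K" "f = (\<lambda>x. h x * indicator {0..R} x)"
    using assms unfolding nice_def by blast
  have hm: "h \<in> borel_measurable borel" using h(1) by (rule borel_measurable_continuous_onI)
  then have fm: "f \<in> borel_measurable M" unfolding h(3) by (intro borel_M borel_measurable_times borel_measurable_indicator) auto
  have "integrable M (\<lambda>x. (f x)\<^sup>2)"
  proof (rule Bochner_Integration.integrable_bound[of M "\<lambda>x. K\<^sup>2 * indicator {0..R} x"])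
    show "integrable M (\<lambda>x. K\<^sup>2 * indicator {0..R} x)" using indicator_sq_integrable by (intro integrable_mult_right) auto
    have "\<bar>h x\<bar>\<^sup>2 \<le> K\<^sup>2" for x using h(2)[of x] by (intro power_mono) auto
    then show "AE x in M. norm ((f x)\<^sup>2) \<le> norm (K\<^sup>2 * indicator {0..R} x)"
      unfolding h(3) by (intro AE_I2) (auto simp: indicator_def)
  qed (use fm in measurable)
  then show ?thesis using fm unfolding csL2_def h(3) by (auto simp: indicator_def)
qed

lemma heat_op_tendsto:
  assumes f: "nice R f" and x: "x \<ge> 0" "x \<noteq> R"
  shows "(\<lambda>N. heat_op (1 / 2 ^ N) f x) \<longlonglongrightarrow> f x"
proof -
  obtain K h where h: "continuous_on UNIV h" "\<And>x. \<bar>h x\<bar> \<le> K" "f = (\<lambda>x. h x * indicator {0..R} x)"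
    using f unfolding nice_def by blast
  have fm: "f \<in> borel_measurable M" using nice_csL2[OF f] by (simp add: csL2_def)
  have K0: "K \<ge> 0" using h(2)[of 0] by linarith
  have Kf: "\<forall>y. \<bar>f y\<bar> \<le> K" using h(2) K0 unfolding h(3) by (auto simp: indicator_def)
  obtain V where V: "V > 0" "\<And>f K x d e t. f \<in> borel_measurable M \<Longrightarrow> (\<forall>y. \<bar>f y\<bar> \<le> K) \<Longrightarrow> 0 < d \<Longrightarrow> 0 \<le> e \<Longrightarrow>
    (\<forall>y\<ge>0. \<bar>y\<^sup>2 - x\<^sup>2\<bar> < d \<longrightarrow> \<bar>f y - f x\<bar> \<le> e) \<Longrightarrow> 0 < t \<Longrightarrow> t \<le> 1 \<Longrightarrow>
    \<bar>heat_op t f x - f x\<bar> \<le> e + 2 * K / d\<^sup>2 * (V * (t * (1 + x\<^sup>2)))"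
    using heat_op_approx by blast
  show ?thesis
  proof (rule LIMSEQ_I)
    fix r :: real assume r: "r > 0"
    have "isCont h x" using h(1) by (simp add: continuous_on_eq_continuous_at)
    then obtain a where a: "a > 0" "\<And>y. dist y x < a \<Longrightarrow> dist (h y) (h x) < r / 2"
      using r unfolding continuous_at_eps_delta by (meson half_gt_zero)
    \<comment> \<open>Small enough both for the continuity of \<open>h\<close> and for staying on
      the same side of the cut at \<open>R\<close>.\<close>
    define b where "b = min a \<bar>x - R\<bar>"
    have b: "b > 0" using a(1) x by (simp add: b_def)
    \<comment> \<open>For nonnegative \<open>x\<close> and \<open>y\<close> one has
      \<open>(y - x)^2 \<le> \<bar>y^2 - x^2\<bar>\<close>, so closeness of the squares within
      \<open>b^2\<close> gives closeness within \<open>b\<close>, also at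
      \<open>x = 0\<close>.\<close>
    have cont: "\<forall>y\<ge>0. \<bar>y\<^sup>2 - x\<^sup>2\<bar> < b\<^sup>2 \<longrightarrow> \<bar>f y - f x\<bar> \<le> r / 2"
    proof (intro allI impI)
      fix y :: real assume y: "y \<ge> 0" and yx: "\<bar>y\<^sup>2 - x\<^sup>2\<bar> < b\<^sup>2"
      have "\<bar>y - x\<bar> < b"
      proof (rule ccontr)
        assume "\<not> \<bar>y - x\<bar> < b"
        then have "b \<le> \<bar>y - x\<bar>" by simp
        moreover have "\<bar>y - x\<bar> \<le> \<bar>y + x\<bar>" using x y by simp
        ultimately have "b * b \<le> \<bar>y - x\<bar> * \<bar>y + x\<bar>" using b by (intro mult_mono) auto
        also have "\<dots> = \<bar>y\<^sup>2 - x\<^sup>2\<bar>" unfolding abs_mult[symmetric] by (simp add: power2_eq_square algebra_simps)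
        finally show False using yx by (simp add: power2_eq_square)
      qed
      then have "dist y x < a" "\<bar>y - x\<bar> < \<bar>x - R\<bar>" unfolding b_def dist_real_def by auto
      then have "\<bar>h y - h x\<bar> < r / 2" "(y \<le> R) = (x \<le> R)" using a(2)[of y] by (auto simp: dist_real_def)
      then show "\<bar>f y - f x\<bar> \<le> r / 2" using x y r unfolding h(3) by (auto simp: indicator_def)
    qed
    define c where "c = 2 * K / (b\<^sup>2)\<^sup>2 * (V * (1 + x\<^sup>2))"
    have "(\<lambda>N. c * (1 / 2) ^ N) \<longlonglongrightarrow> c * 0"
      by (intro tendsto_mult tendsto_const LIMSEQ_power_zero) simp
    then have "eventually (\<lambda>N. c * (1 / 2) ^ N < r / 2) sequentially"
      using r by (intro order_tendstoD(2)) auto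
    then obtain N0 where N0: "\<And>N. N \<ge> N0 \<Longrightarrow> c * (1 / 2) ^ N < r / 2" by (auto simp: eventually_sequentially)
    have "norm (heat_op (1 / 2 ^ N) f x - f x) < r" if N: "N \<ge> N0" for N
    proof -
      have "b\<^sup>2 > 0" "r / 2 \<ge> 0" using b r by auto
      from V(2)[OF fm Kf this cont, of "1 / 2 ^ N"]
      have "\<bar>heat_op (1 / 2 ^ N) f x - f x\<bar> \<le> r / 2 + 2 * K / (b\<^sup>2)\<^sup>2 * (V * (1 / 2 ^ N * (1 + x\<^sup>2)))" by simp
      also have "2 * K / (b\<^sup>2)\<^sup>2 * (V * (1 / 2 ^ N * (1 + x\<^sup>2))) = c * (1 / 2) ^ N" by (simp add: c_def power_one_over)
      finally show ?thesis using N0[OF N] by simp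
    qed
    then show "\<exists>no. \<forall>n\<ge>no. norm (heat_op (1 / 2 ^ n) f x - f x) < r" by blast
  qed
qed

text \<open>Dominated convergence: the heat operator keeps the bound \<open>K\<close>, so
  \<open>\<bar>f x\<bar> * K\<close> dominates at all times, and \<open>heat_op_tendsto\<close>
  gives the limit off the null set \<open>{R}\<close>.\<close>

lemma pairing_tendsto:
  assumes f: "nice R f"
  shows "(\<lambda>N. pairing (1 / 2 ^ N) (1 / 2 ^ N) f) \<longlonglongrightarrow> (\<integral>x. (f x)\<^sup>2 \<partial>M)"
proof -
  note cs = nice_csL2[OF f]
  have fm: "f \<in> borel_measurable M" using cs by (simp add: csL2_def)
  obtain K h where h: "continuous_on UNIV h" "\<And>x. \<bar>h x\<bar> \<le> K" "f = (\<lambda>x. h x * indicator {0..R} x)"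
    using f unfolding nice_def by blast
  have K0: "K \<ge> 0" using h(2)[of 0] by linarith
  have Kf: "\<bar>f y\<bar> \<le> K" for y using h(2) K0 unfolding h(3) by (auto simp: indicator_def)
  have PK: "\<bar>heat_op t f x\<bar> \<le> K" if t: "t > 0" for t x
  proof -
    have "ennreal \<bar>heat_op t f x\<bar> \<le> (\<integral>\<^sup>+y. ennreal (heat t x y) * ennreal \<bar>f y\<bar> \<partial>M)" by (rule abs_heat_op_le[OF fm])
    also have "\<dots> \<le> (\<integral>\<^sup>+y. ennreal (heat t x y) * ennreal K \<partial>M)" by (intro nn_integral_mono mult_left_mono ennreal_leI Kf) auto
    also have "\<dots> = ennreal K" by (subst nn_integral_multc) (measurable, simp add: heat_mass[OF t])
    finally show ?thesis using K0 by simp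
  qed
  define F where "F N x = exp (- (pi * (1 / 2 ^ N) * (1 + x\<^sup>2))) * f x * (exp (- (pi * (1 / 2 ^ N))) * heat_op (1 / 2 ^ N) f x)" for N :: nat and x
  have "(\<lambda>N. \<integral>x. F N x \<partial>M) \<longlonglongrightarrow> (\<integral>x. (f x)\<^sup>2 \<partial>M)"
  proof (rule integral_dominated_convergence)
    show "(\<lambda>x. (f x)\<^sup>2) \<in> borel_measurable M" using fm by measurable
    show "F N \<in> borel_measurable M" for N
      using pairing_dual(2)[OF cs, of "1 / 2 ^ N" "1 / 2 ^ N"] unfolding F_def[abs_def] by (intro borel_measurable_integrable) simp
    show "integrable M (\<lambda>x. \<bar>f x\<bar> * K)" using csL2_integrable[OF cs] by (intro integrable_mult_left) auto
    have "AE x in lebesgue. x \<noteq> R" by (rule AE_I'[of "{R}"]) (auto simp: null_sets_def)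
    then have "AE x in M. x \<noteq> R" unfolding mu_dens using dens_lebesgue by (subst AE_density) auto
    with AE_M_nonneg show "AE x in M. (\<lambda>N. F N x) \<longlonglongrightarrow> (f x)\<^sup>2"
    proof eventually_elim
      fix x :: real assume x: "0 \<le> x" "x \<noteq> R"
      have z: "(\<lambda>N. 1 / 2 ^ N :: real) \<longlonglongrightarrow> 0"
        using LIMSEQ_power_zero[of "1/2 :: real"] by (simp add: power_one_over)
      have "(\<lambda>N. F N x) \<longlonglongrightarrow> damp 0 x * f x * (exp (- (pi * 0)) * f x)"
        unfolding F_def by (intro tendsto_intros z heat_op_tendsto[OF f x])
      then show "(\<lambda>N. F N x) \<longlonglongrightarrow> (f x)\<^sup>2" by (simp add: power2_eq_square)
    qed
    show "AE x in M. norm (F N x) \<le> \<bar>f x\<bar> * K" for N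
    proof (rule AE_I2)
      fix x
      have "\<bar>F N x\<bar> = exp (- (pi * (1 / 2 ^ N) * (1 + x\<^sup>2))) * \<bar>f x\<bar> * (exp (- (pi * (1 / 2 ^ N))) * \<bar>heat_op (1 / 2 ^ N) f x\<bar>)"
        by (simp add: F_def abs_mult)
      also have "\<dots> \<le> 1 * \<bar>f x\<bar> * (1 * K)"
        by (intro mult_mono PK) (auto simp: add_nonneg_nonneg K0)
      finally show "norm (F N x) \<le> \<bar>f x\<bar> * K" by simp
    qed
  qed
  then show ?thesis by (simp add: pairing_def F_def)
qed

section \<open>Density of truncated continuous functions and the inequality for compact
  support\<close>

lemma thin_compl:
  assumes "thin \<alpha> \<epsilon> S" shows "- S \<in> sets M"
proof -
  have "S \<in> sets M" using assms by (simp add: thin_def)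
  from sets.compl_sets[OF this] show ?thesis by (simp add: Compl_eq_Diff_UNIV)
qed

lemma sqnorm_eq: "csL2 R f \<Longrightarrow> sqnorm f UNIV = ennreal (\<integral>x. (f x)\<^sup>2 \<partial>M)"
  unfolding sqnorm_real csL2_def by (simp add: nn_integral_eq_integral)

lemma sqnorm_add_le:
  assumes [measurable]: "f \<in> borel_measurable M" "g \<in> borel_measurable M" "T \<in> sets M"
    and fg: "\<And>x. h x = f x + g x"
  shows "sqnorm h T \<le> 2 * sqnorm f T + 2 * sqnorm g T"
proof -
  have "sqnorm h T \<le> (\<integral>\<^sup>+x. 2 * (ennreal ((norm (f x))\<^sup>2) * indicator T x) + 2 * (ennreal ((norm (g x))\<^sup>2) * indicator T x) \<partial>M)"
    unfolding sqnorm_def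
  proof (intro nn_integral_mono)
    fix x
    have "(norm (h x))\<^sup>2 \<le> (norm (f x) + norm (g x))\<^sup>2"
      unfolding fg by (intro power_mono norm_triangle_ineq) auto
    also have "\<dots> \<le> 2 * (norm (f x))\<^sup>2 + 2 * (norm (g x))\<^sup>2"
      using zero_le_power2[of "norm (f x) - norm (g x)"] by (simp add: power2_diff power2_sum)
    finally have "ennreal ((norm (h x))\<^sup>2) \<le> ennreal (2 * (norm (f x))\<^sup>2 + 2 * (norm (g x))\<^sup>2)" by (rule ennreal_leI)
    also have "\<dots> = 2 * ennreal ((norm (f x))\<^sup>2) + 2 * ennreal ((norm (g x))\<^sup>2)"
      by (simp add: ennreal_plus ennreal_mult flip: ennreal_numeral)
    finally show "ennreal ((norm (h x))\<^sup>2) * indicator T x \<le> 2 * (ennreal ((norm (f x))\<^sup>2) * indicator T x) + 2 * (ennreal ((norm (g x))\<^sup>2) * indicator T x)"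
      by (auto simp: indicator_def)
  qed
  also have "\<dots> = 2 * sqnorm f T + 2 * sqnorm g T"
    unfolding sqnorm_def by (subst nn_integral_add, measurable, subst (1 2) nn_integral_cmult, measurable)
  finally show ?thesis .
qed

lemma sqnorm_mono: "D \<subseteq> D' \<Longrightarrow> sqnorm f D \<le> sqnorm f D'"
  unfolding sqnorm_def by (intro nn_integral_mono) (auto simp: indicator_def)

lemma AE_lebesgue_M: "AE x in lebesgue. Q x \<Longrightarrow> AE x in M. Q x"
  unfolding mu_dens using dens_lebesgue by (subst AE_density) auto

text \<open>First of two approximations: it makes the function bounded, so that the continuous
  approximants can be clamped at the same level and dominated.\<close>

lemma clamp_dense:
  assumes f: "csL2 R f"
  shows "(\<lambda>m. sqnorm (\<lambda>x. f x - max (- real m) (min (real m) (f x))) UNIV) \<longlonglongrightarrow> 0"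
proof -
  have fm[measurable]: "f \<in> borel_measurable M" using f by (simp add: csL2_def)
  have "(\<lambda>m. \<integral>\<^sup>+x. ennreal ((f x - max (- real m) (min (real m) (f x)))\<^sup>2) \<partial>M) \<longlonglongrightarrow> (\<integral>\<^sup>+x. 0 \<partial>M)"
  proof (rule nn_integral_dominated_convergence[where w = "\<lambda>x. ennreal ((f x)\<^sup>2)"])
    show "(\<integral>\<^sup>+x. ennreal ((f x)\<^sup>2) \<partial>M) < \<infinity>" using sqnorm_eq[OF f] by (simp add: sqnorm_real)
    show "AE x in M. ennreal ((f x - max (- real m) (min (real m) (f x)))\<^sup>2) \<le> ennreal ((f x)\<^sup>2)" for m
    proof (intro AE_I2 ennreal_leI)
      fix x
      have "\<bar>f x - max (- real m) (min (real m) (f x))\<bar> \<le> \<bar>f x\<bar>" by (auto simp: max_def min_def)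
      then show "(f x - max (- real m) (min (real m) (f x)))\<^sup>2 \<le> (f x)\<^sup>2" by (simp only: abs_le_square_iff)
    qed
    show "AE x in M. (\<lambda>m. ennreal ((f x - max (- real m) (min (real m) (f x)))\<^sup>2)) \<longlonglongrightarrow> 0"
    proof (rule AE_I2)
      fix x
      obtain k :: nat where k: "\<bar>f x\<bar> \<le> real k" using real_arch_simple by blast
      have "eventually (\<lambda>m. ennreal ((f x - max (- real m) (min (real m) (f x)))\<^sup>2) = 0) sequentially"
        using eventually_ge_at_top[of k]
      proof eventually_elim
        case (elim m)
        then have "real k \<le> real m" by simp
        then have "max (- real m) (min (real m) (f x)) = f x" using k by linarith
        then show ?case by simp
      qed
      then show "(\<lambda>m. ennreal ((f x - max (- real m) (min (real m) (f x)))\<^sup>2)) \<longlonglongrightarrow> 0" by (rule tendsto_eventually)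
    qed
  qed measurable
  then show ?thesis by (simp add: sqnorm_real)
qed

text \<open>Lebesgue measurability yields continuous functions converging to \<open>f\<close> almost
  everywhere. Clamping them to \<open>[-m, m]\<close> and cutting at \<open>R\<close> makes them
  nice and bounds the errors by a constant on a set of finite measure.\<close>

lemma bounded_dense:
  assumes f: "csL2 R f" and m: "m \<ge> 0"
  shows "\<exists>p. (\<forall>n. nice R (p n)) \<and> (\<lambda>n. sqnorm (\<lambda>x. max (- m) (min m (f x)) - p n x) UNIV) \<longlonglongrightarrow> 0"
proof -
  have fm[measurable]: "f \<in> borel_measurable M" using f by (simp add: csL2_def)
  then have "f \<in> borel_measurable lebesgue" by (simp cong: measurable_cong_sets)
  then have "f measurable_on UNIV" by (intro lebesgue_measurable_imp_measurable_on_real) auto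
  then obtain Z g where Z: "negligible Z" and g: "\<And>n. continuous_on UNIV (g n)" "\<And>x. x \<notin> Z \<Longrightarrow> (\<lambda>n. g n x) \<longlonglongrightarrow> f x"
    unfolding measurable_on_def by auto
  define c where "c u = max (- m) (min m u)" for u :: real
  have cc: "continuous_on UNIV c" unfolding c_def by (intro continuous_intros)
  have cm: "\<bar>c u\<bar> \<le> m" for u using m by (auto simp: c_def max_def min_def)
  define p where "p n x = c (g n x) * indicator {0..R} x" for n x
  have np: "nice R (p n)" for n
    unfolding nice_def p_def
    by (intro exI[of _ m] exI[of _ "\<lambda>x. c (g n x)"] conjI allI cm ext continuous_on_compose2[OF cc g(1)]) auto
  have pm[measurable]: "p n \<in> borel_measurable M" for n using nice_csL2[OF np] by (simp add: csL2_def)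
  have cfm[measurable]: "(\<lambda>x. c (f x)) \<in> borel_measurable M" unfolding c_def by measurable
  have "(\<lambda>n. \<integral>\<^sup>+x. ennreal ((c (f x) - p n x)\<^sup>2) \<partial>M) \<longlonglongrightarrow> (\<integral>\<^sup>+x. 0 \<partial>M)"
  proof (rule nn_integral_dominated_convergence[where w = "\<lambda>x. ennreal ((2 * m)\<^sup>2) * indicator {0..R} x"])
    have "emeasure M {0..R} < \<infinity>" by (rule emeasure_M_finite) simp
    then show "(\<integral>\<^sup>+x. ennreal ((2 * m)\<^sup>2) * indicator {0..R} x \<partial>M) < \<infinity>"
      by (subst nn_integral_cmult_indicator) (auto simp: ennreal_mult_less_top)
    have c0: "c 0 = 0" using m by (simp add: c_def)
    show "AE x in M. ennreal ((c (f x) - p n x)\<^sup>2) \<le> ennreal ((2 * m)\<^sup>2) * indicator {0..R} x" for n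
    proof (rule AE_I2)
      fix x
      show "ennreal ((c (f x) - p n x)\<^sup>2) \<le> ennreal ((2 * m)\<^sup>2) * indicator {0..R} x"
      proof (cases "x \<in> {0..R}")
        case True
        have "\<bar>c (f x) - c (g n x)\<bar> \<le> \<bar>2 * m\<bar>" using cm[of "f x"] cm[of "g n x"] by linarith
        then have "(c (f x) - c (g n x))\<^sup>2 \<le> (2 * m)\<^sup>2" by (simp only: abs_le_square_iff)
        then show ?thesis using True by (simp add: p_def ennreal_leI)
      next
        case False
        then show ?thesis using f c0 by (simp add: p_def csL2_def)
      qed
    qed
    have "AE x in lebesgue. x \<notin> Z" using Z by (intro AE_I'[of Z]) (auto simp: negligible_iff_null_sets)
    then have "AE x in M. x \<notin> Z" by (rule AE_lebesgue_M)
    then show "AE x in M. (\<lambda>n. ennreal ((c (f x) - p n x)\<^sup>2)) \<longlonglongrightarrow> 0"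
    proof eventually_elim
      fix x assume x: "x \<notin> Z"
      have c1: "isCont c (f x)" using cc by (simp add: continuous_on_eq_continuous_at)
      have "(\<lambda>n. c (g n x)) \<longlonglongrightarrow> c (f x)" by (rule isCont_tendsto_compose[OF c1 g(2)[OF x]])
      then have "(\<lambda>n. (c (f x) - p n x)\<^sup>2) \<longlonglongrightarrow> (c (f x) - c (f x) * indicator {0..R} x)\<^sup>2"
        unfolding p_def by (intro tendsto_intros)
      also have "(c (f x) - c (f x) * indicator {0..R} x)\<^sup>2 = 0"
        using f c0 by (cases "x \<in> {0..R}") (auto simp: csL2_def)
      finally have "(\<lambda>n. ennreal ((c (f x) - p n x)\<^sup>2)) \<longlonglongrightarrow> ennreal 0" by (rule tendsto_ennrealI)
      then show "(\<lambda>n. ennreal ((c (f x) - p n x)\<^sup>2)) \<longlonglongrightarrow> 0" by simp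
    qed
  qed measurable
  then show ?thesis using np unfolding c_def by (intro exI[of _ p]) (simp add: sqnorm_real)
qed

lemma nice_dense:
  assumes f: "csL2 R f" and e: "e > 0"
  shows "\<exists>p. nice R p \<and> sqnorm (\<lambda>x. f x - p x) UNIV \<le> ennreal e"
proof -
  have fm[measurable]: "f \<in> borel_measurable M" using f by (simp add: csL2_def)
  have e4: "ennreal (e / 4) > 0" using e by simp
  from order_tendstoD(2)[OF clamp_dense[OF f] e4] obtain m :: nat
    where m: "sqnorm (\<lambda>x. f x - max (- real m) (min (real m) (f x))) UNIV < ennreal (e / 4)"
    by (auto simp: eventually_sequentially)
  obtain p where p: "\<And>n. nice R (p n)" "(\<lambda>n. sqnorm (\<lambda>x. max (- real m) (min (real m) (f x)) - p n x) UNIV) \<longlonglongrightarrow> 0"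
    using bounded_dense[OF f, of "real m"] by auto
  from order_tendstoD(2)[OF p(2) e4] obtain n
    where n: "sqnorm (\<lambda>x. max (- real m) (min (real m) (f x)) - p n x) UNIV < ennreal (e / 4)"
    by (auto simp: eventually_sequentially)
  have pm[measurable]: "p n \<in> borel_measurable M" using nice_csL2[OF p(1)] by (simp add: csL2_def)
  have "sqnorm (\<lambda>x. f x - p n x) UNIV \<le> 2 * sqnorm (\<lambda>x. f x - max (- real m) (min (real m) (f x))) UNIV + 2 * sqnorm (\<lambda>x. max (- real m) (min (real m) (f x)) - p n x) UNIV"
    by (rule sqnorm_add_le) auto
  also have "\<dots> \<le> 2 * ennreal (e / 4) + 2 * ennreal (e / 4)"
    using m n by (intro add_mono mult_left_mono) auto
  also have "\<dots> = ennreal e" using e by (simp flip: ennreal_numeral ennreal_mult ennreal_plus)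
  finally show ?thesis using p(1) by blast
qed

lemma csL2_diff:
  assumes f: "csL2 R f" and g: "csL2 R g"
  shows "csL2 R (\<lambda>x. f x - g x)"
proof -
  have fm[measurable]: "f \<in> borel_measurable M" and gm[measurable]: "g \<in> borel_measurable M" using f g by (auto simp: csL2_def)
  have "integrable M (\<lambda>x. (f x - g x)\<^sup>2)"
  proof (rule Bochner_Integration.integrable_bound[of M "\<lambda>x. 2 * (f x)\<^sup>2 + 2 * (g x)\<^sup>2"])
    have "(u - v)\<^sup>2 \<le> 2 * u\<^sup>2 + 2 * v\<^sup>2" for u v :: real
      using zero_le_power2[of "u + v"] by (simp add: power2_diff power2_sum)
    then show "AE x in M. norm ((f x - g x)\<^sup>2) \<le> norm (2 * (f x)\<^sup>2 + 2 * (g x)\<^sup>2)" by (intro AE_I2) simp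
  qed (use f g in \<open>auto simp: csL2_def\<close>)
  then show ?thesis using f g by (auto simp: csL2_def)
qed

lemma csL2_kernel_integrable:
  assumes f: "csL2 R f"
  shows "integrable M (\<lambda>x. f x * bker x y)"
proof (rule Bochner_Integration.integrable_bound[of M "\<lambda>x. \<bar>f x\<bar> * bmaj R y"])
  have [measurable]: "f \<in> borel_measurable M" using f by (simp add: csL2_def)
  show "(\<lambda>x. f x * bker x y) \<in> borel_measurable M" by measurable
  show "AE x in M. norm (f x * bker x y) \<le> norm (\<bar>f x\<bar> * bmaj R y)"
    using csL2_kernel_le[OF f, of _ y] bmaj_nonneg by (intro AE_I2) (simp add: abs_mult)
qed (use csL2_integrable[OF f] in auto)

lemma hank_diff:
  assumes f: "csL2 R f" and g: "csL2 R g"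
  shows "hank (\<lambda>x. f x - g x) y = hank f y - hank g y"
proof -
  show ?thesis
    unfolding hank_def left_diff_distrib by (rule Bochner_Integration.integral_diff[OF csL2_kernel_integrable[OF f] csL2_kernel_integrable[OF g]])
qed

text \<open>For nice functions let \<open>N\<close> tend to infinity in \<open>pairing_bound\<close>
  and absorb the half. The general case follows by approximation, since
  \<open>hank_contraction\<close> bounds the error on the transform side by the error in
  \<open>f\<close>.\<close>

lemma cs_inequality:
  "\<exists>\<epsilon>0>0. \<exists>C>0. \<forall>\<epsilon> S T R f. 0 \<le> \<epsilon> \<longrightarrow> \<epsilon> < \<epsilon>0 \<longrightarrow> thin \<alpha> \<epsilon> S \<longrightarrow> thin \<alpha> \<epsilon> T \<longrightarrow> csL2 R f \<longrightarrow>
    sqnorm f UNIV \<le> ennreal C * (sqnorm f (- S) + sqnorm (hank f) (- T))"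
proof -
  obtain \<epsilon>0 C where E: "\<epsilon>0 > 0" and C: "C > 0" and bd: "\<And>\<epsilon> S T R f N. 0 \<le> \<epsilon> \<Longrightarrow> \<epsilon> < \<epsilon>0 \<Longrightarrow> thin \<alpha> \<epsilon> S \<Longrightarrow> thin \<alpha> \<epsilon> T \<Longrightarrow> csL2 R f \<Longrightarrow>
    ennreal (pairing (1 / 2 ^ N) (1 / 2 ^ N) f) \<le> ennreal (1/2) * sqnorm f UNIV + ennreal C * (sqnorm f (- S) + sqnorm (hank f) (- T))"
    using pairing_bound by blast
  have main: "sqnorm f UNIV \<le> ennreal (8 * C) * (sqnorm f (- S) + sqnorm (hank f) (- T))"
    if e: "0 \<le> \<epsilon>" "\<epsilon> < \<epsilon>0" and S: "thin \<alpha> \<epsilon> S" and T: "thin \<alpha> \<epsilon> T" and f: "csL2 R f" for \<epsilon> S T R f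
  proof -
    have fm[measurable]: "f \<in> borel_measurable M" using f by (simp add: csL2_def)
    note hm[measurable] = hank_measurable[OF f]
    have Sm[measurable]: "- S \<in> sets M" "- T \<in> sets M"
      by (rule thin_compl[OF S], rule thin_compl[OF T])
    have nice: "sqnorm p UNIV \<le> 2 * (ennreal C * (sqnorm p (- S) + sqnorm (hank p) (- T)))" if p: "nice R p" for p
    proof -
      note cs = nice_csL2[OF p]
      have "ennreal (\<integral>x. (p x)\<^sup>2 \<partial>M) \<le> ennreal (1/2) * sqnorm p UNIV + ennreal C * (sqnorm p (- S) + sqnorm (hank p) (- T))"
        by (rule LIMSEQ_le_const2[OF tendsto_ennrealI[OF pairing_tendsto[OF p]]]) (use bd[OF e S T cs] in blast)
      then show ?thesis unfolding sqnorm_eq[OF cs] by (rule absorb_half) simp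
    qed
    show ?thesis
    proof (rule ennreal_le_epsilon)
      fix d :: real assume d: "d > 0"
      \<comment> \<open>The three approximations below cost \<open>(16 * C + 2) * r\<close> in
        total: \<open>16 * C\<close> from the two norms on the right, 2 from the norm of
        \<open>f\<close>.\<close>
      define r where "r = d / (16 * C + 2)"
      have r: "r > 0" using d C by (simp add: r_def)
      obtain p where p: "nice R p" "sqnorm (\<lambda>x. f x - p x) UNIV \<le> ennreal r" using nice_dense[OF f r] by blast
      note cs = nice_csL2[OF p(1)]
      have pm[measurable]: "p \<in> borel_measurable M" using cs by (simp add: csL2_def)
      note hpm[measurable] = hank_measurable[OF cs]
      define q where "q x = p x - f x" for x
      have qm[measurable]: "q \<in> borel_measurable M" unfolding q_def[abs_def] by measurable
      have q: "csL2 R q" unfolding q_def[abs_def] by (rule csL2_diff[OF cs f])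
      note hqm[measurable] = hank_measurable[OF q]
      have Nq: "sqnorm q UNIV \<le> ennreal r" using p(2) unfolding sqnorm_real q_def by (simp add: power2_commute)
      have Nhq: "sqnorm (hank q) UNIV \<le> ennreal r" using hank_contraction[OF q] Nq by simp
      have hq: "hank p x = hank f x + hank q x" for x
        unfolding q_def[abs_def] hank_diff[OF cs f] by simp
      have 1: "sqnorm f UNIV \<le> 2 * sqnorm p UNIV + 2 * ennreal r"
      proof -
        have "sqnorm f UNIV \<le> 2 * sqnorm p UNIV + 2 * sqnorm (\<lambda>x. f x - p x) UNIV" by (rule sqnorm_add_le) auto
        also have "\<dots> \<le> 2 * sqnorm p UNIV + 2 * ennreal r" by (intro add_mono mult_left_mono p order_refl) auto
        finally show ?thesis .
      qed
      have 2: "sqnorm p (- S) \<le> 2 * sqnorm f (- S) + 2 * ennreal r"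
      proof -
        have "sqnorm p (- S) \<le> 2 * sqnorm f (- S) + 2 * sqnorm q (- S)" by (rule sqnorm_add_le[OF fm qm Sm(1)]) (simp add: q_def)
        also have "\<dots> \<le> 2 * sqnorm f (- S) + 2 * ennreal r" by (intro add_mono mult_left_mono order_trans[OF sqnorm_mono[OF subset_UNIV] Nq] order_refl) auto
        finally show ?thesis .
      qed
      have 3: "sqnorm (hank p) (- T) \<le> 2 * sqnorm (hank f) (- T) + 2 * ennreal r"
      proof -
        have "sqnorm (hank p) (- T) \<le> 2 * sqnorm (hank f) (- T) + 2 * sqnorm (hank q) (- T)" by (rule sqnorm_add_le[OF hm hqm Sm(2)]) (rule hq)
        also have "\<dots> \<le> 2 * sqnorm (hank f) (- T) + 2 * ennreal r" by (intro add_mono mult_left_mono order_trans[OF sqnorm_mono[OF subset_UNIV] Nhq] order_refl) auto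
        finally show ?thesis .
      qed
      define u where "u = sqnorm f (- S)"
      define v where "v = sqnorm (hank f) (- T)"
      have "sqnorm f UNIV \<le> 2 * (2 * (ennreal C * ((2 * u + 2 * ennreal r) + (2 * v + 2 * ennreal r)))) + 2 * ennreal r"
        unfolding u_def v_def
        by (intro order_trans[OF 1] add_mono mult_left_mono order_trans[OF nice[OF p(1)]] 2 3 order_refl) auto
      also have "\<dots> = ennreal (8 * C) * (u + v) + ennreal (16 * C + 2) * ennreal r"
      proof -
        have "16 * C + 2 = (8 * C + 8 * C) + 2" by simp
        then have "ennreal (16 * C + 2) = (ennreal (8 * C) + ennreal (8 * C)) + ennreal 2"
          using C by (simp only: ennreal_plus mult_nonneg_nonneg add_nonneg_nonneg less_imp_le zero_le_numeral)
        moreover have "ennreal (8 * C) = 8 * ennreal C" using C by (simp add: ennreal_mult)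
        ultimately have "ennreal (8 * C) = 8 * ennreal C" "ennreal (16 * C + 2) = 8 * ennreal C + 8 * ennreal C + 2"
          by simp_all
        then show ?thesis by (simp add: distrib_left distrib_right mult_ac add_ac)
      qed
      also have "\<dots> \<le> ennreal (8 * C) * (u + v) + ennreal d"
      proof -
        have "ennreal (16 * C + 2) * ennreal r = ennreal d"
        proof -
          have "ennreal (16 * C + 2) * ennreal r = ennreal ((16 * C + 2) * r)"
            using C r by (intro ennreal_mult[symmetric]) auto
          also have "(16 * C + 2) * r = d" using C by (simp add: r_def)
          finally show ?thesis .
        qed
        then show ?thesis by simp
      qed
      finally show "sqnorm f UNIV \<le> ennreal (8 * C) * (sqnorm f (- S) + sqnorm (hank f) (- T)) + ennreal d"
        by (simp add: u_def v_def)
    qed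
  qed
  have "8 * C > 0" using C by simp
  show ?thesis
    by (rule exI[of _ \<epsilon>0], rule conjI[OF E], rule exI[of _ "8 * C"], rule conjI[OF \<open>8 * C > 0\<close>], intro allI impI, rule main)
qed

subsection \<open>General complex functions\<close>

lemma L2norm_sqnorm: "L2norm \<alpha> D f = sqrt (enn2real (sqnorm f D))"
  by (simp add: L2norm_def sqnorm_def mult.commute)

lemma L2_sqnorm: "L2 \<alpha> f \<longleftrightarrow> f \<in> borel_measurable M \<and> sqnorm f UNIV < \<infinity>"
  by (simp add: L2_def sqnorm_def)

lemma N2_Compl: "sqnorm f ({0..} - S) = sqnorm f (- S)"
  unfolding sqnorm_def
  by (rule nn_integral_cong_AE, use AE_M_nonneg in eventually_elim) (auto simp: indicator_def)

lemma sqnorm_split: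
  assumes [measurable]: "u \<in> borel_measurable M" "v \<in> borel_measurable M" "T \<in> sets M" and h: "\<And>x. h x = Complex (u x) (v x)"
  shows "sqnorm h T = sqnorm u T + sqnorm v T"
proof -
  have "sqnorm h T = (\<integral>\<^sup>+x. ennreal ((u x)\<^sup>2) * indicator T x + ennreal ((v x)\<^sup>2) * indicator T x \<partial>M)"
    unfolding sqnorm_def h by (intro nn_integral_cong) (simp add: cmod_power2 indicator_def flip: ennreal_plus)
  also have "\<dots> = sqnorm u T + sqnorm v T"
    unfolding sqnorm_real by (rule nn_integral_add) measurable
  finally show ?thesis .
qed

lemma csL2_trunc:
  fixes f :: "real \<Rightarrow> complex"
  assumes f: "f \<in> borel_measurable M" and fin: "sqnorm f UNIV < \<infinity>"
    and u: "u \<in> borel_measurable M" "\<And>x. \<bar>u x\<bar> \<le> cmod (f x)"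
  shows "csL2 R (\<lambda>x. u x * indicator {0..R} x)"
proof -
  note [measurable] = u(1) f
  have m: "(\<lambda>x. u x * indicator {0..R} x) \<in> borel_measurable M" by measurable
  have "integrable M (\<lambda>x. (u x * indicator {0..R} x)\<^sup>2)"
  proof (rule integrableI_bounded)
    have "(\<integral>\<^sup>+x. ennreal (norm ((u x * indicator {0..R} x)\<^sup>2)) \<partial>M) \<le> sqnorm f UNIV"
      unfolding sqnorm_def
    proof (intro nn_integral_mono)
      fix x
      have "(u x)\<^sup>2 \<le> (cmod (f x))\<^sup>2" using power_mono[OF u(2)[of x], of 2] by simp
      then show "ennreal (norm ((u x * indicator {0..R} x)\<^sup>2)) \<le> ennreal ((cmod (f x))\<^sup>2) * indicator UNIV x"
        by (auto simp: indicator_def intro: ennreal_leI)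
    qed
    then show "(\<integral>\<^sup>+x. ennreal (norm ((u x * indicator {0..R} x)\<^sup>2)) \<partial>M) < \<infinity>" using fin by (rule le_less_trans)
  qed (use m in measurable)
  then show ?thesis using m by (auto simp: csL2_def)
qed

text \<open>The Bessel kernel is real, so the transform acts on real and imaginary parts
  separately.\<close>

lemma FB_hank:
  assumes u: "csL2 R u" and v: "csL2 R v" and h: "\<And>x. h x = Complex (u x) (v x)"
  shows "FB \<alpha> h y = Complex (hank u y) (hank v y)"
proof -
  have "FB \<alpha> h y = (\<integral>x. complex_of_real (u x * bker x y) + \<i> * complex_of_real (v x * bker x y) \<partial>M)"
    unfolding FB_def h bker_def[symmetric] by (intro Bochner_Integration.integral_cong refl) (simp add: complex_eq_iff)
  also have "\<dots> = (\<integral>x. complex_of_real (u x * bker x y) \<partial>M) + (\<integral>x. \<i> * complex_of_real (v x * bker x y) \<partial>M)"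
    using csL2_kernel_integrable[OF u] csL2_kernel_integrable[OF v]
    by (intro Bochner_Integration.integral_add integrable_mult_right integrable_of_real) auto
  also have "\<dots> = complex_of_real (hank u y) + \<i> * complex_of_real (hank v y)"
    unfolding hank_def by (simp only: integral_mult_right_zero integral_complex_of_real)
  finally show ?thesis by (simp add: complex_eq_iff)
qed

lemma sqnorm_trunc_tendsto:
  fixes f :: "real \<Rightarrow> complex"
  assumes f: "f \<in> borel_measurable M" and fin: "sqnorm f UNIV < \<infinity>"
  shows "(\<lambda>n. sqnorm (\<lambda>x. f x * indicator {0..real n} x) UNIV) \<longlonglongrightarrow> sqnorm f UNIV"
proof -
  note [measurable] = f
  show ?thesis unfolding sqnorm_def
  proof (rule nn_integral_dominated_convergence[where w = "\<lambda>x. ennreal ((cmod (f x))\<^sup>2) * indicator UNIV x"])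
    show "(\<integral>\<^sup>+x. ennreal ((cmod (f x))\<^sup>2) * indicator UNIV x \<partial>M) < \<infinity>" using fin by (simp add: sqnorm_def)
    show "AE x in M. ennreal ((cmod (f x * indicator {0..real n} x))\<^sup>2) * indicator UNIV x \<le> ennreal ((cmod (f x))\<^sup>2) * indicator UNIV x" for n
      by (intro AE_I2) (auto simp: indicator_def)
    show "AE x in M. (\<lambda>n. ennreal ((cmod (f x * indicator {0..real n} x))\<^sup>2) * indicator UNIV x) \<longlonglongrightarrow> ennreal ((cmod (f x))\<^sup>2) * indicator UNIV x"
      using AE_M_nonneg
    proof eventually_elim
      fix x :: real assume x: "0 \<le> x"
      obtain k :: nat where k: "x \<le> real k" using real_arch_simple by blast
      have "eventually (\<lambda>n. ennreal ((cmod (f x * indicator {0..real n} x))\<^sup>2) * indicator UNIV x = ennreal ((cmod (f x))\<^sup>2) * indicator UNIV x) sequentially"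
        using eventually_ge_at_top[of k]
      proof eventually_elim
        case (elim n)
        then have "x \<in> {0..real n}" using x k by auto
        then show ?case by simp
      qed
      then show "(\<lambda>n. ennreal ((cmod (f x * indicator {0..real n} x))\<^sup>2) * indicator UNIV x) \<longlonglongrightarrow> ennreal ((cmod (f x))\<^sup>2) * indicator UNIV x"
        by (rule tendsto_eventually)
    qed
  qed measurable
qed

text \<open>Apply the hypothesis to the real and imaginary parts of the truncations of
  \<open>f\<close> to \<open>{0..n}\<close>, add, and let \<open>n\<close> tend to infinity. The
  transforms of the truncations converge to \<open>g\<close> by the definition of
  \<open>FB_L2\<close>, used along the integers.\<close>

lemma L2_inequality:
  assumes ineq: "\<And>R u. csL2 R u \<Longrightarrow> sqnorm u UNIV \<le> ennreal C * (sqnorm u (- S) + sqnorm (hank u) (- T))"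
    and C: "C > 0" and Sm: "- S \<in> sets M" "- T \<in> sets M" and f: "L2 \<alpha> f" and g: "FB_L2 \<alpha> f g"
  shows "L2norm \<alpha> UNIV f \<le> sqrt (2 * C) * (L2norm \<alpha> ({0..} - S) f + L2norm \<alpha> ({0..} - T) g)"
proof -
  have fm[measurable]: "f \<in> borel_measurable M" and fin: "sqnorm f UNIV < \<infinity>" using f by (auto simp: L2_sqnorm)
  have gm[measurable]: "g \<in> borel_measurable M" and gfin: "sqnorm g UNIV < \<infinity>" using g by (auto simp: FB_L2_def L2_sqnorm)
  note [measurable] = Sm
  define fn where "fn n = (\<lambda>x. f x * indicator {0..real n} x)" for n :: nat
  define u where "u n x = Re (f x) * indicator {0..real n} x" for n :: nat and x
  define v where "v n x = Im (f x) * indicator {0..real n} x" for n :: nat and x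
  have un: "csL2 (real n) (u n)" for n unfolding u_def[abs_def]
    by (rule csL2_trunc[OF fm fin]) (auto intro: abs_Re_le_cmod)
  have vn: "csL2 (real n) (v n)" for n unfolding v_def[abs_def]
    by (rule csL2_trunc[OF fm fin]) (auto intro: abs_Im_le_cmod)
  have um[measurable]: "u n \<in> borel_measurable M" and vm[measurable]: "v n \<in> borel_measurable M" for n
    using un vn by (auto simp: csL2_def)
  note hum[measurable] = hank_measurable[OF un] and hvm[measurable] = hank_measurable[OF vn]
  have fn: "fn n x = Complex (u n x) (v n x)" for n x
    by (simp add: fn_def u_def v_def complex_eq_iff indicator_def)
  have FBn: "FB \<alpha> (fn n) y = Complex (hank (u n) y) (hank (v n) y)" for n y
    by (rule FB_hank[OF un vn fn])
  have FBm[measurable]: "FB \<alpha> (fn n) \<in> borel_measurable M" for n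
  proof -
    have "FB \<alpha> (fn n) = (\<lambda>y. complex_of_real (hank (u n) y) + \<i> * complex_of_real (hank (v n) y))"
      by (rule ext) (simp add: FBn complex_eq_iff)
    then show ?thesis by simp
  qed
  have n1: "sqnorm (fn n) U = sqnorm (u n) U + sqnorm (v n) U" if "U \<in> sets M" for n U
    by (rule sqnorm_split[OF um vm that fn])
  have n2: "sqnorm (FB \<alpha> (fn n)) U = sqnorm (hank (u n)) U + sqnorm (hank (v n)) U" if "U \<in> sets M" for n U
    by (rule sqnorm_split[OF hum hvm that FBn])
  have U: "UNIV \<in> sets M" by simp
  have fnle: "sqnorm (fn n) U \<le> sqnorm f U" for n U
    unfolding sqnorm_def fn_def by (intro nn_integral_mono) (auto simp: indicator_def)
  have FBfin: "sqnorm (FB \<alpha> (fn n)) UNIV < \<infinity>" for n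
  proof -
    have "sqnorm (FB \<alpha> (fn n)) UNIV \<le> sqnorm (fn n) UNIV"
      unfolding n1[OF U] n2[OF U] by (intro add_mono hank_contraction[OF un] hank_contraction[OF vn])
    also have "\<dots> \<le> sqnorm f UNIV" by (rule fnle)
    finally show ?thesis using fin by simp
  qed
  define r where "r n = sqnorm (\<lambda>y. FB \<alpha> (fn n) y - g y) UNIV" for n
  \<comment> \<open>\<open>enn2real\<close> sends infinity to 0, so the convergence of
    \<open>L2norm\<close> implies that of \<open>r\<close> only once \<open>r n\<close> is known to
    be finite.\<close>
  have rfin: "r n < \<infinity>" for n
  proof -
    have "r n \<le> 2 * sqnorm (FB \<alpha> (fn n)) UNIV + 2 * sqnorm (\<lambda>y. - g y) UNIV"
      unfolding r_def by (rule sqnorm_add_le) auto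
    also have "sqnorm (\<lambda>y. - g y) UNIV = sqnorm g UNIV" by (simp add: sqnorm_def)
    also have "2 * sqnorm (FB \<alpha> (fn n)) UNIV + 2 * sqnorm g UNIV < \<infinity>"
      using FBfin[of n] gfin by (simp add: ennreal_mult_less_top)
    finally show ?thesis .
  qed
  have rlim: "r \<longlonglongrightarrow> 0"
  proof -
    have "((\<lambda>R. L2norm \<alpha> UNIV (\<lambda>y. FB \<alpha> (\<lambda>x. f x * indicator {0..R} x) y - g y)) \<longlongrightarrow> 0) at_top"
      using g by (simp add: FB_L2_def)
    from filterlim_compose[OF this filterlim_real_sequentially]
    have "(\<lambda>n. L2norm \<alpha> UNIV (\<lambda>y. FB \<alpha> (fn n) y - g y)) \<longlonglongrightarrow> 0" by (simp add: fn_def)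
    then have "(\<lambda>n. sqrt (enn2real (r n))) \<longlonglongrightarrow> 0" by (simp add: L2norm_sqnorm r_def)
    then have "(\<lambda>n. (sqrt (enn2real (r n)))\<^sup>2) \<longlonglongrightarrow> 0\<^sup>2" by (intro tendsto_power)
    then have "(\<lambda>n. enn2real (r n)) \<longlonglongrightarrow> 0" by simp
    then have "(\<lambda>n. ennreal (enn2real (r n))) \<longlonglongrightarrow> ennreal 0" by (rule tendsto_ennrealI)
    then show ?thesis using rfin by (simp add: less_top)
  qed
  have step: "sqnorm (fn n) UNIV \<le> ennreal C * (sqnorm f (- S) + (2 * sqnorm g (- T) + 2 * r n))" for n
  proof -
    have "sqnorm (fn n) UNIV \<le> ennreal C * (sqnorm (u n) (- S) + sqnorm (hank (u n)) (- T)) + ennreal C * (sqnorm (v n) (- S) + sqnorm (hank (v n)) (- T))"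
      unfolding n1[OF U] by (intro add_mono ineq[OF un] ineq[OF vn])
    also have "\<dots> = ennreal C * (sqnorm (fn n) (- S) + sqnorm (FB \<alpha> (fn n)) (- T))"
      unfolding n1[OF Sm(1)] n2[OF Sm(2)] by (simp add: distrib_left add_ac)
    also have "\<dots> \<le> ennreal C * (sqnorm f (- S) + (2 * sqnorm g (- T) + 2 * r n))"
    proof (intro mult_left_mono add_mono fnle)
      have "sqnorm (FB \<alpha> (fn n)) (- T) \<le> 2 * sqnorm g (- T) + 2 * sqnorm (\<lambda>y. FB \<alpha> (fn n) y - g y) (- T)"
        by (rule sqnorm_add_le[OF gm _ Sm(2)]) auto
      also have "\<dots> \<le> 2 * sqnorm g (- T) + 2 * r n"
        unfolding r_def by (intro add_mono mult_left_mono sqnorm_mono order_refl) auto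
      finally show "sqnorm (FB \<alpha> (fn n)) (- T) \<le> 2 * sqnorm g (- T) + 2 * r n" .
    qed auto
    finally show ?thesis .
  qed
  have bfin: "sqnorm f (- S) < \<infinity>" "sqnorm g (- T) < \<infinity>"
    using le_less_trans[OF sqnorm_mono[of "- S" UNIV f] fin] le_less_trans[OF sqnorm_mono[of "- T" UNIV g] gfin] by auto
  obtain a where a: "sqnorm f UNIV = ennreal a" "a \<ge> 0" using fin by (cases "sqnorm f UNIV") auto
  obtain b where b: "sqnorm f (- S) = ennreal b" "b \<ge> 0" using bfin by (cases "sqnorm f (- S)") auto
  obtain c where c: "sqnorm g (- T) = ennreal c" "c \<ge> 0" using bfin by (cases "sqnorm g (- T)") auto
  have "sqnorm f UNIV \<le> ennreal C * (sqnorm f (- S) + (2 * sqnorm g (- T) + 2 * 0))"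
  proof (rule LIMSEQ_le)
    show "(\<lambda>n. sqnorm (fn n) UNIV) \<longlonglongrightarrow> sqnorm f UNIV" unfolding fn_def by (rule sqnorm_trunc_tendsto[OF fm fin])
    show "(\<lambda>n. ennreal C * (sqnorm f (- S) + (2 * sqnorm g (- T) + 2 * r n))) \<longlonglongrightarrow> ennreal C * (sqnorm f (- S) + (2 * sqnorm g (- T) + 2 * 0))"
      by (intro ennreal_tendsto_cmult tendsto_add tendsto_const rlim) auto
  qed (use step in auto)
  then have "ennreal a \<le> ennreal (C * (b + 2 * c))"
    using b c C by (simp add: a ennreal_mult ennreal_plus)
  then have "a \<le> C * (b + 2 * c)" using b c C by (subst (asm) ennreal_le_iff) auto
  \<comment> \<open>The factor 2 on \<open>c\<close> comes from replacing the transform of a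
    truncation by \<open>g\<close>; enlarging both terms equally yields the constant
    \<open>sqrt (2 * C)\<close>.\<close>
  also have "\<dots> \<le> 2 * C * (b + c)" using b c C by (simp add: algebra_simps)
  also have "\<dots> \<le> 2 * C * (sqrt b + sqrt c)\<^sup>2"
    using b c C by (intro mult_left_mono) (auto simp: power2_sum)
  finally have "sqrt a \<le> sqrt (2 * C * (sqrt b + sqrt c)\<^sup>2)" by (rule real_sqrt_le_mono)
  also have "\<dots> = sqrt (2 * C) * (sqrt b + sqrt c)"
    using b c C by (simp add: real_sqrt_mult)
  finally show ?thesis using a b c by (simp add: L2norm_sqnorm N2_Compl)
qed

end

theorem theoremB:
  fixes \<alpha> :: real
  assumes "\<alpha> > -1/2"
  shows "\<exists>\<epsilon>0>0. \<forall>\<epsilon>. 0 < \<epsilon> \<and> \<epsilon> < \<epsilon>0 \<and> \<epsilon> < 1 \<longrightarrow>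
           (\<exists>C. \<forall>S \<Sigma> f g. thin \<alpha> \<epsilon> S \<longrightarrow> thin \<alpha> \<epsilon> \<Sigma> \<longrightarrow> L2 \<alpha> f \<longrightarrow> FB_L2 \<alpha> f g \<longrightarrow>
              L2norm \<alpha> UNIV f \<le> C * (L2norm \<alpha> ({0..} - S) f + L2norm \<alpha> ({0..} - \<Sigma>) g))"
proof -
  interpret hankel \<alpha> by unfold_locales (rule assms)
  obtain \<epsilon>0 C where E: "\<epsilon>0 > 0" and C: "C > 0"
    and ineq: "\<And>\<epsilon> S T R f. 0 \<le> \<epsilon> \<Longrightarrow> \<epsilon> < \<epsilon>0 \<Longrightarrow> thin \<alpha> \<epsilon> S \<Longrightarrow> thin \<alpha> \<epsilon> T \<Longrightarrow> csL2 R f \<Longrightarrow>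
      sqnorm f UNIV \<le> ennreal C * (sqnorm f (- S) + sqnorm (hank f) (- T))"
    using cs_inequality by blast
  show ?thesis
  proof (rule exI[of _ \<epsilon>0], intro conjI E allI impI)
    fix \<epsilon> assume e: "0 < \<epsilon> \<and> \<epsilon> < \<epsilon>0 \<and> \<epsilon> < 1"
    show "\<exists>C. \<forall>S \<Sigma> f g. thin \<alpha> \<epsilon> S \<longrightarrow> thin \<alpha> \<epsilon> \<Sigma> \<longrightarrow> L2 \<alpha> f \<longrightarrow> FB_L2 \<alpha> f g \<longrightarrow>
              L2norm \<alpha> UNIV f \<le> C * (L2norm \<alpha> ({0..} - S) f + L2norm \<alpha> ({0..} - \<Sigma>) g)"
    \<comment> \<open>One constant serves all \<open>\<epsilon>\<close> below the threshold, since
      \<open>\<epsilon>\<close> enters only through \<open>\<epsilon> < \<epsilon>0\<close>.\<close>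
    proof (rule exI[of _ "sqrt (2 * C)"], intro allI impI)
      fix S \<Sigma> f g
      assume S: "thin \<alpha> \<epsilon> S" and T: "thin \<alpha> \<epsilon> \<Sigma>" and f: "L2 \<alpha> f" and g: "FB_L2 \<alpha> f g"
      show "L2norm \<alpha> UNIV f \<le> sqrt (2 * C) * (L2norm \<alpha> ({0..} - S) f + L2norm \<alpha> ({0..} - \<Sigma>) g)"
        by (rule L2_inequality[OF _ C thin_compl[OF S] thin_compl[OF T] f g], rule ineq[OF _ _ S T])
           (use e in auto)
    qed
  qed
qed

end
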